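(* Let $n\ge3$ and $m\ge3$ be integers. Then the involutive cone incidence (with $d=m$) $\widetilde\rho_m:\mathbb P(\widetilde{\mathcal F}^m_m)\to\mathbb B^m_m$ in $\mathbb P^{2n-1}$ is birational.
   Context: We work over $\mathbb C$; $(V,\omega)$ is a complex symplectic vector space of dimension $2n$ and $\mathbb P^{2n-1}=\mathbb P(V)$. For a hyperplane $H=V(\ell)$, the polar point is $\sigma(H)=[v_\ell]\in H$, where $\ell(u)=\omega(v_\ell,u)$ for all $u\in V$. For a vector bundle $E$ on a base $B$, $\pi:\mathbb P(E)\to B$ parametrizes one-dimensional subspaces of the fibers, with tautological line subbundle $\mathcal O_{\mathbb P(E)}(-1)=\mathcal O_E(-1)\subset\pi^*E$; $\operatorname{Sym}^kE=0$ for $k<0$; pullbacks of bundles are not written. Let $\check{\mathbb P}^{2n-1}$ be the space of hyperplanes of $\mathbb P(V)$ and $\mathcal F=V^\vee\otimes\mathcal O_{\check{\mathbb P}^{2n-1}}$. The tautological sequence $0\to\mathcal O_{\check{\mathbb P}^{2n-1}}(-1)\to\mathcal F\to\mathcal Q\to0$ defines $\mathcal Q$ (its fiber at $H$ is the space of linear forms on $H$). The bundle $\mathbb P(\mathcal Q^\vee)$ parametrizes pairs $(H,p)$ with $p\in H$; on it $0\to\mathcal G\to\mathcal Q\to\mathcal O_{\mathcal Q^\vee}(1)\to0$ defines $\mathcal G$, whose fiber at $(H,p)$ is the space of linear forms on $H$ vanishing at $p$. Let $s_\sigma:\check{\mathbb P}^{2n-1}\to\mathbb P(\mathcal Q^\vee)$,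 $H\mapsto(H,\sigma(H))$, and $\mathcal G_\sigma=s_\sigma^*\mathcal G$. For $d\ge m$ set $\mathbb Y_m=\mathbb P(\operatorname{Sym}^m\mathcal G_\sigma)$: its points are pairs $(H,[q])$ with $H$ a hyperplane and $q\ne0$ a degree-$m$ form on $H$ that is a polynomial in the linear forms on $H$ vanishing at $\sigma(H)$ (the equation of a possibly nonreduced cone in $H$ whose vertex contains $\sigma(H)$). Over $\mathbb Y_m$, multiplication gives an inclusion $\mathcal O_{\operatorname{Sym}^m\mathcal G_\sigma}(-1)\otimes\operatorname{Sym}^{d-m}\mathcal Q\hookrightarrow\operatorname{Sym}^d\mathcal Q$, and $\widetilde{\mathcal F}^m_d\subset\operatorname{Sym}^d\mathcal F$ is the inverse image of this subbundle under $\operatorname{Sym}^d\mathcal F\to\operatorname{Sym}^d\mathcal Q$. Thus the fiber of $\widetilde{\mathcal F}^m_d$ over $(H,[q])$ consists of the degree-$d$ forms on $V$ whose restriction to $H$ is a multiple of $q$. The involutive cone incidence $\widetilde\rho_m:\mathbb P(\widetilde{\mathcal F}^m_d)\to\mathbb P(\operatorname{Sym}^dV^\vee)$ is the map induced by $\widetilde{\mathcal F}^m_d\subset\operatorname{Sym}^dV^\vee\otimes\mathcal O$, and $\mathbb B^m_d$ is its image. *)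

theory Defs
  imports "HOL-Analysis.Analysis" "HOL-Library.Function_Algebras"
begin

section \<open>Linear forms, symmetric powers, polynomial functions\<close>

text \<open>Vector spaces are given, as in \<open>HOL.Vector_Spaces\<close>, by their scalar multiplication.\<close>

definition dual :: "(complex \<Rightarrow> 'w::ab_group_add \<Rightarrow> 'w) \<Rightarrow> ('w \<Rightarrow> complex) set" where
  "dual smul = {l. Vector_Spaces.linear smul (*) l}"

definition fscale :: "complex \<Rightarrow> ('a \<Rightarrow> complex) \<Rightarrow> ('a \<Rightarrow> complex)" where
  "fscale c f = (\<lambda>x. c * f x)"

abbreviation fspan :: "('a \<Rightarrow> complex) set \<Rightarrow> ('a \<Rightarrow> complex) set" where
  "fspan \<equiv> module.span fscale"

text \<open>If \<open>L\<close> is a space of linear forms, \<open>Sym k L\<close> is its \<open>k\<close>-th symmetric power: as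
  \<open>\<complex>\<close> is infinite, a form is the same thing as the polynomial function it defines.\<close>

definition Sym :: "nat \<Rightarrow> ('a \<Rightarrow> complex) set \<Rightarrow> ('a \<Rightarrow> complex) set" where
  "Sym k L = fspan {\<lambda>x. (\<Prod>i<k. l i x) | l. \<forall>i<k. l i \<in> L}"

definition polyfun :: "(complex \<Rightarrow> 'w::ab_group_add \<Rightarrow> 'w) \<Rightarrow> ('w \<Rightarrow> complex) set" where
  "polyfun smul = fspan (\<Union>k. Sym k (dual smul))"

section \<open>Varieties as spaces with functions\<close>

text \<open>The Zariski topology is only used on subsets of finite-dimensional subspaces of \<open>'w\<close>;
  there it is the usual one, also when \<open>'w\<close> itself (a function space) is infinite-dimensional,
  because linear forms on a subspace extend.\<close>

definition zariski :: "(complex \<Rightarrow> 'w::ab_group_add \<Rightarrow> 'w) \<Rightarrow> 'w topology" where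
  "zariski smul = topology_generated_by {{w. p w \<noteq> 0} | p. p \<in> polyfun smul}"

definition regular_on ::
    "(complex \<Rightarrow> 'w::ab_group_add \<Rightarrow> 'w) \<Rightarrow> 'w set \<Rightarrow> ('w \<Rightarrow> complex) \<Rightarrow> bool" where
  "regular_on smul S g \<longleftrightarrow>
     (\<forall>w\<in>S. \<exists>N p q. openin (subtopology (zariski smul) S) N \<and> w \<in> N \<and>
        p \<in> polyfun smul \<and> q \<in> polyfun smul \<and> (\<forall>z\<in>N. q z \<noteq> 0 \<and> g z = p z / q z))"

text \<open>A variety is described by its Zariski topology and its sheaf of regular functions:
  \<open>reg X U g\<close> says that \<open>g\<close> is regular on the open set \<open>U\<close> (the values of \<open>g\<close> outside
  \<open>U\<close> are irrelevant).\<close>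

record 'p space_with_functions =
  zar :: "'p topology"
  reg :: "'p set \<Rightarrow> ('p \<Rightarrow> complex) \<Rightarrow> bool"

definition morphism ::
    "'p space_with_functions \<Rightarrow> 'q space_with_functions \<Rightarrow> ('p \<Rightarrow> 'q) \<Rightarrow> bool" where
  "morphism X Y \<phi> \<longleftrightarrow> continuous_map (zar X) (zar Y) \<phi> \<and>
     (\<forall>U g. openin (zar Y) U \<and> reg Y U g \<longrightarrow>
        reg X {x \<in> topspace (zar X). \<phi> x \<in> U} (g \<circ> \<phi>))"

definition isomorphism ::
    "'p space_with_functions \<Rightarrow> 'q space_with_functions \<Rightarrow> ('p \<Rightarrow> 'q) \<Rightarrow> bool" where
  "isomorphism X Y \<phi> \<longleftrightarrow> morphism X Y \<phi> \<and>
     (\<exists>\<psi>. morphism Y X \<psi> \<and> (\<forall>x\<in>topspace (zar X). \<psi> (\<phi> x) = x) \<and>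
          (\<forall>y\<in>topspace (zar Y). \<phi> (\<psi> y) = y))"

definition open_subspace :: "'p space_with_functions \<Rightarrow> 'p set \<Rightarrow> 'p space_with_functions" where
  "open_subspace X U = \<lparr>zar = subtopology (zar X) U, reg = reg X\<rparr>"

definition dense_open :: "'p space_with_functions \<Rightarrow> 'p set \<Rightarrow> bool" where
  "dense_open X U \<longleftrightarrow> openin (zar X) U \<and> zar X closure_of U = topspace (zar X)"

definition birational_morphism ::
    "'p space_with_functions \<Rightarrow> 'q space_with_functions \<Rightarrow> ('p \<Rightarrow> 'q) \<Rightarrow> bool" where
  "birational_morphism X Y \<phi> \<longleftrightarrow> morphism X Y \<phi> \<and>
     (\<exists>U U'. dense_open X U \<and> dense_open Y U' \<and>
        isomorphism (open_subspace X U) (open_subspace Y U') \<phi>)"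

text \<open>A set \<open>X\<close> of points gets its structure of variety from homogeneous coordinates: \<open>\<pi>\<close> maps
  a coordinate vector, taken in the finite-dimensional subspace \<open>W\<close>, to the point it
  represents, and the subset \<open>W \<inter> \<pi> -` X\<close> of \<open>W\<close> is mapped onto \<open>X\<close>. A set of points is open,
  and a function on it is regular, if this is so after pulling back to coordinate vectors.
  For \<open>\<pi>\<close> sending \<open>w\<close> to the line spanned by \<open>w\<close>, this is the (reduced) structure of a
  subvariety of \<open>P(W)\<close>. More generally it is the right structure of variety
  whenever \<open>\<pi>\<close> is a morphism having local sections on \<open>X\<close>.\<close>

definition coordinate_space ::
    "(complex \<Rightarrow> 'w::ab_group_add \<Rightarrow> 'w) \<Rightarrow> 'w set \<Rightarrow> ('w \<Rightarrow> 'p) \<Rightarrow> 'p set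
      \<Rightarrow> 'p space_with_functions" where
  "coordinate_space smul W \<pi> X =
     \<lparr>zar = topology (\<lambda>U. U \<subseteq> X \<and>
        openin (subtopology (zariski smul) (W \<inter> \<pi> -` X)) (W \<inter> \<pi> -` U)),
      reg = (\<lambda>U g. regular_on smul (W \<inter> \<pi> -` U) (g \<circ> \<pi>))\<rparr>"

lemma openin_coordinate_space:
  "openin (zar (coordinate_space smul W \<pi> X)) U \<longleftrightarrow>
     U \<subseteq> X \<and> openin (subtopology (zariski smul) (W \<inter> \<pi> -` X)) (W \<inter> \<pi> -` U)"
proof -
  let ?S = "subtopology (zariski smul) (W \<inter> \<pi> -` X)"
  have "istopology (\<lambda>U. U \<subseteq> X \<and> openin ?S (W \<inter> \<pi> -` U))"
    unfolding istopology_def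
  proof (intro conjI allI impI)
    fix A B
    assume A: "A \<subseteq> X \<and> openin ?S (W \<inter> \<pi> -` A)" and B: "B \<subseteq> X \<and> openin ?S (W \<inter> \<pi> -` B)"
    show "A \<inter> B \<subseteq> X" using A by blast
    have "W \<inter> \<pi> -` (A \<inter> B) = (W \<inter> \<pi> -` A) \<inter> (W \<inter> \<pi> -` B)" by blast
    then show "openin ?S (W \<inter> \<pi> -` (A \<inter> B))" using A B by (metis openin_Int)
  next
    fix K
    assume K: "\<forall>A\<in>K. A \<subseteq> X \<and> openin ?S (W \<inter> \<pi> -` A)"
    show "\<Union>K \<subseteq> X" using K by blast
    have "W \<inter> \<pi> -` \<Union>K = (\<Union>A\<in>K. W \<inter> \<pi> -` A)" by blast
    then show "openin ?S (W \<inter> \<pi> -` \<Union>K)" using K by (metis (no_types, lifting) image_iff openin_Union)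
  qed
  then show ?thesis by (simp add: coordinate_space_def topology_inverse')
qed

section \<open>The involutive cone incidence\<close>

definition symplectic_form ::
    "(complex \<Rightarrow> 'v::ab_group_add \<Rightarrow> 'v) \<Rightarrow> ('v \<Rightarrow> 'v \<Rightarrow> complex) \<Rightarrow> bool" where
  "symplectic_form smul \<omega> \<longleftrightarrow>
     (\<forall>v. \<omega> v \<in> dual smul) \<and> (\<forall>u. (\<lambda>v. \<omega> v u) \<in> dual smul) \<and>
     (\<forall>v. \<omega> v v = 0) \<and> (\<forall>v. (\<forall>u. \<omega> v u = 0) \<longrightarrow> v = 0)"

definition hyperplanes :: "(complex \<Rightarrow> 'v::ab_group_add \<Rightarrow> 'v) \<Rightarrow> 'v set set" where
  "hyperplanes smul = {{u. l u = 0} | l. l \<in> dual smul \<and> l \<noteq> 0}"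

text \<open>The points of \<open>P(L)\<close>, for a space \<open>L\<close> of functions, are the one-dimensional subspaces
  of \<open>L\<close>.\<close>

definition proj :: "('a \<Rightarrow> complex) set \<Rightarrow> ('a \<Rightarrow> complex) set set" where
  "proj L = {fspan {f} | f. f \<in> L \<and> f \<noteq> 0}"

text \<open>The line in \<open>V\<close> that is the polar point of \<open>H\<close>. The vectors \<open>v\<^sub>l\<close>, for the various
  equations \<open>l\<close> of \<open>H\<close>, are proportional.\<close>

definition polar_point ::
    "(complex \<Rightarrow> 'v::ab_group_add \<Rightarrow> 'v) \<Rightarrow> ('v \<Rightarrow> 'v \<Rightarrow> complex) \<Rightarrow> 'v set \<Rightarrow> 'v set" where
  "polar_point smul \<omega> H = module.span smul
     {v. \<exists>l \<in> dual smul. l \<noteq> 0 \<and> H = {u. l u = 0} \<and> (\<forall>u. l u = \<omega> v u)}"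

text \<open>Functions on \<open>H\<close> are represented by functions on \<open>V\<close> vanishing outside \<open>H\<close>.\<close>

definition res :: "'v set \<Rightarrow> ('v \<Rightarrow> complex) \<Rightarrow> ('v \<Rightarrow> complex)" where
  "res H f = (\<lambda>u. if u \<in> H then f u else 0)"

definition Q_fiber ::
    "(complex \<Rightarrow> 'v::ab_group_add \<Rightarrow> 'v) \<Rightarrow> 'v set \<Rightarrow> ('v \<Rightarrow> complex) set" where
  "Q_fiber smul H = res H ` dual smul"

definition G\<sigma>_fiber ::
    "(complex \<Rightarrow> 'v::ab_group_add \<Rightarrow> 'v) \<Rightarrow> ('v \<Rightarrow> 'v \<Rightarrow> complex) \<Rightarrow> 'v set
      \<Rightarrow> ('v \<Rightarrow> complex) set" where
  "G\<sigma>_fiber smul \<omega> H = {a \<in> Q_fiber smul H. \<forall>v \<in> polar_point smul \<omega> H. a v = 0}"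

definition Y_points ::
    "(complex \<Rightarrow> 'v::ab_group_add \<Rightarrow> 'v) \<Rightarrow> ('v \<Rightarrow> 'v \<Rightarrow> complex) \<Rightarrow> nat
      \<Rightarrow> ('v set \<times> ('v \<Rightarrow> complex) set) set" where
  "Y_points smul \<omega> m =
     {(H, L). H \<in> hyperplanes smul \<and> L \<in> proj (Sym m (G\<sigma>_fiber smul \<omega> H))}"

text \<open>The fiber of \<open>F\<close> over \<open>(H, L)\<close>, where \<open>L\<close> is the line spanned by \<open>q\<close>: the forms on
  \<open>V\<close> of degree \<open>d \<ge> m\<close> whose restriction to \<open>H\<close> lies in the image of
  \<open>L \<otimes> Sym (d - m) Q\<close>.\<close>

definition F_fiber ::
    "(complex \<Rightarrow> 'v::ab_group_add \<Rightarrow> 'v) \<Rightarrow> nat \<Rightarrow> nat \<Rightarrow> 'v set \<times> ('v \<Rightarrow> complex) set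
      \<Rightarrow> ('v \<Rightarrow> complex) set" where
  "F_fiber smul m d = (\<lambda>(H, L). {f \<in> Sym d (dual smul).
     \<exists>t \<in> L. \<exists>s \<in> Sym (d - m) (Q_fiber smul H). \<forall>u\<in>H. f u = t u * s u})"

type_synonym 'v incidence_point = "'v set \<times> ('v \<Rightarrow> complex) set \<times> ('v \<Rightarrow> complex) set"

definition PF_points ::
    "(complex \<Rightarrow> 'v::ab_group_add \<Rightarrow> 'v) \<Rightarrow> ('v \<Rightarrow> 'v \<Rightarrow> complex) \<Rightarrow> nat \<Rightarrow> nat
      \<Rightarrow> 'v incidence_point set" where
  "PF_points smul \<omega> m d =
     {(H, L, M). (H, L) \<in> Y_points smul \<omega> m \<and> M \<in> proj (F_fiber smul m d (H, L))}"

text \<open>Coordinates on \<open>P(F)\<close>: an equation of \<open>H\<close>, a form on \<open>V\<close> restricting to the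
  degree-\<open>m\<close> form \<open>q\<close> on \<open>H\<close>, and the degree-\<open>d\<close> form on \<open>V\<close>. Local sections exist, as
  \<open>P(F)\<close> is an iterated projective bundle and \<open>Sym m Q\<close> is a quotient bundle of
  \<open>Sym m V\<^sup>\<or> \<otimes> \<O>\<close>.\<close>

type_synonym 'v triple = "('v \<Rightarrow> complex) \<times> ('v \<Rightarrow> complex) \<times> ('v \<Rightarrow> complex)"

definition tscale :: "complex \<Rightarrow> 'v triple \<Rightarrow> 'v triple" where
  "tscale c = (\<lambda>(l, q, f). (fscale c l, fscale c q, fscale c f))"

definition PF_coord :: "'v triple \<Rightarrow> 'v incidence_point" where
  "PF_coord = (\<lambda>(l, q, f). ({u. l u = 0}, fspan {res {u. l u = 0} q}, fspan {f}))"

definition PF ::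
    "(complex \<Rightarrow> 'v::ab_group_add \<Rightarrow> 'v) \<Rightarrow> ('v \<Rightarrow> 'v \<Rightarrow> complex) \<Rightarrow> nat \<Rightarrow> nat
      \<Rightarrow> 'v incidence_point space_with_functions" where
  "PF smul \<omega> m d = coordinate_space tscale
     (dual smul \<times> Sym m (dual smul) \<times> Sym d (dual smul)) PF_coord (PF_points smul \<omega> m d)"

definition rho :: "'v incidence_point \<Rightarrow> ('v \<Rightarrow> complex) set" where
  "rho = (\<lambda>(H, L, M). M)"

definition B ::
    "(complex \<Rightarrow> 'v::ab_group_add \<Rightarrow> 'v) \<Rightarrow> ('v \<Rightarrow> 'v \<Rightarrow> complex) \<Rightarrow> nat \<Rightarrow> nat
      \<Rightarrow> ('v \<Rightarrow> complex) set space_with_functions" where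
  "B smul \<omega> m d = coordinate_space fscale
     (Sym d (dual smul)) (\<lambda>f. fspan {f}) (rho ` PF_points smul \<omega> m d)"

end

theory Submission
  imports Defs "HOL-Computational_Algebra.Polynomial"
begin

text \<open>
  A point of the incidence over the line spanned by a form \<open>f\<close> is given by a vector \<open>w\<close> such that
  \<open>f (u + t w) = f u\<close> for all \<open>u\<close> with \<open>\<omega> w u = 0\<close>; when \<open>f\<close> does not vanish on the hyperplane,
  nothing else has to be chosen. If \<open>S\<close> is linear with \<open>\<omega> w (S w) = 0\<close> for all \<open>w\<close>, then
  \<open>f (S w + t w) = f (S w)\<close> is an equation for \<open>w\<close>, linear in \<open>f\<close>. For a suitable witness \<open>f0\<close>, whose terms
  are \<open>m\<close>-th powers of linear forms and one product, the ideal of these equations contains all forms of some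
  degree \<open>D\<close> that vanish at one given point. Eliminating all monomials of degree \<open>D\<close> but one by Cramer's
  rule then expresses \<open>w\<close>, for every \<open>f\<close> in a Zariski neighbourhood of \<open>f0\<close>, as a polynomial in \<open>f\<close>: this is the
  inverse morphism. The neighbourhood is dense since every point of the incidence is joined to
  the witness by a rational curve.
\<close>

text \<open>The inverse has to be given by regular functions, so the vertex must be computed by a
  polynomial formula in \<open>f\<close>. One form \<open>f0\<close> is enough to get it, provided
  that \<open>E 0\<close> is, up to scaling, the only solution of its equations and a reduced one:
  then every form of large degree \<open>D\<close> vanishing at \<open>E 0\<close> is an equation of
  \<open>f0\<close>, and since the equations are linear in \<open>f\<close>, they can be chosen so
  that the system has the identity matrix at \<open>f0\<close>. The shape of \<open>f0\<close>
  serves this uniqueness. Its powers do not involve \<open>p 0\<close>, and the product is a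
  multiple of \<open>y\<close>, the equation of the hyperplane polar to \<open>E 0\<close>; so
  \<open>E 0\<close> is a vertex. Without the product, \<open>F 0\<close> minus the sum of the
  \<open>F i\<close> with \<open>i \<ge> 1\<close> would be another vertex. Without the shift in
  \<open>Q i = q i + y\<close>, the vector \<open>F 0\<close> would be another one, because on its
  hyperplane \<open>p 0 = 0\<close> the form would not involve \<open>y\<close>. The cone of a point
  is not determined by \<open>f\<close> when \<open>f\<close> vanishes on the hyperplane, so these
  \<open>f\<close> are removed by a further polynomial condition.\<close>

lemma vector_space_fscale: "vector_space fscale"
  by unfold_locales (auto simp: fscale_def fun_eq_iff algebra_simps)

interpretation fs: vector_space fscale
  by (rule vector_space_fscale)

lemma vector_space_tscale: "vector_space tscale"
  by unfold_locales
    (auto simp: tscale_def fs.scale_right_distrib fs.scale_left_distrib split: prod.splits)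

lemma fscale_apply [simp]: "fscale c f x = c * f x"
  by (simp add: fscale_def)

lemma dual_iff:
  assumes "vector_space smul"
  shows "l \<in> dual smul \<longleftrightarrow> (\<forall>x y. l (x + y) = l x + l y) \<and> (\<forall>c x. l (smul c x) = c * l x)"
proof -
  have "vector_space ((*) :: complex \<Rightarrow> complex \<Rightarrow> complex)"
    by unfold_locales (auto simp: algebra_simps)
  then show ?thesis
    using assms by (simp add: dual_def Vector_Spaces.linear_iff)
qed

lemma subspace_dual:
  assumes "vector_space smul"
  shows "fs.subspace (dual smul)"
  by (rule fs.subspaceI) (auto simp: dual_iff[OF assms] algebra_simps)

section \<open>Symmetric powers\<close>

lemma subspace_Sym: "fs.subspace (Sym k L)"
  by (simp add: Sym_def)

lemmas Sym_add = fs.subspace_add[OF subspace_Sym]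
  and Sym_fscale = fs.subspace_scale[OF subspace_Sym]
  and Sym_zero = fs.subspace_0[OF subspace_Sym]
  and Sym_diff = fs.subspace_diff[OF subspace_Sym]
  and Sym_sum = fs.subspace_sum[OF subspace_Sym]

lemma Sym_prod: "(\<And>i. i < k \<Longrightarrow> l i \<in> L) \<Longrightarrow> (\<lambda>x. \<Prod>i<k. l i x) \<in> Sym k L"
  unfolding Sym_def by (rule fs.span_base) blast

lemma Sym_induct [consumes 1, case_names zero add scale prod]:
  assumes "p \<in> Sym k L"
    and "P 0" "\<And>p q. P p \<Longrightarrow> P q \<Longrightarrow> P (p + q)" "\<And>c p. P p \<Longrightarrow> P (fscale c p)"
    and "\<And>l. (\<And>i. i < k \<Longrightarrow> l i \<in> L) \<Longrightarrow> P (\<lambda>x. \<Prod>i<k. l i x)"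
  shows "P p"
proof -
  have "fs.subspace {p. P p}"
    using assms(2-4) by (intro fs.subspaceI) auto
  then show ?thesis
    using assms(1,5) unfolding Sym_def by (elim fs.span_induct[where P = P]) auto
qed

lemma Sym_mono: "L \<subseteq> L' \<Longrightarrow> Sym k L \<subseteq> Sym k L'"
  unfolding Sym_def by (rule fs.span_mono) blast

lemma Sym_0: "p \<in> Sym 0 L \<longleftrightarrow> (\<exists>c. p = (\<lambda>_. c))"
proof -
  have "{\<lambda>x. \<Prod>i<(0::nat). l i x | l. \<forall>i<0. l i \<in> L} = {1}"
    by (auto simp: fun_eq_iff)
  then show ?thesis
    by (auto simp: Sym_def fs.span_singleton fun_eq_iff)
qed

lemma Sym_1: "l \<in> L \<Longrightarrow> l \<in> Sym 1 L"
  using Sym_prod[of 1 "\<lambda>_. l" L] by simp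

lemma Sym_mult:
  assumes "p \<in> Sym a L" and "q \<in> Sym b L"
  shows "p * q \<in> Sym (a + b) L"
  using assms(1)
proof (induction rule: Sym_induct)
  case zero
  show ?case by (simp only: mult_zero_left mult_zero_right Sym_zero)
next
  case (add p q)
  then show ?case by (simp only: Sym_add distrib_right)
next
  case (scale c p)
  have "fscale c p * q = fscale c (p * q)" by (simp add: fun_eq_iff)
  then show ?case using scale by (simp only: Sym_fscale)
next
  case (prod l)
  note l = this
  from assms(2) show ?case
  proof (induction rule: Sym_induct)
    case zero
    show ?case by (simp only: mult_zero_left mult_zero_right Sym_zero)
  next
    case (add p q)
    then show ?case by (simp only: Sym_add distrib_left)
  next
    case (scale c p)
    have "(\<lambda>x. \<Prod>i<a. l i x) * fscale c p = fscale c ((\<lambda>x. \<Prod>i<a. l i x) * p)"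
      by (simp add: fun_eq_iff)
    then show ?case using scale by (simp only: Sym_fscale)
  next
    case (prod l')
    define l'' where "l'' i = (if i < a then l i else l' (i - a))" for i
    have "(\<lambda>x. \<Prod>i<a + b. l'' i x) \<in> Sym (a + b) L"
      using l prod by (intro Sym_prod) (auto simp: l''_def)
    moreover have "(\<Prod>i<a + b. l'' i x) = (\<Prod>i<a. l i x) * (\<Prod>i<b. l' i x)" for x
    proof -
      have "(\<Prod>i<a + b. l'' i x) = (\<Prod>i<a. l'' i x) * (\<Prod>i\<in>{a..<a+b}. l'' i x)"
        by (metis prod.atLeastLessThan_concat atLeast0LessThan le_add1 zero_order(1))
      also have "(\<Prod>i\<in>{a..<a+b}. l'' i x) = (\<Prod>i<b. l'' (i + a) x)"
        using prod.shift_bounds_nat_ivl[of "\<lambda>i. l'' i x" 0 a b]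
        by (simp add: atLeast0LessThan add.commute)
      finally show ?thesis by (simp add: l''_def)
    qed
    ultimately show ?case by (simp add: times_fun_def)
  qed
qed

lemma Sym_mult_left: "l \<in> L \<Longrightarrow> p \<in> Sym k L \<Longrightarrow> l * p \<in> Sym (Suc k) L"
  using Sym_mult[OF Sym_1] by fastforce

lemma Sym_power: "p \<in> Sym a L \<Longrightarrow> p ^ k \<in> Sym (k * a) L"
proof (induction k)
  case 0
  then show ?case by (auto simp: Sym_0 fun_eq_iff)
next
  case (Suc k)
  then show ?case using Sym_mult[of p a L "p ^ k"] by (simp only: power_Suc mult_Suc)
qed

lemma Sym_power_form: "l \<in> L \<Longrightarrow> l ^ k \<in> Sym k L"
  using Sym_power[OF Sym_1] by fastforce

text \<open>Applied with \<open>c\<close> a scaling factor, with \<open>c = 1\<close> for invariance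
  along a vertex, and with \<open>c = 0\<close> for vanishing at a point.\<close>

lemma Sym_homogeneous:
  assumes "p \<in> Sym k L" and "\<And>l. l \<in> L \<Longrightarrow> l y = c * l x"
  shows "p y = c ^ k * p x"
  using assms(1)
proof (induction rule: Sym_induct)
  case (prod l)
  then have "(\<Prod>i<k. l i y) = (\<Prod>i<k. c * l i x)"
    by (intro prod.cong refl assms(2)) auto
  then show ?case by (simp add: prod.distrib)
qed (auto simp: algebra_simps)

lemma prod_fun_apply: "(\<Prod>i\<in>A. f i) x = (\<Prod>i\<in>A. f i x)" for f :: "'b \<Rightarrow> 'a \<Rightarrow> complex"
  by (induction A rule: infinite_finite_induct) auto

lemma sum_fun_apply: "(\<Sum>i\<in>A. f i) x = (\<Sum>i\<in>A. f i x)" for f :: "'b \<Rightarrow> 'a \<Rightarrow> complex"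
  by (induction A rule: infinite_finite_induct) auto

lemma power_fun_apply [simp]: "(f ^ k) x = f x ^ k" for f :: "'a \<Rightarrow> complex"
  by (induction k) auto

lemma Sym_prod_Sym:
  assumes "\<And>i. i < (k::nat) \<Longrightarrow> p i \<in> Sym d L"
  shows "(\<lambda>x. \<Prod>i<k. p i x) \<in> Sym (k * d) L"
  using assms
proof (induction k)
  case 0
  then show ?case by (auto simp: Sym_0)
next
  case (Suc k)
  then have "p k * (\<lambda>x. \<Prod>i<k. p i x) \<in> Sym (d + k * d) L"
    by (intro Sym_mult) auto
  moreover have "p k * (\<lambda>x. \<Prod>i<k. p i x) = (\<lambda>x. \<Prod>i<Suc k. p i x)"
    by (simp add: fun_eq_iff)
  ultimately show ?case by simp
qed

lemma Sym_comp:
  assumes "p \<in> Sym k L'" and "\<And>l. l \<in> L' \<Longrightarrow> l \<circ> \<phi> \<in> Sym d L"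
  shows "p \<circ> \<phi> \<in> Sym (k * d) L"
  using assms(1)
proof (induction rule: Sym_induct)
  case zero
  have "0 \<circ> \<phi> = 0" by (simp add: fun_eq_iff)
  then show ?case by (metis Sym_zero)
next
  case (add p q)
  have "(p + q) \<circ> \<phi> = (p \<circ> \<phi>) + (q \<circ> \<phi>)" by (simp add: fun_eq_iff)
  then show ?case using add by (simp only: Sym_add)
next
  case (scale c p)
  have "fscale c p \<circ> \<phi> = fscale c (p \<circ> \<phi>)" by (simp add: fun_eq_iff)
  then show ?case using scale by (simp only: Sym_fscale)
next
  case (prod l)
  then have "(\<lambda>x. \<Prod>i<k. (l i \<circ> \<phi>) x) \<in> Sym (k * d) L"
    by (intro Sym_prod_Sym assms(2))
  then show ?case by (simp add: comp_def)
qed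

lemma Sym_comp_linear:
  assumes "p \<in> Sym k L'" and "\<And>l. l \<in> L' \<Longrightarrow> l \<circ> \<phi> \<in> L"
  shows "p \<circ> \<phi> \<in> Sym k L"
  using Sym_comp[OF assms(1), of \<phi> 1 L] assms(2) Sym_1 by auto

section \<open>Polynomial functions\<close>

lemma subspace_polyfun: "fs.subspace (polyfun smul)"
  by (simp add: polyfun_def)

lemmas polyfun_add = fs.subspace_add[OF subspace_polyfun]
  and polyfun_fscale = fs.subspace_scale[OF subspace_polyfun]
  and polyfun_zero = fs.subspace_0[OF subspace_polyfun]

lemma polyfun_Sym: "p \<in> Sym k (dual smul) \<Longrightarrow> p \<in> polyfun smul"
  unfolding polyfun_def by (rule fs.span_base) blast

lemma polyfun_const: "(\<lambda>_. c) \<in> polyfun smul"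
  by (rule polyfun_Sym[of _ 0]) (auto simp: Sym_0)

lemma polyfun_induct [consumes 1, case_names zero add scale Sym]:
  assumes "p \<in> polyfun smul"
    and "P 0" "\<And>p q. P p \<Longrightarrow> P q \<Longrightarrow> P (p + q)" "\<And>c p. P p \<Longrightarrow> P (fscale c p)"
    and "\<And>p k. p \<in> Sym k (dual smul) \<Longrightarrow> P p"
  shows "P p"
proof -
  have "fs.subspace {p. P p}"
    using assms(2-4) by (intro fs.subspaceI) auto
  then show ?thesis
    using assms(1,5) unfolding polyfun_def by (elim fs.span_induct[where P = P]) auto
qed

lemma polyfun_mult:
  assumes "p \<in> polyfun smul" and "q \<in> polyfun smul"
  shows "p * q \<in> polyfun smul"
  using assms(1)
proof (induction rule: polyfun_induct)
  case zero
  show ?case by (simp only: mult_zero_left mult_zero_right polyfun_zero)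
next
  case (add p q)
  then show ?case by (simp only: polyfun_add distrib_right)
next
  case (scale c p)
  have "fscale c p * q = fscale c (p * q)" by (simp add: fun_eq_iff)
  then show ?case using scale by (simp only: polyfun_fscale)
next
  case (Sym p k)
  note p = this
  from assms(2) show ?case
  proof (induction rule: polyfun_induct)
    case zero
    show ?case by (simp only: mult_zero_left mult_zero_right polyfun_zero)
  next
    case (add p q)
    then show ?case by (simp only: polyfun_add distrib_left)
  next
    case (scale c q)
    have "p * fscale c q = fscale c (p * q)" by (simp add: fun_eq_iff)
    then show ?case using scale by (simp only: polyfun_fscale)
  next
    case (Sym q j)
    then show ?case using p Sym_mult polyfun_Sym by blast
  qed
qed

lemma polyfun_comp:
  assumes "p \<in> polyfun s2" and "\<And>l. l \<in> dual s2 \<Longrightarrow> l \<circ> \<Phi> \<in> polyfun s1"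
  shows "p \<circ> \<Phi> \<in> polyfun s1"
  using assms(1)
proof (induction rule: polyfun_induct)
  case zero
  have "0 \<circ> \<Phi> = 0" by (simp add: fun_eq_iff)
  then show ?case by (metis polyfun_zero)
next
  case (add p q)
  have "(p + q) \<circ> \<Phi> = (p \<circ> \<Phi>) + (q \<circ> \<Phi>)" by (simp add: fun_eq_iff)
  then show ?case using add by (simp only: polyfun_add)
next
  case (scale c p)
  have "fscale c p \<circ> \<Phi> = fscale c (p \<circ> \<Phi>)" by (simp add: fun_eq_iff)
  then show ?case using scale by (simp only: polyfun_fscale)
next
  case (Sym p k)
  then show ?case
  proof (induction rule: Sym_induct)
    case zero
    have "0 \<circ> \<Phi> = 0" by (simp add: fun_eq_iff)
    then show ?case by (metis polyfun_zero)
  next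
    case (add p q)
    have "(p + q) \<circ> \<Phi> = (p \<circ> \<Phi>) + (q \<circ> \<Phi>)" by (simp add: fun_eq_iff)
    then show ?case using add by (simp only: polyfun_add)
  next
    case (scale c p)
    have "fscale c p \<circ> \<Phi> = fscale c (p \<circ> \<Phi>)" by (simp add: fun_eq_iff)
    then show ?case using scale by (simp only: polyfun_fscale)
  next
    case (prod l)
    have "(\<lambda>x. \<Prod>i<j. (l i \<circ> \<Phi>) x) \<in> polyfun s1" if "j \<le> k" for j
      using that
    proof (induction j)
      case 0
      then show ?case by (simp add: polyfun_const)
    next
      case (Suc j)
      then have "(l j \<circ> \<Phi>) * (\<lambda>x. \<Prod>i<j. (l i \<circ> \<Phi>) x) \<in> polyfun s1"
        using prod assms(2) by (intro polyfun_mult) auto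
      moreover have "(l j \<circ> \<Phi>) * (\<lambda>x. \<Prod>i<j. (l i \<circ> \<Phi>) x) = (\<lambda>x. \<Prod>i<Suc j. (l i \<circ> \<Phi>) x)"
        by (simp add: fun_eq_iff)
      ultimately show ?case by simp
    qed
    from this[of k] show ?case by (simp add: comp_def)
  qed
qed

section \<open>The Zariski topology and morphisms in coordinates\<close>

lemma openin_zariski:
  "openin (zariski smul) N \<longleftrightarrow> (\<forall>w\<in>N. \<exists>p\<in>polyfun smul. p w \<noteq> 0 \<and> {z. p z \<noteq> 0} \<subseteq> N)"
proof
  assume "openin (zariski smul) N"
  then have "generate_topology_on {{w. p w \<noteq> 0} | p. p \<in> polyfun smul} N"
    unfolding zariski_def openin_topology_generated_by_iff .
  then show "\<forall>w\<in>N. \<exists>p\<in>polyfun smul. p w \<noteq> 0 \<and> {z. p z \<noteq> 0} \<subseteq> N"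
  proof induction
    case Empty
    then show ?case by simp
  next
    case (Int a b)
    show ?case
    proof
      fix w assume w: "w \<in> a \<inter> b"
      from w Int obtain p where p: "p \<in> polyfun smul" "p w \<noteq> 0" "{z. p z \<noteq> 0} \<subseteq> a" by auto
      from w Int obtain q where q: "q \<in> polyfun smul" "q w \<noteq> 0" "{z. q z \<noteq> 0} \<subseteq> b" by auto
      show "\<exists>p\<in>polyfun smul. p w \<noteq> 0 \<and> {z. p z \<noteq> 0} \<subseteq> a \<inter> b"
        using p q by (intro bexI[of _ "p * q"] polyfun_mult) auto
    qed
  next
    case (UN K)
    then show ?case by (meson UnionE Union_upper dual_order.trans)
  next
    case (Basis s)
    then show ?case by blast
  qed
next
  assume N: "\<forall>w\<in>N. \<exists>p\<in>polyfun smul. p w \<noteq> 0 \<and> {z. p z \<noteq> 0} \<subseteq> N"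
  have "openin (zariski smul) {z. p z \<noteq> 0}" if "p \<in> polyfun smul" for p
    using that unfolding zariski_def by (intro topology_generated_by_Basis) blast
  then show "openin (zariski smul) N"
    using N by (subst openin_subopen) (metis mem_Collect_eq)
qed

lemma topspace_zariski [simp]: "topspace (zariski smul) = UNIV"
proof -
  have "openin (zariski smul) UNIV"
    unfolding openin_zariski by (intro ballI bexI[of _ "\<lambda>_. 1"] polyfun_const) auto
  then show ?thesis by (metis openin_subset top.extremum_uniqueI)
qed

lemma openin_zariski_subtopology:
  "openin (subtopology (zariski smul) S) N \<longleftrightarrow>
     N \<subseteq> S \<and> (\<forall>w\<in>N. \<exists>p\<in>polyfun smul. p w \<noteq> 0 \<and> {z\<in>S. p z \<noteq> 0} \<subseteq> N)" (is "?L \<longleftrightarrow> ?R")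
proof
  assume ?L
  then obtain T where "openin (zariski smul) T" "N = T \<inter> S"
    by (auto simp: openin_subtopology)
  then show ?R by (force simp: openin_zariski)
next
  assume R: ?R
  define T where "T = \<Union>{{z. p z \<noteq> 0} | p. p \<in> polyfun smul \<and> {z\<in>S. p z \<noteq> 0} \<subseteq> N}"
  have "openin (zariski smul) T"
    unfolding T_def openin_zariski by blast
  moreover have "N = T \<inter> S"
    using R unfolding T_def by blast
  ultimately show ?L by (auto simp: openin_subtopology)
qed

lemma topspace_coordinate_space [simp]:
  "topspace (zar (coordinate_space s W \<pi> X)) = X"
proof -
  have "openin (zar (coordinate_space s W \<pi> X)) X"
    unfolding openin_coordinate_space
    using openin_topspace[of "subtopology (zariski s) (W \<inter> \<pi> -` X)"] by simp
  moreover have "topspace (zar (coordinate_space s W \<pi> X)) \<subseteq> X"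
    by (metis openin_topspace openin_coordinate_space)
  ultimately show ?thesis by (metis openin_subset subset_antisym)
qed

lemma openin_coordinate_subspace:
  assumes "openin (zar (coordinate_space s W \<pi> X)) U"
  shows "openin (zar (open_subspace (coordinate_space s W \<pi> X) U)) A \<longleftrightarrow>
     A \<subseteq> U \<and> openin (subtopology (zariski s) (W \<inter> \<pi> -` U)) (W \<inter> \<pi> -` A)"
proof -
  have UX: "U \<subseteq> X" and U: "openin (subtopology (zariski s) (W \<inter> \<pi> -` X)) (W \<inter> \<pi> -` U)"
    using assms by (auto simp: openin_coordinate_space)
  have "openin (zar (open_subspace (coordinate_space s W \<pi> X) U)) A \<longleftrightarrow>
      A \<subseteq> U \<and> openin (subtopology (zariski s) (W \<inter> \<pi> -` X)) (W \<inter> \<pi> -` A)"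
    using openin_open_subtopology[OF assms] UX
    by (auto simp: open_subspace_def openin_coordinate_space)
  moreover have "openin (subtopology (zariski s) (W \<inter> \<pi> -` X)) (W \<inter> \<pi> -` A) \<longleftrightarrow>
     openin (subtopology (zariski s) (W \<inter> \<pi> -` U)) (W \<inter> \<pi> -` A)" if "A \<subseteq> U"
  proof -
    have "subtopology (zariski s) (W \<inter> \<pi> -` U) =
        subtopology (subtopology (zariski s) (W \<inter> \<pi> -` X)) (W \<inter> \<pi> -` U)"
      using UX by (auto simp: subtopology_subtopology intro!: arg_cong2[of _ _ _ _ subtopology])
    then show ?thesis
      using openin_open_subtopology[OF U] that by auto
  qed
  ultimately show ?thesis by blast
qed

lemma reg_coordinate_subspace:
  "reg (open_subspace (coordinate_space s W \<pi> X) U) V g \<longleftrightarrow> regular_on s (W \<inter> \<pi> -` V) (g \<circ> \<pi>)"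
  by (simp add: open_subspace_def coordinate_space_def)

text \<open>Openness and regularity are defined on coordinate vectors, so \<open>\<phi>\<close> only
  has to be covered by a map \<open>\<Phi>\<close> along which polynomial functions pull back to
  polynomial functions. Used for \<open>rho\<close> and for its inverse.\<close>

lemma morphism_coordinates:
  assumes U1: "openin (zar (coordinate_space s1 W1 \<pi>1 X1)) U1"
    and U2: "openin (zar (coordinate_space s2 W2 \<pi>2 X2)) U2"
    and \<Phi>: "\<And>p. p \<in> polyfun s2 \<Longrightarrow> p \<circ> \<Phi> \<in> polyfun s1"
    and W: "\<And>w. w \<in> W1 \<Longrightarrow> \<pi>1 w \<in> U1 \<Longrightarrow> \<Phi> w \<in> W2 \<and> \<pi>2 (\<Phi> w) = \<phi> (\<pi>1 w)"
    and \<phi>: "\<phi> ` U1 \<subseteq> U2"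
  shows "morphism (open_subspace (coordinate_space s1 W1 \<pi>1 X1) U1)
     (open_subspace (coordinate_space s2 W2 \<pi>2 X2) U2) \<phi>"
proof -
  let ?A = "open_subspace (coordinate_space s1 W1 \<pi>1 X1) U1"
  let ?B = "open_subspace (coordinate_space s2 W2 \<pi>2 X2) U2"
  have top1: "topspace (zar ?A) = U1" and top2: "topspace (zar ?B) = U2"
    using U1 U2 openin_subset by (fastforce simp: open_subspace_def)+
  have pull: "openin (subtopology (zariski s1) S1) (S1 \<inter> \<Phi> -` N)"
    if N: "openin (subtopology (zariski s2) S2) N" and S: "\<Phi> ` S1 \<subseteq> S2" for S1 S2 N
    unfolding openin_zariski_subtopology
  proof (intro conjI ballI)
    fix w assume w: "w \<in> S1 \<inter> \<Phi> -` N"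
    then obtain p where "p \<in> polyfun s2" "p (\<Phi> w) \<noteq> 0" "{z\<in>S2. p z \<noteq> 0} \<subseteq> N"
      using N by (auto simp: openin_zariski_subtopology)
    then show "\<exists>p\<in>polyfun s1. p w \<noteq> 0 \<and> {z \<in> S1. p z \<noteq> 0} \<subseteq> S1 \<inter> \<Phi> -` N"
      using S by (intro bexI[of _ "p \<circ> \<Phi>"] \<Phi>) auto
  qed auto
  have pre: "W1 \<inter> \<pi>1 -` {x \<in> U1. \<phi> x \<in> V} = (W1 \<inter> \<pi>1 -` U1) \<inter> \<Phi> -` (W2 \<inter> \<pi>2 -` V)" for V
    using W by auto
  have "continuous_map (zar ?A) (zar ?B) \<phi>"
    unfolding continuous_map
  proof (intro conjI allI impI)
    show "\<phi> ` topspace (zar ?A) \<subseteq> topspace (zar ?B)" using \<phi> top1 top2 by simp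
  next
    fix V assume "openin (zar ?B) V"
    then have V: "V \<subseteq> U2" "openin (subtopology (zariski s2) (W2 \<inter> \<pi>2 -` U2)) (W2 \<inter> \<pi>2 -` V)"
      using openin_coordinate_subspace[OF U2] by auto
    have "\<Phi> ` (W1 \<inter> \<pi>1 -` U1) \<subseteq> W2 \<inter> \<pi>2 -` U2"
      using W \<phi> by auto
    from pull[OF V(2) this] show "openin (zar ?A) {x \<in> topspace (zar ?A). \<phi> x \<in> V}"
      unfolding openin_coordinate_subspace[OF U1] top1 pre by auto
  qed
  moreover have "reg ?A {x \<in> topspace (zar ?A). \<phi> x \<in> V} (g \<circ> \<phi>)"
    if V: "openin (zar ?B) V" and g: "reg ?B V g" for V g
  proof -
    have g: "regular_on s2 (W2 \<inter> \<pi>2 -` V) (g \<circ> \<pi>2)"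
      using g by (simp only: reg_coordinate_subspace)
    let ?S = "(W1 \<inter> \<pi>1 -` U1) \<inter> \<Phi> -` (W2 \<inter> \<pi>2 -` V)"
    have "regular_on s1 ?S ((g \<circ> \<phi>) \<circ> \<pi>1)"
      unfolding regular_on_def
    proof
      fix w assume w: "w \<in> ?S"
      then obtain N p q where N: "openin (subtopology (zariski s2) (W2 \<inter> \<pi>2 -` V)) N" "\<Phi> w \<in> N"
        and pq: "p \<in> polyfun s2" "q \<in> polyfun s2"
        and eq: "\<forall>z\<in>N. q z \<noteq> 0 \<and> (g \<circ> \<pi>2) z = p z / q z"
        using g unfolding regular_on_def by blast
      have "openin (subtopology (zariski s1) ?S) (?S \<inter> \<Phi> -` N)"
        by (rule pull[OF N(1)]) auto
      then show "\<exists>N p q. openin (subtopology (zariski s1) ?S) N \<and> w \<in> N \<and> p \<in> polyfun s1 \<and>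
          q \<in> polyfun s1 \<and> (\<forall>z\<in>N. q z \<noteq> 0 \<and> (g \<circ> \<phi> \<circ> \<pi>1) z = p z / q z)"
        using w N(2) eq W
        by (intro exI[of _ "?S \<inter> \<Phi> -` N"] exI[of _ "p \<circ> \<Phi>"] exI[of _ "q \<circ> \<Phi>"])
          (auto intro!: \<Phi> pq)
    qed
    then show ?thesis
      unfolding reg_coordinate_subspace top1 pre .
  qed
  ultimately show ?thesis
    unfolding morphism_def by blast
qed

section \<open>Linear algebra in spaces of functions\<close>

lemma fspan_mult:
  assumes "p \<in> fspan A" and "q \<in> fspan S"
  shows "p * q \<in> fspan {a * b | a b. a \<in> A \<and> b \<in> S}" (is "_ \<in> fspan ?C")
  using assms(1)
proof (induction rule: fs.span_induct_alt)
  case base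
  show ?case by (simp only: mult_zero_left fs.span_zero)
next
  case (step c a p)
  have "a * q \<in> fspan ?C" using assms(2)
  proof (induction rule: fs.span_induct_alt)
    case base
    show ?case by (simp only: mult_zero_right fs.span_zero)
  next
    case (step d b q)
    have "a * (fscale d b + q) = fscale d (a * b) + a * q"
      by (simp add: fun_eq_iff algebra_simps)
    moreover have "a * b \<in> ?C" using \<open>a \<in> A\<close> step by blast
    ultimately show ?case
      using step(2) by (simp only: fs.span_add fs.span_scale fs.span_base)
  qed
  moreover have "(fscale c a + p) * q = fscale c (a * q) + p * q"
    by (simp add: fun_eq_iff algebra_simps)
  ultimately show ?case
    using step(2) by (simp only: fs.span_add fs.span_scale)
qed

lemma Sym_finite_span:
  assumes "finite S" and "L \<subseteq> fspan S"
  shows "\<exists>C. finite C \<and> Sym k L \<subseteq> fspan C"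
proof -
  have "\<exists>C. finite C \<and> (\<forall>l. (\<forall>i<k. l i \<in> L) \<longrightarrow> (\<lambda>x. \<Prod>i<k. l i x) \<in> fspan C)"
  proof (induction k)
    case 0
    have "(\<lambda>x. \<Prod>i<0. l i x) \<in> fspan {\<lambda>_. 1}" for l :: "nat \<Rightarrow> 'a \<Rightarrow> complex"
      by (simp only: lessThan_0 prod.empty fs.span_base singletonI)
    then show ?case by blast
  next
    case (Suc k)
    then obtain C where C: "finite C"
      and *: "\<And>l. (\<forall>i<k. l i \<in> L) \<Longrightarrow> (\<lambda>x. \<Prod>i<k. l i x) \<in> fspan C"
      by blast
    have "(\<lambda>x. \<Prod>i<Suc k. l i x) \<in> fspan {a * b | a b. a \<in> C \<and> b \<in> S}"
      if "\<forall>i<Suc k. l i \<in> L" for l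
    proof -
      have "(\<lambda>x. \<Prod>i<k. l i x) * l k \<in> fspan {a * b | a b. a \<in> C \<and> b \<in> S}"
        using that assms(2) by (intro fspan_mult *) auto
      moreover have "(\<lambda>x. \<Prod>i<k. l i x) * l k = (\<lambda>x. \<Prod>i<Suc k. l i x)"
        by (simp add: fun_eq_iff)
      ultimately show ?thesis by simp
    qed
    moreover have "finite {a * b | a b. a \<in> C \<and> b \<in> S}"
      using C assms(1) finite_image_set2[of "\<lambda>a. a \<in> C" "\<lambda>b. b \<in> S" "(*)"] by simp
    ultimately show ?case by blast
  qed
  then obtain C where "finite C" and C: "\<And>l. (\<forall>i<k. l i \<in> L) \<Longrightarrow> (\<lambda>x. \<Prod>i<k. l i x) \<in> fspan C"
    by blast
  moreover have "Sym k L \<subseteq> fspan C"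
    unfolding Sym_def by (rule fs.span_minimal) (use C in auto)
  ultimately show ?thesis by blast
qed

text \<open>The linear forms \<open>\<phi> b\<close> have to live on the whole function space,
  because polynomial functions on coordinate vectors are built from such forms. Hence a basis of
  \<open>W\<close> is extended to one of the full space, and \<open>\<phi> b\<close> reads off a
  coordinate there.\<close>

lemma ex_dual_basis:
  assumes W: "fs.subspace W" and C: "W \<subseteq> fspan C" "finite C"
  obtains S \<phi> where "finite S" "S \<subseteq> W" "\<And>b. \<phi> b \<in> dual fscale"
    "\<And>b b'. b \<in> S \<Longrightarrow> b' \<in> S \<Longrightarrow> \<phi> b b' = (if b = b' then 1 else 0)"
    "\<And>g. g \<in> W \<Longrightarrow> g = (\<Sum>b\<in>S. fscale (\<phi> b g) b)"
proof -
  obtain S where S: "S \<subseteq> W" "fs.independent S" "W \<subseteq> fspan S"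
    using fs.maximal_independent_subset by blast
  have fin: "finite S"
    using fs.independent_span_bound[OF C(2) S(2)] S(1) C(1) by blast
  define E where "E = fs.extend_basis S"
  have E: "S \<subseteq> E" "fs.independent E" "fspan E = UNIV"
    using fs.extend_basis_superset[OF S(2)] fs.independent_extend_basis[OF S(2)]
      fs.span_extend_basis[OF S(2)] by (auto simp: E_def)
  define \<phi> where "\<phi> b g = fs.representation E g b" for b g
  have "\<phi> b \<in> dual fscale" for b
    unfolding dual_iff[OF vector_space_fscale] \<phi>_def
    using E by (simp add: fs.representation_add fs.representation_scale)
  moreover have "\<phi> b b' = (if b = b' then 1 else 0)" if "b \<in> S" "b' \<in> S" for b b'
    using that E fs.representation_basis[OF E(2), of b'] by (auto simp: \<phi>_def)
  moreover have "g = (\<Sum>b\<in>S. fscale (\<phi> b g) b)" if "g \<in> W" for g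
  proof -
    have g: "g \<in> fspan S" using that S by blast
    have "fs.representation E g = fs.representation S g"
      by (rule fs.representation_extend[OF E(2) g E(1)])
    then show ?thesis
      using fs.sum_representation_eq[OF S(2) g fin subset_refl] by (simp add: \<phi>_def)
  qed
  ultimately show ?thesis
    using that[of S \<phi>] fin S(1) by blast
qed

text \<open>Gaussian elimination with coefficients depending polynomially on a parameter, near a
  parameter value \<open>f0\<close> where the matrix of the system is the identity. It produces a common
  denominator \<open>\<Delta>\<close> for the solutions.\<close>

lemma elimination:
  fixes A :: "'j \<Rightarrow> 'j \<Rightarrow> 'f \<Rightarrow> complex" and b :: "'j \<Rightarrow> 'f \<Rightarrow> complex"
  assumes "finite J"
    and "\<And>j k. j \<in> J \<Longrightarrow> k \<in> J \<Longrightarrow> A j k \<in> Sym d L"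
    and "\<And>j. j \<in> J \<Longrightarrow> b j \<in> Sym d L"
    and "\<And>j k. j \<in> J \<Longrightarrow> k \<in> J \<Longrightarrow> A j k f0 = (if j = k then 1 else 0)"
  shows "\<exists>d' \<Delta> c. \<Delta> \<in> Sym d' L \<and> (\<forall>k\<in>J. c k \<in> Sym d' L) \<and> \<Delta> f0 = 1 \<and>
    (\<forall>f y y0. (\<forall>j\<in>J. (\<Sum>k\<in>J. A j k f * y k) = b j f * y0) \<longrightarrow>
       (\<forall>k\<in>J. \<Delta> f * y k = c k f * (y0::complex)))"
  using assms
proof (induction J arbitrary: d A b rule: finite_induct)
  case empty
  show ?case by (intro exI[of _ 0] exI[of _ "\<lambda>_. 1"]) (auto simp: Sym_0)
next
  case (insert i J)
  \<comment> \<open>Fraction-free elimination of the unknown \<open>i\<close> with pivot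
    \<open>A i i\<close>. At \<open>f0\<close> the pivot is 1 and the other \<open>A j i\<close> are
    0, so the remaining matrix is again the identity there.\<close>
  define A' where "A' j k = A i i * A j k - A j i * A i k" for j k
  define b' where "b' j = A i i * b j - A j i * b i" for j
  have "\<exists>d' \<Delta> c. \<Delta> \<in> Sym d' L \<and> (\<forall>k\<in>J. c k \<in> Sym d' L) \<and> \<Delta> f0 = 1 \<and>
    (\<forall>f y y0. (\<forall>j\<in>J. (\<Sum>k\<in>J. A' j k f * y k) = b' j f * y0) \<longrightarrow>
       (\<forall>k\<in>J. \<Delta> f * y k = c k f * (y0::complex)))"
  proof (rule insert.IH)
    show "A' j k \<in> Sym (d + d) L" if "j \<in> J" "k \<in> J" for j k
      using that insert.prems unfolding A'_def by (intro Sym_diff Sym_mult) auto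
    show "b' j \<in> Sym (d + d) L" if "j \<in> J" for j
      using that insert.prems unfolding b'_def by (intro Sym_diff Sym_mult) auto
    show "A' j k f0 = (if j = k then 1 else 0)" if "j \<in> J" "k \<in> J" for j k
      using that insert.prems(3) insert.hyps by (auto simp: A'_def)
  qed
  then obtain d' \<Delta> c where \<Delta>: "\<Delta> \<in> Sym d' L" "\<Delta> f0 = 1" and c: "\<And>k. k \<in> J \<Longrightarrow> c k \<in> Sym d' L"
    and sol: "\<And>f y y0 k. (\<forall>j\<in>J. (\<Sum>k\<in>J. A' j k f * y k) = b' j f * y0) \<Longrightarrow> k \<in> J \<Longrightarrow>
       \<Delta> f * y k = c k f * (y0::complex)"
    by blast
  define \<Delta>' where "\<Delta>' = \<Delta> * A i i"
  \<comment> \<open>The eliminated unknown is found by back substitution in row \<open>i\<close>;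
    the factor \<open>A i i\<close> in \<open>\<Delta>'\<close> clears its denominator and is passed
    on to the other numerators.\<close>
  define c' where "c' k = (if k = i then \<Delta> * b i - (\<Sum>k\<in>J. c k * A i k) else c k * A i i)" for k
  have "\<Delta>' \<in> Sym (d' + d) L"
    unfolding \<Delta>'_def using insert.prems \<Delta> by (intro Sym_mult) auto
  moreover have "c' k \<in> Sym (d' + d) L" if "k \<in> insert i J" for k
    using that insert.prems \<Delta> c unfolding c'_def
    by (auto intro!: Sym_diff Sym_mult Sym_sum)
  moreover have "\<Delta>' f0 = 1"
    using insert.prems \<Delta> by (simp add: \<Delta>'_def)
  moreover have "\<Delta>' f * y k = c' k f * y0"
    if eq: "\<And>j. j \<in> insert i J \<Longrightarrow> (\<Sum>k\<in>insert i J. A j k f * y k) = b j f * y0" and k: "k \<in> insert i J"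
    for f y y0 k
  proof -
    have eq': "A j i f * y i + (\<Sum>k\<in>J. A j k f * y k) = b j f * y0" if "j \<in> insert i J" for j
      using eq[OF that] insert.hyps by simp
    have "(\<Sum>k\<in>J. A' j k f * y k) = b' j f * y0" if j: "j \<in> J" for j
    proof -
      have "(\<Sum>k\<in>J. A' j k f * y k) =
          A i i f * (\<Sum>k\<in>J. A j k f * y k) - A j i f * (\<Sum>k\<in>J. A i k f * y k)"
        by (simp add: A'_def sum_subtractf sum_distrib_left algebra_simps)
      also have "(\<Sum>k\<in>J. A j k f * y k) = b j f * y0 - A j i f * y i"
        using eq'[of j] j by (simp add: algebra_simps)
      also have "(\<Sum>k\<in>J. A i k f * y k) = b i f * y0 - A i i f * y i"
        using eq'[of i] by (simp add: algebra_simps)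
      finally show ?thesis by (simp add: b'_def algebra_simps)
    qed
    then have yk: "\<Delta> f * y k = c k f * y0" if "k \<in> J" for k
      using sol that by blast
    show ?thesis
    proof (cases "k = i")
      case True
      have "\<Delta>' f * y i = \<Delta> f * (b i f * y0 - (\<Sum>k\<in>J. A i k f * y k))"
        by (simp add: \<Delta>'_def flip: eq'[of i])
      also have "\<dots> = \<Delta> f * b i f * y0 - (\<Sum>k\<in>J. A i k f * (\<Delta> f * y k))"
        by (simp add: algebra_simps sum_distrib_left)
      also have "(\<Sum>k\<in>J. A i k f * (\<Delta> f * y k)) = (\<Sum>k\<in>J. A i k f * (c k f * y0))"
        using yk by simp
      finally show ?thesis
        using True by (simp add: c'_def sum_fun_apply sum_distrib_left algebra_simps)
    next
      case False
      with k have "k \<in> J" by simp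
      from yk[OF this] False show ?thesis
        by (simp add: c'_def \<Delta>'_def algebra_simps)
    qed
  qed
  ultimately show ?case
    by (intro exI[of _ "d' + d"] exI[of _ \<Delta>'] exI[of _ c'] conjI ballI allI impI) (assumption | blast)+
qed

section \<open>Ideals in rings of functions\<close>

text \<open>The ring is a subset \<open>R\<close> of the type because it will be
  \<open>polyfun smul\<close> inside the ring of all functions.\<close>

definition ideal_in :: "'a::comm_ring_1 set \<Rightarrow> 'a set \<Rightarrow> bool" where
  "ideal_in R I \<longleftrightarrow> 1 \<in> R \<and> (\<forall>a\<in>R. \<forall>b\<in>R. a + b \<in> R \<and> a * b \<in> R \<and> - a \<in> R) \<and>
     I \<subseteq> R \<and> 0 \<in> I \<and> (\<forall>a\<in>I. \<forall>b\<in>I. a + b \<in> I) \<and> (\<forall>r\<in>R. \<forall>a\<in>I. r * a \<in> I)"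

definition rad_in :: "'a::comm_ring_1 set \<Rightarrow> 'a set \<Rightarrow> 'a set" where
  "rad_in R I = {a \<in> R. \<exists>k. a ^ k \<in> I}"

context
  fixes R I :: "'a::comm_ring_1 set"
  assumes ideal: "ideal_in R I"
begin

lemma ideal_add: "a \<in> I \<Longrightarrow> b \<in> I \<Longrightarrow> a + b \<in> I"
  and ideal_mult: "r \<in> R \<Longrightarrow> a \<in> I \<Longrightarrow> r * a \<in> I"
  and ideal_zero: "0 \<in> I"
  and ideal_subset: "I \<subseteq> R"
  and ring_one: "1 \<in> R"
  and ring_add: "r \<in> R \<Longrightarrow> s \<in> R \<Longrightarrow> r + s \<in> R"
  and ring_mult: "r \<in> R \<Longrightarrow> s \<in> R \<Longrightarrow> r * s \<in> R"
  and ring_uminus: "r \<in> R \<Longrightarrow> - r \<in> R"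
  using ideal unfolding ideal_in_def by auto

lemma ideal_uminus: "a \<in> I \<Longrightarrow> - a \<in> I"
  using ideal_mult[of "- 1" a] ring_uminus[OF ring_one] by simp

lemma ideal_diff: "a \<in> I \<Longrightarrow> b \<in> I \<Longrightarrow> a - b \<in> I"
  using ideal_add[of a "- b"] ideal_uminus by simp

lemma ideal_sum: "(\<And>i. i \<in> A \<Longrightarrow> f i \<in> I) \<Longrightarrow> sum f A \<in> I"
  by (induction A rule: infinite_finite_induct) (auto intro: ideal_zero ideal_add)

lemma ring_power: "r \<in> R \<Longrightarrow> r ^ k \<in> R"
  by (induction k) (auto intro: ring_one ring_mult)

lemma ring_of_nat: "of_nat k \<in> R"
proof (induction k)
  case 0
  have "1 + (- 1) \<in> R" using ring_add[OF ring_one ring_uminus[OF ring_one]] .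
  then show ?case by simp
qed (auto intro: ring_add ring_one)

lemma ideal_power_mono: "a \<in> R \<Longrightarrow> a ^ k \<in> I \<Longrightarrow> k \<le> j \<Longrightarrow> a ^ j \<in> I"
  using ideal_mult[of "a ^ (j - k)" "a ^ k"] ring_power by (simp flip: power_add)

lemma ideal_subset_radical: "a \<in> I \<Longrightarrow> a \<in> rad_in R I"
  using ideal_subset by (auto simp: rad_in_def intro!: exI[of _ 1])

lemma ideal_inI:
  assumes "K \<subseteq> R" "0 \<in> K" "\<And>a b. a \<in> K \<Longrightarrow> b \<in> K \<Longrightarrow> a + b \<in> K" "\<And>r a. r \<in> R \<Longrightarrow> a \<in> K \<Longrightarrow> r * a \<in> K"
  shows "ideal_in R K"
  using ideal assms unfolding ideal_in_def by simp

lemma ideal_in_radical: "ideal_in R (rad_in R I)"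
proof -
  have "a + b \<in> rad_in R I" if ab: "a \<in> rad_in R I" "b \<in> rad_in R I" for a b
  proof -
    obtain k l where *: "a \<in> R" "a ^ k \<in> I" "b \<in> R" "b ^ l \<in> I"
      using ab by (auto simp: rad_in_def)
    have "of_nat ((k + l) choose i) * a ^ i * b ^ (k + l - i) \<in> I" for i
    proof (cases "k \<le> i")
      case True
      have "(of_nat ((k + l) choose i) * b ^ (k + l - i)) * a ^ i \<in> I"
        using * True
        by (intro ideal_mult[OF ring_mult[OF ring_of_nat ring_power] ideal_power_mono[of a k i]])
      then show ?thesis by (simp add: mult_ac)
    next
      case False
      then show ?thesis
        using *
        by (intro ideal_mult[OF ring_mult[OF ring_of_nat ring_power] ideal_power_mono[of b l]]) auto
    qed
    then have "(a + b) ^ (k + l) \<in> I"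
      unfolding binomial_ring by (intro ideal_sum)
    then show ?thesis using * ring_add by (auto simp: rad_in_def)
  qed
  moreover have "r * a \<in> rad_in R I" if ra: "r \<in> R" "a \<in> rad_in R I" for r a
  proof -
    obtain k where "a \<in> R" "a ^ k \<in> I" using ra by (auto simp: rad_in_def)
    then show ?thesis
      using ra ring_mult ideal_mult[OF ring_power[of r k]]
      by (auto simp: rad_in_def power_mult_distrib)
  qed
  moreover have "0 \<in> rad_in R I"
    using ideal_subset_radical ideal_zero by simp
  moreover have "rad_in R I \<subseteq> R"
    by (auto simp: rad_in_def)
  ultimately show ?thesis by (intro ideal_inI)
qed

lemma radical_power: "a \<in> R \<Longrightarrow> a ^ k \<in> rad_in R I \<Longrightarrow> a \<in> rad_in R I"
  by (auto simp: rad_in_def simp flip: power_mult)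

text \<open>Multiplication by \<open>a ^ k * b ^ j\<close> makes the two exponents equal. This lets
  the exponents in the relations below be ignored up to radicals.\<close>

lemma radical_mult_power:
  assumes "a \<in> R" "b \<in> R" "a ^ j * b ^ k \<in> rad_in R I"
  shows "a * b \<in> rad_in R I"
proof -
  have "ideal_in R (rad_in R I)" by (rule ideal_in_radical)
  then have "(a ^ k * b ^ j) * (a ^ j * b ^ k) \<in> rad_in R I"
    using assms ring_mult ring_power unfolding ideal_in_def by blast
  moreover have "(a ^ k * b ^ j) * (a ^ j * b ^ k) = (a * b) ^ (j + k)"
    by (simp add: power_mult_distrib power_add mult_ac)
  ultimately show ?thesis
    using assms ring_mult radical_power by metis
qed

lemma ideal_in_adjoin:
  assumes "x \<in> R"
  shows "ideal_in R {a + x * r | a r. a \<in> I \<and> r \<in> R}" (is "ideal_in R ?I")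
proof -
  have "a + b \<in> ?I" if ab: "a \<in> ?I" "b \<in> ?I" for a b
  proof -
    obtain a' r b' s where *: "a = a' + x * r" "b = b' + x * s" "a' \<in> I" "b' \<in> I" "r \<in> R" "s \<in> R"
      using ab by blast
    then have "a + b = (a' + b') + x * (r + s)" by (simp add: algebra_simps)
    then show ?thesis using * ideal_add ring_add by blast
  qed
  moreover have "s * a \<in> ?I" if sa: "s \<in> R" "a \<in> ?I" for s a
  proof -
    obtain a' r where *: "a = a' + x * r" "a' \<in> I" "r \<in> R" using sa by blast
    then have "s * a = s * a' + x * (s * r)" by (simp add: algebra_simps)
    then show ?thesis using * sa ideal_mult ring_mult by blast
  qed
  moreover have "0 \<in> ?I"
    using ideal_zero ring_of_nat[of 0] by force
  moreover have "?I \<subseteq> R"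
    using ideal_subset assms ring_add ring_mult by blast
  ultimately show ?thesis by (intro ideal_inI)
qed

lemma adjoin_base: "x \<in> R \<Longrightarrow> x \<in> {a + x * r | a r. a \<in> I \<and> r \<in> R}"
  and adjoin_superset: "I \<subseteq> {a + x * r | a r. a \<in> I \<and> r \<in> R}"
proof -
  show "x \<in> {a + x * r | a r. a \<in> I \<and> r \<in> R}"
    using ideal_zero ring_one by force
  show "I \<subseteq> {a + x * r | a r. a \<in> I \<and> r \<in> R}"
    using ring_of_nat[of 0] by force
qed

text \<open>If \<open>h ^ j = a + x * r\<close> with \<open>a \<in> I\<close>, then
  \<open>h ^ (j * k)\<close> is congruent to \<open>x ^ k * r ^ k\<close> modulo \<open>I\<close>,
  and one further factor \<open>h\<close> brings it into \<open>I\<close>.\<close>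

lemma nilpotent_if_nilpotent_mod:
  assumes "x \<in> R" "h \<in> R" "x ^ k * h \<in> I" "h \<in> rad_in R {a + x * r | a r. a \<in> I \<and> r \<in> R}"
  shows "h \<in> rad_in R I"
proof -
  obtain j a r where *: "h ^ j = a + x * r" "a \<in> I" "r \<in> R"
    using assms(4) by (auto simp: rad_in_def)
  have "(a + x * r) ^ i - (x * r) ^ i \<in> I" for i
  proof (induction i)
    case 0
    show ?case by (simp add: ideal_zero)
  next
    case (Suc i)
    have "(x * r) * ((a + x * r) ^ i - (x * r) ^ i) + (a + x * r) ^ i * a \<in> I"
      using Suc * assms ideal_subset
      by (intro ideal_add ideal_mult ring_mult ring_power ring_add) auto
    then show ?case by (simp add: algebra_simps)
  qed
  then have "h * ((a + x * r) ^ k - (x * r) ^ k) + r ^ k * (x ^ k * h) \<in> I"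
    using * by (intro ideal_add ideal_mult[OF assms(2)] ideal_mult[OF ring_power assms(3)])
  also have "h * ((a + x * r) ^ k - (x * r) ^ k) + r ^ k * (x ^ k * h) = h ^ Suc (j * k)"
    by (simp add: power_mult *(1) power_mult_distrib algebra_simps)
  finally show ?thesis
    using assms(2) unfolding rad_in_def by blast
qed

end

text \<open>Comparing the values at \<open>2 t\<close> and \<open>t\<close> eliminates the leading coefficient.\<close>

lemma coefficient_mem:
  assumes "fs.subspace J" and "\<And>t. (\<Sum>i\<le>d. fscale (t ^ i) (c i)) \<in> J" and "i \<le> d"
  shows "c i \<in> J"
  using assms(2,3)
proof (induction d arbitrary: c i)
  case 0
  from 0(1)[of 1] 0(2) show ?case by simp
next
  case (Suc d)
  have "(\<Sum>i\<le>d. fscale (t ^ i) (fscale (2 ^ i - 2 ^ Suc d) (c i))) \<in> J" for t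
  proof -
    have "(\<Sum>i\<le>Suc d. fscale ((2 * t) ^ i) (c i)) - fscale (2 ^ Suc d) (\<Sum>i\<le>Suc d. fscale (t ^ i) (c i)) \<in> J"
      by (intro fs.subspace_diff fs.subspace_scale assms(1) Suc.prems(1))
    also have "(\<Sum>i\<le>Suc d. fscale ((2 * t) ^ i) (c i)) - fscale (2 ^ Suc d) (\<Sum>i\<le>Suc d. fscale (t ^ i) (c i))
      = (\<Sum>i\<le>d. fscale (t ^ i) (fscale (2 ^ i - 2 ^ Suc d) (c i)))"
      by (rule ext) (simp add: sum_fun_apply sum_distrib_left sum_subtractf power_mult_distrib algebra_simps)
    finally show ?thesis .
  qed
  then have "fscale (2 ^ i - 2 ^ Suc d) (c i) \<in> J" if "i \<le> d" for i
    using that by (rule Suc.IH)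
  then have "fscale (1 / (2 ^ i - 2 ^ Suc d)) (fscale (2 ^ i - 2 ^ Suc d) (c i)) \<in> J" if "i \<le> d" for i
    using that assms(1) fs.subspace_scale by blast
  moreover have "(2::complex) ^ i - 2 ^ Suc d \<noteq> 0" if "i \<le> d" for i
  proof -
    have "(2::nat) ^ i < 2 ^ Suc d"
      using that by (intro power_strict_increasing) auto
    then have "(of_nat (2 ^ i) :: complex) \<noteq> of_nat (2 ^ Suc d)"
      unfolding of_nat_eq_iff by simp
    then show ?thesis by simp
  qed
  ultimately have le: "c i \<in> J" if "i \<le> d" for i
    using that by (simp add: fs.scale_scale)
  have "(\<Sum>i\<le>Suc d. fscale (1 ^ i) (c i)) - (\<Sum>i\<le>d. c i) \<in> J"
    by (intro fs.subspace_diff fs.subspace_sum assms(1) Suc.prems(1) le) simp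
  then have "c (Suc d) \<in> J" by simp
  with le Suc.prems(2) show ?case
    by (cases "i = Suc d") auto
qed

text \<open>Constant functions act as scalars on the function ring, so this is
  \<open>coefficient_mem\<close> for a polynomial whose coefficients are functions.\<close>

lemma poly_coeff_mem:
  fixes P :: "('a \<Rightarrow> complex) poly"
  assumes "fs.subspace J" and "\<And>t. poly P (\<lambda>_. t) \<in> J"
  shows "coeff P i \<in> J"
proof (cases "i \<le> degree P")
  case True
  have "poly P (\<lambda>_. t) = (\<Sum>i\<le>degree P. fscale (t ^ i) (coeff P i))" for t
    by (rule ext) (simp add: poly_altdef sum_fun_apply mult.commute)
  then show ?thesis
    using coefficient_mem[where J = J and d = "degree P" and c = "coeff P", OF assms(1)] assms(2) True by metis
next
  case False
  then show ?thesis using assms(1) by (simp add: coeff_eq_0 fs.subspace_0)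
qed

lemma coeff_linear_power_1:
  fixes a b :: "'a::comm_ring_1"
  shows "coeff ([:a, b:] ^ k) 1 = of_nat k * b * a ^ (k - 1)"
proof (induction k)
  case (Suc k)
  have "coeff ([:a, b:] ^ Suc k) 1 = a * coeff ([:a, b:] ^ k) 1 + b * a ^ k"
    by (simp add: coeff_mult coeff_0_power)
  also have "\<dots> = of_nat (Suc k) * b * a ^ (Suc k - 1)"
    using Suc by (cases k) (auto simp: algebra_simps)
  finally show ?case .
qed auto

section \<open>Symplectic vector spaces\<close>

locale symplectic = vector_space smul
  for smul :: "complex \<Rightarrow> 'v::ab_group_add \<Rightarrow> 'v" +
  fixes \<omega> :: "'v \<Rightarrow> 'v \<Rightarrow> complex"
  assumes symplectic: "symplectic_form smul \<omega>"
begin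

lemma dual_iff': "l \<in> dual smul \<longleftrightarrow> (\<forall>x y. l (x + y) = l x + l y) \<and> (\<forall>c x. l (smul c x) = c * l x)"
  by (rule dual_iff) unfold_locales

lemma subspace_dual': "fs.subspace (dual smul)"
  by (rule subspace_dual) unfold_locales

lemma \<omega>_dual: "\<omega> v \<in> dual smul" and \<omega>_dual_left: "(\<lambda>v. \<omega> v u) \<in> dual smul"
  using symplectic by (auto simp: symplectic_form_def)

lemma \<omega>_right [simp]: "\<omega> v (x + y) = \<omega> v x + \<omega> v y" "\<omega> v (smul c x) = c * \<omega> v x"
  using \<omega>_dual[of v] by (auto simp: dual_iff')

lemma \<omega>_left [simp]: "\<omega> (x + y) u = \<omega> x u + \<omega> y u" "\<omega> (smul c x) u = c * \<omega> x u"
  using \<omega>_dual_left[of u] by (auto simp: dual_iff')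

lemma \<omega>_self [simp]: "\<omega> v v = 0"
  using symplectic by (auto simp: symplectic_form_def)

lemma \<omega>_zero [simp]: "\<omega> v 0 = 0" "\<omega> 0 v = 0"
  using \<omega>_right(2)[of v 0 0] \<omega>_left(2)[of 0 0 v] by auto

lemma \<omega>_nondegenerate: "v \<noteq> 0 \<Longrightarrow> \<exists>u. \<omega> v u \<noteq> 0"
  using symplectic by (auto simp: symplectic_form_def)

lemma \<omega>_commute: "\<omega> u v = - \<omega> v u"
proof -
  have "\<omega> (u + v) (u + v) = \<omega> u u + \<omega> v v + (\<omega> u v + \<omega> v u)"
    by (simp del: \<omega>_self)
  then have "\<omega> u v + \<omega> v u = 0" by simp
  then show ?thesis by (simp add: eq_neg_iff_add_eq_0)
qed

lemma \<omega>_uminus [simp]: "\<omega> v (- x) = - \<omega> v x" "\<omega> (- x) v = - \<omega> x v"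
  using \<omega>_right(2)[of v "- 1" x] \<omega>_left(2)[of "- 1" x v] by auto

lemma \<omega>_diff [simp]: "\<omega> v (x - y) = \<omega> v x - \<omega> v y" "\<omega> (x - y) v = \<omega> x v - \<omega> y v"
  using \<omega>_right(1)[of v x "- y"] \<omega>_left(1)[of x "- y" v] by auto

lemma \<omega>_sum: "\<omega> v (\<Sum>i\<in>A. g i) = (\<Sum>i\<in>A. \<omega> v (g i))" "\<omega> (\<Sum>i\<in>A. g i) v = (\<Sum>i\<in>A. \<omega> (g i) v)"
  by (induction A rule: infinite_finite_induct) auto

definition darboux_system :: "nat \<Rightarrow> (nat \<Rightarrow> 'v) \<Rightarrow> (nat \<Rightarrow> 'v) \<Rightarrow> bool" where
  "darboux_system k E F \<longleftrightarrow> (\<forall>i<k. \<forall>j<k. \<omega> (E i) (F j) = (if i = j then 1 else 0) \<and>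
     \<omega> (E i) (E j) = 0 \<and> \<omega> (F i) (F j) = 0)"

definition darboux_vec :: "nat \<Rightarrow> (nat \<Rightarrow> 'v) \<Rightarrow> (nat \<Rightarrow> 'v) \<Rightarrow> (nat \<Rightarrow> complex) \<Rightarrow> (nat \<Rightarrow> complex) \<Rightarrow> 'v" where
  "darboux_vec k E F a c = (\<Sum>i<k. smul (a i) (E i) + smul (c i) (F i))"

lemma \<omega>_darboux_vec:
  assumes "darboux_system k E F" and "i < k"
  shows "\<omega> (darboux_vec k E F a c) (F i) = a i" and "\<omega> (E i) (darboux_vec k E F a c) = c i"
proof -
  have "\<omega> (darboux_vec k E F a c) (F i) = (\<Sum>j<k. if j = i then a j else 0)"
    unfolding darboux_vec_def \<omega>_sum using assms
    by (intro sum.cong) (auto simp: darboux_system_def)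
  then show "\<omega> (darboux_vec k E F a c) (F i) = a i" using assms(2) by simp
  have "\<omega> (E i) (darboux_vec k E F a c) = (\<Sum>j<k. if j = i then c j else 0)"
    unfolding darboux_vec_def \<omega>_sum using assms
    by (intro sum.cong) (auto simp: darboux_system_def)
  then show "\<omega> (E i) (darboux_vec k E F a c) = c i" using assms(2) by simp
qed

text \<open>Symplectic Gram-Schmidt: \<open>pr w\<close> is the part of \<open>w\<close> orthogonal
  to the system, nonzero by assumption. A vector \<open>u\<close> pairing nontrivially with it can
  be replaced by \<open>pr u\<close> without changing the pairing, and then be scaled.\<close>

lemma darboux_extend:
  assumes E: "darboux_system k E F"
    and w: "w \<noteq> darboux_vec k E F (\<lambda>i. \<omega> w (F i)) (\<lambda>i. \<omega> (E i) w)"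
  shows "\<exists>E F. darboux_system (Suc k) E F"
proof -
  define pr where "pr w = w - darboux_vec k E F (\<lambda>i. \<omega> w (F i)) (\<lambda>i. \<omega> (E i) w)" for w
  have pr12: "\<omega> (pr w) (F i) = 0" "\<omega> (E i) (pr w) = 0" if "i < k" for w i
    using \<omega>_darboux_vec[OF E that] by (simp_all add: pr_def)
  have pr: "\<omega> (pr w) (F i) = 0" "\<omega> (E i) (pr w) = 0" "\<omega> (pr w) (E i) = 0" "\<omega> (F i) (pr w) = 0"
    if "i < k" for w i
    using pr12[OF that] \<omega>_commute[of "pr w" "E i"] \<omega>_commute[of "F i" "pr w"] by simp_all
  have "pr w \<noteq> 0" using w by (simp add: pr_def)
  then obtain u where u: "\<omega> (pr w) u \<noteq> 0" using \<omega>_nondegenerate by blast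
  have "\<omega> (pr w) (pr u) = \<omega> (pr w) u"
    using pr by (simp add: pr_def[of u] darboux_vec_def \<omega>_sum)
  with u have u': "\<omega> (pr w) (pr u) \<noteq> 0" by simp
  define f where "f = smul (1 / \<omega> (pr w) (pr u)) (pr u)"
  have f: "\<omega> (pr w) f = 1" "\<omega> f (pr w) = - 1" "\<omega> f f = 0"
    using u' \<omega>_commute[of "pr u" "pr w"] by (simp_all add: f_def)
  have fE: "\<omega> f (F i) = 0" "\<omega> (E i) f = 0" "\<omega> (F i) f = 0" if "i < k" for i
    using pr[OF that] by (simp_all add: f_def)
  have "darboux_system (Suc k) (E(k := pr w)) (F(k := f))"
    unfolding darboux_system_def
  proof (intro allI impI)
    fix i j assume "i < Suc k" "j < Suc k"
    then consider "i = k" "j = k" | "i = k" "j < k" | "i < k" "j = k" | "i < k" "j < k" by linarith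
    then show "\<omega> ((E(k := pr w)) i) ((F(k := f)) j) = (if i = j then 1 else 0) \<and>
      \<omega> ((E(k := pr w)) i) ((E(k := pr w)) j) = 0 \<and> \<omega> ((F(k := f)) i) ((F(k := f)) j) = 0"
    proof cases
      case 4
      then show ?thesis using E by (simp add: darboux_system_def)
    qed (simp_all add: f fE pr)
  qed
  then show ?thesis by blast
qed

lemma ex_darboux:
  assumes dim: "dim UNIV = 2 * n" and n: "n > 0"
  obtains k E F where "darboux_system k E F" "k \<ge> n"
    "\<And>w. w = darboux_vec k E F (\<lambda>i. \<omega> w (F i)) (\<lambda>i. \<omega> (E i) w)"
proof -
  obtain Bs where Bs: "independent Bs" "span Bs = UNIV" "card Bs = dim UNIV"
    using basis_exists[of UNIV] by (metis UNIV_I subsetI subset_antisym)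
  with dim n have "finite Bs" by (metis card.infinite nat_0_less_mult_iff zero_less_numeral less_nat_zero_code)
  \<comment> \<open>A crude bound that makes a maximal system exist: pairing with the
    \<open>F i\<close> shows that the \<open>E i\<close> are independent.\<close>
  have bound: "k \<le> 2 * n" if ds: "darboux_system k E F" for k E F
  proof -
    have E_eq: "\<omega> (E j) (F i) = (if E j = E i then 1 else 0)" if "i < k" "j < k" for i j
      using ds that unfolding darboux_system_def by (metis one_neq_zero)
    have inj: "inj_on E {..<k}"
      using ds unfolding darboux_system_def inj_on_def by (metis lessThan_iff one_neq_zero)
    have "independent (E ` {..<k})"
    proof (rule independent_if_scalars_zero)
      fix f x assume f: "(\<Sum>x\<in>E ` {..<k}. smul (f x) x) = 0" and x: "x \<in> E ` {..<k}"
      then obtain i where i: "i < k" "x = E i" by auto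
      have "0 = (\<Sum>x\<in>E ` {..<k}. f x * \<omega> x (F i))"
        using arg_cong[OF f, of "\<lambda>z. \<omega> z (F i)"] by (simp add: \<omega>_sum)
      also have "\<dots> = (\<Sum>x'\<in>E ` {..<k}. if x' = x then f x' else 0)"
        using E_eq i by (intro sum.cong) auto
      finally show "f x = 0" using x by simp
    qed simp
    then have "card (E ` {..<k}) \<le> card Bs"
      using independent_span_bound[OF \<open>finite Bs\<close>] Bs by simp
    then show ?thesis using inj dim Bs by (simp add: card_image)
  qed
  define k where "k = (GREATEST k. \<exists>E F. darboux_system k E F)"
  have ex0: "\<exists>E F. darboux_system 0 E F" by (simp add: darboux_system_def)
  have "\<exists>E F. darboux_system k E F"
    unfolding k_def using bound by (intro GreatestI_nat[where P = "\<lambda>k. \<exists>E F. darboux_system k E F", OF ex0]) blast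
  then obtain E F where EF: "darboux_system k E F" by blast
  have "\<not> (\<exists>E F. darboux_system (Suc k) E F)"
    using Greatest_le_nat[of "\<lambda>k. \<exists>E F. darboux_system k E F" "Suc k" "2 * n"] bound
    unfolding k_def[symmetric] by (metis not_less_eq_eq order_refl)
  then have exp: "w = darboux_vec k E F (\<lambda>i. \<omega> w (F i)) (\<lambda>i. \<omega> (E i) w)" for w
    using darboux_extend[OF EF] by blast
  \<comment> \<open>By maximality the \<open>2 * k\<close> vectors of the system span the space, so
    \<open>2 * n \<le> 2 * k\<close>.\<close>
  have "UNIV \<subseteq> span (E ` {..<k} \<union> F ` {..<k})"
  proof
    fix w
    show "w \<in> span (E ` {..<k} \<union> F ` {..<k})"
      by (subst exp, unfold darboux_vec_def, intro span_sum span_add span_scale span_base) auto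
  qed
  then have "dim UNIV \<le> card (E ` {..<k} \<union> F ` {..<k})"
    by (rule dim_le_card) simp
  also have "\<dots> \<le> card (E ` {..<k}) + card (F ` {..<k})" by (rule card_Un_le)
  also have "\<dots> \<le> k + k" by (intro add_mono) (metis card_image_le card_lessThan finite_lessThan)+
  finally have "k \<ge> n" using dim by simp
  then show ?thesis using that EF exp by blast
qed

text \<open>\<open>w\<close> spans the polar point of a hyperplane on which the form \<open>f\<close> is a cone with vertex
  containing that point.\<close>

definition cone_vertex :: "('v \<Rightarrow> complex) \<Rightarrow> 'v \<Rightarrow> bool" where
  "cone_vertex f w \<longleftrightarrow> (\<forall>u t. \<omega> w u = 0 \<longrightarrow> f (u + smul t w) = f u)"

end

section \<open>The witness form in Darboux coordinates\<close>

locale darboux = symplectic smul \<omega>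
  for smul :: "complex \<Rightarrow> 'v::ab_group_add \<Rightarrow> 'v" and \<omega> :: "'v \<Rightarrow> 'v \<Rightarrow> complex" +
  fixes k m :: nat and E F :: "nat \<Rightarrow> 'v"
  assumes m: "m \<ge> 3" and k: "k \<ge> 2" and EF: "darboux_system k E F"
    and expand: "\<And>w. w = darboux_vec k E F (\<lambda>i. \<omega> w (F i)) (\<lambda>i. \<omega> (E i) w)"
begin

definition p :: "nat \<Rightarrow> 'v \<Rightarrow> complex" where "p i w = \<omega> w (F i)"
definition q :: "nat \<Rightarrow> 'v \<Rightarrow> complex" where "q i w = \<omega> (E i) w"
abbreviation y :: "'v \<Rightarrow> complex" where "y \<equiv> q 0"
abbreviation I :: "nat set" where "I \<equiv> {1..<k}"
definition Q :: "nat \<Rightarrow> 'v \<Rightarrow> complex" where "Q i = q i + y"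
text \<open>In the coordinates \<open>p i\<close>, \<open>Q i\<close> (for
  \<open>i \<ge> 1\<close>), \<open>y\<close> and \<open>p 0\<close> of a vector, the symplectic
  form pairs its \<open>y\<close> with \<open>x\<close> instead of \<open>p 0\<close>, an effect of
  the shift in \<open>Q i\<close>.\<close>

definition x :: "'v \<Rightarrow> complex" where "x = p 0 - (\<Sum>i\<in>I. p i)"
abbreviation vec :: "(nat \<Rightarrow> complex) \<Rightarrow> (nat \<Rightarrow> complex) \<Rightarrow> 'v" where "vec \<equiv> darboux_vec k E F"

definition f0 :: "'v \<Rightarrow> complex" where
  "f0 = (\<Sum>i\<in>I. Q i ^ m + p i ^ m) + y * p 0 ^ (m - 1)"

lemma p_dual: "p i \<in> dual smul" and q_dual: "q i \<in> dual smul"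
  by (auto simp: dual_iff' p_def q_def)

lemma Q_dual: "Q i \<in> dual smul"
  unfolding Q_def by (intro fs.subspace_add[OF subspace_dual'] q_dual)

lemma x_dual: "x \<in> dual smul"
  unfolding x_def by (intro fs.subspace_diff[OF subspace_dual'] fs.subspace_sum[OF subspace_dual'] p_dual)

lemma p_vec: "i < k \<Longrightarrow> p i (vec a c) = a i" and q_vec: "i < k \<Longrightarrow> q i (vec a c) = c i"
  using \<omega>_darboux_vec[OF EF] by (auto simp: p_def q_def)

lemma vec_pq: "w = vec (\<lambda>i. p i w) (\<lambda>i. q i w)"
  using expand by (simp add: p_def q_def)

lemma \<omega>_pq: "\<omega> u w = (\<Sum>i<k. p i u * q i w - q i u * p i w)"
proof -
  have "\<omega> u w = \<omega> (vec (\<lambda>i. p i u) (\<lambda>i. q i u)) w"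
    using vec_pq[of u] by simp
  also have "\<dots> = (\<Sum>i<k. p i u * \<omega> (E i) w + q i u * \<omega> (F i) w)"
    by (simp add: darboux_vec_def \<omega>_sum)
  also have "\<dots> = (\<Sum>i<k. p i u * q i w - q i u * p i w)"
    by (intro sum.cong refl) (simp add: p_def q_def \<omega>_commute[of "F _" w])
  finally show ?thesis .
qed

lemma lessThan_k: "{..<k} = insert 0 I" "0 \<notin> I"
  using k by auto

lemma dual_expand:
  assumes "l \<in> dual smul"
  shows "l = (\<Sum>i<k. fscale (l (E i)) (p i) + fscale (l (F i)) (q i))"
proof
  fix w
  have add: "l (a + b) = l a + l b" and sc: "l (smul c a) = c * l a" for a b c
    using assms by (auto simp: dual_iff')
  have sum: "l (sum g A) = (\<Sum>i\<in>A. l (g i))" for g :: "nat \<Rightarrow> 'v" and A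
    using add sc[of 0 0] by (induction A rule: infinite_finite_induct) auto
  have "l w = l (vec (\<lambda>i. p i w) (\<lambda>i. q i w))" using vec_pq[of w] by simp
  then show "l w = (\<Sum>i<k. fscale (l (E i)) (p i) + fscale (l (F i)) (q i)) w"
    by (simp add: darboux_vec_def sum add sc sum_fun_apply mult.commute)
qed

lemma f0_Sym: "f0 \<in> Sym m (dual smul)"
proof -
  have "y * p 0 ^ (m - 1) \<in> Sym (Suc (m - 1)) (dual smul)"
    by (intro Sym_mult_left q_dual Sym_power_form p_dual)
  then have "y * p 0 ^ (m - 1) \<in> Sym m (dual smul)" using m by simp
  then show ?thesis
    unfolding f0_def by (intro Sym_add Sym_sum Sym_power_form Q_dual p_dual)
qed

section \<open>The equations of the cone vertices of the witness\<close>

text \<open>The members of \<open>vertex_eqns d\<close> are the equations of degree \<open>d\<close>, linear in \<open>f\<close>, for the cone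
  vertices \<open>w\<close> of \<open>f\<close>.\<close>

definition vertex_eqns :: "nat \<Rightarrow> (('v \<Rightarrow> complex) \<Rightarrow> ('v \<Rightarrow> complex)) set" where
  "vertex_eqns d = {G. (\<forall>f g. G (f + g) = G f + G g) \<and> (\<forall>c f. G (fscale c f) = fscale c (G f)) \<and>
     (\<forall>f\<in>Sym m (dual smul). G f \<in> Sym d (dual smul) \<and> (\<forall>w. cone_vertex f w \<longrightarrow> G f w = 0))}"

text \<open>Equations specialized at \<open>f0\<close>. Each member comes with a deformation
  \<open>G f\<close> that is linear in \<open>f\<close>, and this deformation is what the
  elimination uses.\<close>

definition J :: "nat \<Rightarrow> ('v \<Rightarrow> complex) set" where
  "J d = {G f0 | G. G \<in> vertex_eqns d}"

definition JJ :: "('v \<Rightarrow> complex) set" where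
  "JJ = fspan (\<Union>d. J d)"

lemma subspace_J: "fs.subspace (J d)"
proof (rule fs.subspaceI)
  have "(\<lambda>_. 0) \<in> vertex_eqns d"
    by (auto simp: vertex_eqns_def Sym_zero fun_eq_iff)
  then show "0 \<in> J d" by (force simp: J_def)
next
  fix a b assume "a \<in> J d" "b \<in> J d"
  then obtain G H where G: "G \<in> vertex_eqns d" "a = G f0" and H: "H \<in> vertex_eqns d" "b = H f0"
    by (auto simp: J_def)
  have "(\<lambda>f. G f + H f) \<in> vertex_eqns d"
    using G H by (auto simp: vertex_eqns_def Sym_add fs.scale_right_distrib)
  then show "a + b \<in> J d" using G H by (force simp: J_def)
next
  fix c a assume "a \<in> J d"
  then obtain G where G: "G \<in> vertex_eqns d" "a = G f0"
    by (auto simp: J_def)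
  have "(\<lambda>f. fscale c (G f)) \<in> vertex_eqns d"
    using G by (auto simp: vertex_eqns_def Sym_fscale fs.scale_right_distrib fs.scale_left_commute)
  then show "fscale c a \<in> J d" using G by (force simp: J_def)
qed

lemma J_Sym: "J d \<subseteq> Sym d (dual smul)"
  using f0_Sym by (auto simp: J_def vertex_eqns_def)

lemma J_mult:
  assumes h: "h \<in> Sym j (dual smul)" and "a \<in> J d"
  shows "h * a \<in> J (j + d)"
proof -
  obtain G where G: "G \<in> vertex_eqns d" "a = G f0"
    using assms by (auto simp: J_def)
  have "h * fscale c g = fscale c (h * g)" for c g
    by (simp add: fun_eq_iff)
  then have "(\<lambda>f. h * G f) \<in> vertex_eqns (j + d)"
    using G Sym_mult[OF h] by (auto simp: vertex_eqns_def distrib_left)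
  then show ?thesis using G by (force simp: J_def)
qed

lemma JJ_fscale: "a \<in> JJ \<Longrightarrow> fscale c a \<in> JJ" and JJ_add: "a \<in> JJ \<Longrightarrow> b \<in> JJ \<Longrightarrow> a + b \<in> JJ"
  and JJ_zero: "0 \<in> JJ" and subspace_JJ: "fs.subspace JJ"
  unfolding JJ_def by (auto intro: fs.span_scale fs.span_add fs.span_zero)

lemma JJ_mult:
  assumes "h \<in> polyfun smul" and "a \<in> JJ"
  shows "h * a \<in> JJ"
proof -
  have "h * a \<in> fspan {h * a | h a. h \<in> (\<Union>k. Sym k (dual smul)) \<and> a \<in> (\<Union>d. J d)}"
    using assms unfolding polyfun_def JJ_def by (rule fspan_mult)
  also have "\<dots> \<subseteq> JJ"
    unfolding JJ_def by (rule fs.span_mono) (use J_mult in blast)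
  finally show ?thesis .
qed

lemma JJ_polyfun: "JJ \<subseteq> polyfun smul"
  unfolding JJ_def by (rule fs.span_minimal) (use J_Sym polyfun_Sym subspace_polyfun in blast)+

lemma ideal_JJ: "ideal_in (polyfun smul) JJ"
proof -
  have "1 \<in> polyfun smul" using polyfun_const[of 1] by (simp add: one_fun_def)
  moreover have "- a \<in> polyfun smul" if "a \<in> polyfun smul" for a
    using fs.subspace_neg[OF subspace_polyfun that] .
  ultimately show ?thesis
    unfolding ideal_in_def
    by (intro conjI ballI JJ_mult JJ_add JJ_zero JJ_polyfun polyfun_add polyfun_mult) assumption+
qed

text \<open>The ideal arguments take place in the ungraded \<open>JJ\<close>, whereas elimination
  needs equations of one fixed degree. The component of degree \<open>d\<close> is isolated by
  comparing coefficients of powers of \<open>t\<close> in the values at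
  \<open>smul t w\<close>.\<close>

lemma JJ_homogeneous:
  assumes "a \<in> JJ" and "a \<in> Sym d (dual smul)"
  shows "a \<in> J d"
proof -
  have "\<exists>g N. (\<forall>i. g i \<in> J i) \<and> a = (\<Sum>i<N. g i)"
    using assms(1) unfolding JJ_def
  proof (induction rule: fs.span_induct_alt)
    case base
    show ?case by (intro exI[of _ "\<lambda>_. 0"] exI[of _ 0]) (simp only: fs.subspace_0[OF subspace_J] lessThan_0 sum.empty simp_thms)
  next
    case (step c z b)
    then obtain e g N where z: "z \<in> J e" and g: "\<And>i. g i \<in> J i" "b = (\<Sum>i<N. g i)" by blast
    define g' where "g' i = (if i < N then g i else 0) + (if i = e then fscale c z else 0)" for i
    have "g' i \<in> J i" for i
      unfolding g'_def using z g fs.subspace_0[OF subspace_J] fs.subspace_scale[OF subspace_J]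
      by (intro fs.subspace_add[OF subspace_J]) auto
    moreover have "fscale c z + b = (\<Sum>i<Suc (max N e). g' i)"
    proof -
      have "(\<Sum>i<Suc (max N e). g' i) = (\<Sum>i<Suc (max N e). if i < N then g i else 0) +
          (\<Sum>i<Suc (max N e). if i = e then fscale c z else 0)"
        by (simp only: g'_def sum.distrib)
      also have "(\<Sum>i<Suc (max N e). if i < N then g i else 0) = (\<Sum>i<N. g i)"
        by (rule sum.mono_neutral_cong_right) auto
      also have "(\<Sum>i<Suc (max N e). if i = e then fscale c z else 0) = fscale c z"
        by (subst sum.delta) auto
      finally show ?thesis by (simp only: g(2) add.commute)
    qed
    ultimately show ?case by blast
  qed
  then obtain g N where g: "\<And>i. g i \<in> J i" and a: "a = (\<Sum>i<N. g i)" by blast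
  define g' where "g' i = (if i < N then g i else 0)" for i
  have a': "a = (\<Sum>i\<le>max N d. g' i)"
    unfolding a g'_def by (rule sum.mono_neutral_cong_left) auto
  have hom: "b (smul t w) = t ^ i * b w" if "b \<in> Sym i (dual smul)" for b t w i
    by (rule Sym_homogeneous[OF that]) (simp add: dual_iff')
  have "a w = g' d w" for w
  proof -
    define P where "P = (\<Sum>i\<le>max N d. monom (g' i w) i) - monom (a w) d"
    have "poly P t = 0" for t
    proof -
      have "(\<Sum>i\<le>max N d. t ^ i * g' i w) = (\<Sum>i\<le>max N d. g' i (smul t w))"
      proof (intro sum.cong refl)
        fix i
        show "t ^ i * g' i w = g' i (smul t w)"
          using hom[of "g i" i t w] g[of i] J_Sym[of i] by (auto simp: g'_def)
      qed
      also have "\<dots> = a (smul t w)" by (simp add: a' sum_fun_apply)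
      also have "\<dots> = t ^ d * a w" by (rule hom[OF assms(2)])
      finally show ?thesis by (simp add: P_def poly_sum poly_monom mult.commute)
    qed
    then have "P = 0" using poly_all_0_iff_0 by blast
    then have "coeff P d = 0" by simp
    then show ?thesis by (simp add: P_def coeff_sum)
  qed
  then have "a = g' d" by blast
  then show ?thesis using g fs.subspace_0[OF subspace_J] by (simp add: g'_def)
qed

lemma JJ_base:
  assumes add: "\<And>a b. S (a + b) = S a + S b" and sc: "\<And>c a. S (smul c a) = smul c (S a)"
    and S: "\<And>w. \<omega> w (S w) = 0"
  shows "(\<lambda>w. f0 (S w + smul t w) - f0 (S w)) \<in> JJ"
proof -
  define G where "G f = (\<lambda>w. f (S w + smul t w) - f (S w))" for f :: "'v \<Rightarrow> complex"
  have "G f \<in> Sym m (dual smul)" if f: "f \<in> Sym m (dual smul)" for f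
  proof -
    have "f \<circ> (\<lambda>w. S w + smul t w) \<in> Sym m (dual smul)"
      by (rule Sym_comp_linear[OF f])
        (auto simp: dual_iff' add sc algebra_simps scale_left_commute)
    moreover have "f \<circ> S \<in> Sym m (dual smul)"
      by (rule Sym_comp_linear[OF f]) (auto simp: dual_iff' add sc)
    ultimately have "(f \<circ> (\<lambda>w. S w + smul t w)) - (f \<circ> S) \<in> Sym m (dual smul)"
      by (rule Sym_diff)
    then show ?thesis by (simp add: G_def comp_def fun_diff_def)
  qed
  moreover have "G f w = 0" if "cone_vertex f w" for f w
    using that S by (simp add: G_def cone_vertex_def)
  ultimately have "G \<in> vertex_eqns m"
    unfolding vertex_eqns_def by (auto simp: G_def fun_eq_iff algebra_simps)
  then have "G f0 \<in> JJ"
    unfolding JJ_def J_def by (intro fs.span_base) blast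
  then show ?thesis by (simp add: G_def)
qed


section \<open>Explicit relations in the ideal of the vertex equations\<close>

lemma dual_polyfun: "l \<in> dual smul \<Longrightarrow> l \<in> polyfun smul"
  using Sym_1 polyfun_Sym by blast

lemma darboux_vec_add: "vec (\<lambda>i. a i + a' i) (\<lambda>i. c i + c' i) = vec a c + vec a' c'"
  by (simp add: darboux_vec_def scale_left_distrib sum.distrib algebra_simps)

lemma darboux_vec_scale: "vec (\<lambda>i. t * a i) (\<lambda>i. t * c i) = smul t (vec a c)"
  by (simp add: darboux_vec_def scale_sum_right scale_right_distrib)

text \<open>For linear forms \<open>\<alpha> i\<close>, \<open>\<kappa> i\<close>, \<open>\<eta>\<close> and \<open>\<beta>\<close>, the vector \<open>direction \<alpha> \<kappa> \<eta> \<beta> w\<close> is the one where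
  \<open>p i\<close>, \<open>Q i\<close> (for \<open>i \<ge> 1\<close>), \<open>y\<close> and \<open>p 0\<close> take the values of these forms at \<open>w\<close>.\<close>

definition direction where
  "direction \<alpha> \<kappa> \<eta> \<beta> w =
     vec (\<lambda>i. if i = 0 then \<beta> w else \<alpha> i w) (\<lambda>i. if i = 0 then \<eta> w else \<kappa> i w - \<eta> w)"

lemma direction_values:
  shows "i \<in> I \<Longrightarrow> p i (direction \<alpha> \<kappa> \<eta> \<beta> w) = \<alpha> i w"
    and "i \<in> I \<Longrightarrow> Q i (direction \<alpha> \<kappa> \<eta> \<beta> w) = \<kappa> i w"
    and "y (direction \<alpha> \<kappa> \<eta> \<beta> w) = \<eta> w" and "p 0 (direction \<alpha> \<kappa> \<eta> \<beta> w) = \<beta> w"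
  using k by (auto simp: direction_def p_vec q_vec Q_def)

lemma form_add: "l \<in> dual smul \<Longrightarrow> l (a + b) = l a + l b"
  and form_smul: "l \<in> dual smul \<Longrightarrow> l (smul c a) = c * l a"
  by (auto simp: dual_iff')

context
  fixes \<alpha> \<kappa> :: "nat \<Rightarrow> 'v \<Rightarrow> complex" and \<eta> \<beta> :: "'v \<Rightarrow> complex"
  assumes forms: "\<And>i. \<alpha> i \<in> dual smul" "\<And>i. \<kappa> i \<in> dual smul" "\<eta> \<in> dual smul" "\<beta> \<in> dual smul"
    and orth: "(\<Sum>i\<in>I. \<alpha> i * q i - \<kappa> i * p i) + \<beta> * y - \<eta> * x = 0"
begin

lemma direction_linear:
  "direction \<alpha> \<kappa> \<eta> \<beta> (a + b) = direction \<alpha> \<kappa> \<eta> \<beta> a + direction \<alpha> \<kappa> \<eta> \<beta> b"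
  "direction \<alpha> \<kappa> \<eta> \<beta> (smul c a) = smul c (direction \<alpha> \<kappa> \<eta> \<beta> a)"
  unfolding direction_def
  by (subst darboux_vec_add[symmetric], rule arg_cong2[of _ _ _ _ vec];
      simp add: fun_eq_iff form_add[OF forms(1)] form_add[OF forms(2)] form_add[OF forms(3)]
        form_add[OF forms(4)] form_smul[OF forms(1)] form_smul[OF forms(2)] form_smul[OF forms(3)]
        form_smul[OF forms(4)] algebra_simps)
    (subst darboux_vec_scale[symmetric], rule arg_cong2[of _ _ _ _ vec];
      simp add: fun_eq_iff form_add[OF forms(1)] form_add[OF forms(2)] form_add[OF forms(3)]
        form_add[OF forms(4)] form_smul[OF forms(1)] form_smul[OF forms(2)] form_smul[OF forms(3)]
        form_smul[OF forms(4)] algebra_simps)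

text \<open>In the pairing of \<open>u\<close> with \<open>w\<close>, writing \<open>q i\<close> as
  \<open>Q i - y\<close> adds \<open>\<eta>\<close> times the sum of the \<open>p i\<close>;
  together with \<open>- \<eta> * p 0\<close> this is \<open>- \<eta> * x\<close>. So the assumption
  \<open>orth\<close> is exactly the orthogonality.\<close>

lemma direction_orthogonal: "\<omega> w (direction \<alpha> \<kappa> \<eta> \<beta> w) = 0"
proof -
  let ?u = "direction \<alpha> \<kappa> \<eta> \<beta> w"
  have "\<omega> ?u w = \<beta> w * y w - \<eta> w * p 0 w + (\<Sum>i\<in>I. p i ?u * q i w - q i ?u * p i w)"
    by (subst \<omega>_pq, subst lessThan_k(1)) (simp add: direction_values)
  also have "(\<Sum>i\<in>I. p i ?u * q i w - q i ?u * p i w) =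
      (\<Sum>i\<in>I. (\<alpha> i w * q i w - \<kappa> i w * p i w) + \<eta> w * p i w)"
  proof (intro sum.cong refl)
    fix i assume "i \<in> I"
    then have vals: "p i ?u = \<alpha> i w" "q i ?u = \<kappa> i w - \<eta> w"
      using direction_values(1)[of i \<alpha> \<kappa> \<eta> \<beta> w] direction_values(2)[of i \<alpha> \<kappa> \<eta> \<beta> w]
        direction_values(3)[of \<alpha> \<kappa> \<eta> \<beta> w]
      by (auto simp: Q_def eq_diff_eq)
    show "p i ?u * q i w - q i ?u * p i w = (\<alpha> i w * q i w - \<kappa> i w * p i w) + \<eta> w * p i w"
      unfolding vals by (simp add: algebra_simps)
  qed
  also have "\<dots> = (\<Sum>i\<in>I. \<alpha> i w * q i w - \<kappa> i w * p i w) + \<eta> w * (\<Sum>i\<in>I. p i w)"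
    by (simp only: sum.distrib sum_distrib_left)
  also have "\<beta> w * y w - \<eta> w * p 0 w + \<dots> =
      ((\<Sum>i\<in>I. \<alpha> i * q i - \<kappa> i * p i) + \<beta> * y - \<eta> * x) w"
    by (simp add: x_def sum_fun_apply algebra_simps)
  also have "\<dots> = 0" by (simp only: orth zero_fun_apply)
  finally show ?thesis by (simp add: \<omega>_commute[of w ?u])
qed

text \<open>With \<open>u = direction \<alpha> \<kappa> \<eta> \<beta> w\<close>, the next two relations are the coefficients of \<open>t\<close> in
  \<open>f0 (u + t w) - f0 u\<close> and in \<open>f0 (t u + w) - f0 (t u)\<close>.\<close>

lemma vertex_relation_1:
  "of_nat m * (\<Sum>i\<in>I. p i * \<alpha> i ^ (m - 1) + Q i * \<kappa> i ^ (m - 1)) + y * \<beta> ^ (m - 1)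
     + of_nat (m - 1) * \<eta> * p 0 * \<beta> ^ (m - 2) \<in> JJ" (is "?r \<in> _")
proof -
  \<comment> \<open>The expansion in \<open>t\<close>. The subtracted value does not depend on
    \<open>t\<close> and leaves the coefficient of \<open>t\<close> unchanged.\<close>
  define P where "P = (\<Sum>i\<in>I. [:\<kappa> i, Q i:] ^ m + [:\<alpha> i, p i:] ^ m) + [:\<eta>, y:] * [:\<beta>, p 0:] ^ (m - 1)
    - [:\<lambda>w. f0 (direction \<alpha> \<kappa> \<eta> \<beta> w):]"
  have "poly P (\<lambda>_. t) \<in> JJ" for t
  proof -
    have "poly P (\<lambda>_. t) w = f0 (direction \<alpha> \<kappa> \<eta> \<beta> w + smul t w) - f0 (direction \<alpha> \<kappa> \<eta> \<beta> w)" for w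
    proof -
      let ?u = "direction \<alpha> \<kappa> \<eta> \<beta> w"
      have "f0 (?u + smul t w) = (\<Sum>i\<in>I. (\<kappa> i w + t * Q i w) ^ m + (\<alpha> i w + t * p i w) ^ m)
          + (\<eta> w + t * y w) * (\<beta> w + t * p 0 w) ^ (m - 1)"
        by (simp add: f0_def sum_fun_apply form_add[OF Q_dual] form_add[OF p_dual] form_add[OF q_dual]
          form_smul[OF Q_dual] form_smul[OF p_dual] form_smul[OF q_dual] direction_values)
      then show ?thesis
        by (simp add: P_def poly_sum sum_fun_apply distrib_right mult.assoc)
    qed
    moreover have "(\<lambda>w. f0 (direction \<alpha> \<kappa> \<eta> \<beta> w + smul t w) - f0 (direction \<alpha> \<kappa> \<eta> \<beta> w)) \<in> JJ"
      by (rule JJ_base[OF direction_linear direction_orthogonal])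
    ultimately show ?thesis by presburger
  qed
  then have "coeff P 1 \<in> JJ" by (rule poly_coeff_mem[OF subspace_JJ])
  also have "coeff P 1 = ?r"
  proof -
    have "coeff ([:\<eta>, y:] * [:\<beta>, p 0:] ^ (m - 1)) 1 =
        \<eta> * coeff ([:\<beta>, p 0:] ^ (m - 1)) 1 + y * \<beta> ^ (m - 1)"
      by (simp add: coeff_mult coeff_0_power)
    also have "coeff ([:\<beta>, p 0:] ^ (m - 1)) 1 = of_nat (m - 1) * p 0 * \<beta> ^ (m - 2)"
      using coeff_linear_power_1[of \<beta> "p 0" "m - 1"] by (simp add: numeral_2_eq_2)
    finally have c: "coeff ([:\<eta>, y:] * [:\<beta>, p 0:] ^ (m - 1)) 1 = 
        \<eta> * (of_nat (m - 1) * p 0 * \<beta> ^ (m - 2)) + y * \<beta> ^ (m - 1)" .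
    show ?thesis
      unfolding P_def coeff_diff coeff_add coeff_sum coeff_linear_power_1 c
      using m by (simp add: sum_distrib_left algebra_simps)
  qed
  finally show ?thesis .
qed

lemma vertex_relation_2:
  "of_nat m * (\<Sum>i\<in>I. \<alpha> i * p i ^ (m - 1) + \<kappa> i * Q i ^ (m - 1)) + \<eta> * p 0 ^ (m - 1)
     + of_nat (m - 1) * y * \<beta> * p 0 ^ (m - 2) \<in> JJ" (is "?r \<in> _")
proof -
  \<comment> \<open>The subtracted value is \<open>f0 (t u) = t ^ m * f0 u\<close>, hence the
    monomial of degree \<open>m\<close>; it does not meet the coefficient of
    \<open>t\<close>.\<close>
  define P where "P = (\<Sum>i\<in>I. [:Q i, \<kappa> i:] ^ m + [:p i, \<alpha> i:] ^ m) + [:y, \<eta>:] * [:p 0, \<beta>:] ^ (m - 1)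
    - monom (\<lambda>w. f0 (direction \<alpha> \<kappa> \<eta> \<beta> w)) m"
  have "poly P (\<lambda>_. t) \<in> JJ" for t
  proof -
    define S where "S w = smul t (direction \<alpha> \<kappa> \<eta> \<beta> w)" for w
    have "poly P (\<lambda>_. t) w = f0 (S w + smul 1 w) - f0 (S w)" for w
    proof -
      let ?u = "direction \<alpha> \<kappa> \<eta> \<beta> w"
      have "f0 (S w + smul 1 w) = (\<Sum>i\<in>I. (Q i w + t * \<kappa> i w) ^ m + (p i w + t * \<alpha> i w) ^ m)
          + (y w + t * \<eta> w) * (p 0 w + t * \<beta> w) ^ (m - 1)"
        by (simp add: S_def f0_def sum_fun_apply form_add[OF Q_dual] form_add[OF p_dual] form_add[OF q_dual]
          form_smul[OF Q_dual] form_smul[OF p_dual] form_smul[OF q_dual] direction_values add.commute)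
      moreover have "f0 (S w) = t ^ m * f0 ?u"
        unfolding S_def by (rule Sym_homogeneous[OF f0_Sym]) (rule form_smul)
      ultimately show ?thesis
        by (simp add: P_def poly_sum sum_fun_apply poly_monom distrib_right mult.assoc
          mult.commute[of _ "t ^ m"])
    qed
    moreover have "(\<lambda>w. f0 (S w + smul 1 w) - f0 (S w)) \<in> JJ"
      by (rule JJ_base)
        (simp_all add: S_def direction_linear direction_orthogonal scale_right_distrib scale_left_commute)
    ultimately show ?thesis by presburger
  qed
  then have "coeff P 1 \<in> JJ" by (rule poly_coeff_mem[OF subspace_JJ])
  also have "coeff P 1 = ?r"
  proof -
    have "coeff ([:y, \<eta>:] * [:p 0, \<beta>:] ^ (m - 1)) 1 =
        y * coeff ([:p 0, \<beta>:] ^ (m - 1)) 1 + \<eta> * p 0 ^ (m - 1)"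
      by (simp add: coeff_mult coeff_0_power)
    also have "coeff ([:p 0, \<beta>:] ^ (m - 1)) 1 = of_nat (m - 1) * \<beta> * p 0 ^ (m - 2)"
      using coeff_linear_power_1[of "p 0" \<beta> "m - 1"] by (simp add: numeral_2_eq_2)
    finally have c: "coeff ([:y, \<eta>:] * [:p 0, \<beta>:] ^ (m - 1)) 1 = 
        y * (of_nat (m - 1) * \<beta> * p 0 ^ (m - 2)) + \<eta> * p 0 ^ (m - 1)" .
    show ?thesis
      unfolding P_def coeff_diff coeff_add coeff_sum coeff_linear_power_1 c
      using m by (simp add: sum_distrib_left algebra_simps)
  qed
  finally show ?thesis .
qed

end

lemma JJ_of_nat_cancel:
  assumes "j > 0" and "of_nat j * a \<in> JJ"
  shows "a \<in> JJ"
proof -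
  have "fscale (1 / of_nat j) (of_nat j * a) \<in> JJ" by (rule JJ_fscale[OF assms(2)])
  also have "fscale (1 / of_nat j) (of_nat j * a) = a"
    using assms(1) by (simp add: fun_eq_iff)
  finally show ?thesis .
qed

lemma dual_zero: "0 \<in> dual smul"
  by (rule fs.subspace_0[OF subspace_dual'])

lemma dual_uminus: "l \<in> dual smul \<Longrightarrow> - l \<in> dual smul"
  by (rule fs.subspace_neg[OF subspace_dual'])

lemma dual_if: "a \<in> dual smul \<Longrightarrow> b \<in> dual smul \<Longrightarrow> (if P then a else b) \<in> dual smul"
  by simp

lemmas forms = dual_zero dual_uminus dual_if p_dual q_dual x_dual Q_dual

lemma power_if_0: "j > 0 \<Longrightarrow> (if P then a else 0) ^ j = (if P then a ^ j else 0)"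
  for a :: "'b::comm_ring_1"
  by (simp add: power_0_left)

lemma m_pos: "m > 0" "m - 1 > 0" "m - 2 > 0"
  using m by auto

lemma zero_power_m [simp]:
  "(0::'b::comm_ring_1) ^ (m - 1) = 0" "(0::'b) ^ (m - Suc 0) = 0" "(0::'b) ^ (m - 2) = 0"
  using m by (auto simp: power_0_left)

lemma sum_single: "i \<in> I \<Longrightarrow> (\<Sum>j\<in>I. (if j = i then a else 0) * f j) = a * f i"
  for a :: "'b::comm_ring_1"
  by (simp add: if_distrib[of "\<lambda>z. z * _"] cong: if_cong)

text \<open>The condition \<open>orth\<close> is a linear relation between the forms
  \<open>q i\<close>, \<open>p i\<close>, \<open>y\<close> and \<open>x\<close>. Except for
  \<open>rel_f\<close>, the lemmas \<open>rel_a\<close> to \<open>rel_g\<close> solve it by a Koszul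
  relation: two of these forms serve, up to sign, as coefficients of each other, and all other
  coefficients are 0. The pairs are \<open>p i\<close> and \<open>x\<close> here, then
  \<open>q i\<close> and \<open>x\<close>, \<open>p i\<close> and \<open>y\<close>,
  \<open>q i\<close> and \<open>y\<close>, \<open>y\<close> and \<open>x\<close>, \<open>p i\<close>
  and \<open>q i\<close>. Most terms of the two vertex relations vanish for such a choice.\<close>

lemma rel_a:
  assumes i: "i \<in> I"
  shows "Q i * x ^ (m - 1) \<in> JJ" and "of_nat m * (x * Q i ^ (m - 1)) - p i * p 0 ^ (m - 1) \<in> JJ"
proof -
  have o: "(\<Sum>j\<in>I. 0 * q j - (if j = i then x else 0) * p j) + 0 * y - (- p i) * x = 0"
    using sum_single[OF i, of x p] by (simp add: sum_negf mult.commute[of x])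
  note fs = forms(1) forms(3)[OF x_dual forms(1)] forms(2)[OF p_dual]
  have "of_nat m * (Q i * x ^ (m - 1)) \<in> JJ"
    using vertex_relation_1[of "\<lambda>_. 0" "\<lambda>j. if j = i then x else 0" "- p i" 0, OF fs forms(1) o]
      i m_pos
    by (simp add: power_if_0 if_distrib[of "\<lambda>z. _ * z"] cong: if_cong)
  then show "Q i * x ^ (m - 1) \<in> JJ" using JJ_of_nat_cancel m_pos by blast
  show "of_nat m * (x * Q i ^ (m - 1)) - p i * p 0 ^ (m - 1) \<in> JJ"
    using vertex_relation_2[of "\<lambda>_. 0" "\<lambda>j. if j = i then x else 0" "- p i" 0, OF fs forms(1) o]
      i m_pos
    by (simp add: if_distrib[of "\<lambda>z. z * _"] cong: if_cong)
qed

lemma rel_b: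
  assumes i: "i \<in> I"
  shows "p i * x ^ (m - 1) \<in> JJ"
proof -
  have o: "(\<Sum>j\<in>I. (if j = i then x else 0) * q j - 0 * p j) + 0 * y - q i * x = 0"
    using sum_single[OF i, of x q] by (simp add: mult.commute[of x])
  have "of_nat m * (p i * x ^ (m - 1)) \<in> JJ"
    using vertex_relation_1[of "\<lambda>j. if j = i then x else 0" "\<lambda>_. 0" "q i" 0,
        OF forms(3)[OF x_dual forms(1)] forms(1) q_dual forms(1) o] i m_pos
    by (simp add: power_if_0 if_distrib[of "\<lambda>z. _ * z"] cong: if_cong)
  then show ?thesis using JJ_of_nat_cancel m_pos by blast
qed

lemma rel_c:
  assumes i: "i \<in> I"
  shows "of_nat m * (y * Q i ^ (m - 1)) + of_nat (m - 1) * y * p i * p 0 ^ (m - 2) \<in> JJ"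
proof -
  have o: "(\<Sum>j\<in>I. 0 * q j - (if j = i then y else 0) * p j) + p i * y - 0 * x = 0"
    using sum_single[OF i, of y p] by (simp add: sum_negf mult.commute[of y])
  show ?thesis
    using vertex_relation_2[of "\<lambda>_. 0" "\<lambda>j. if j = i then y else 0" 0 "p i",
        OF forms(1) forms(3)[OF q_dual forms(1)] forms(1) p_dual o] i
    by (simp add: if_distrib[of "\<lambda>z. z * _"] cong: if_cong)
qed

lemma rel_d:
  assumes i: "i \<in> I"
  shows "of_nat m * (y * p i ^ (m - 1)) - of_nat (m - 1) * y * q i * p 0 ^ (m - 2) \<in> JJ"
    and "of_nat m * (p i * y ^ (m - 1)) + y * (- q i) ^ (m - 1) \<in> JJ"
proof -
  have o: "(\<Sum>j\<in>I. (if j = i then y else 0) * q j - 0 * p j) + (- q i) * y - 0 * x = 0"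
    using sum_single[OF i, of y q] by (simp add: mult.commute[of y])
  note fs = forms(3)[OF q_dual forms(1)] forms(1) forms(1) forms(2)[OF q_dual]
  show "of_nat m * (y * p i ^ (m - 1)) - of_nat (m - 1) * y * q i * p 0 ^ (m - 2) \<in> JJ"
    using vertex_relation_2[of "\<lambda>j. if j = i then y else 0" "\<lambda>_. 0" 0 "- q i", OF fs o] i
    by (simp add: if_distrib[of "\<lambda>z. z * _"] cong: if_cong)
  show "of_nat m * (p i * y ^ (m - 1)) + y * (- q i) ^ (m - 1) \<in> JJ"
    using vertex_relation_1[of "\<lambda>j. if j = i then y else 0" "\<lambda>_. 0" 0 "- q i", OF fs o] i m_pos
    by (simp add: power_if_0 if_distrib[of "\<lambda>z. _ * z"] cong: if_cong)
qed

lemma rel_e: "y * x ^ (m - 1) + of_nat (m - 1) * y * p 0 * x ^ (m - 2) \<in> JJ"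
proof -
  have o: "(\<Sum>j\<in>I. 0 * q j - 0 * p j) + x * y - y * x = 0"
    by simp
  show ?thesis
    using vertex_relation_1[of "\<lambda>_. 0" "\<lambda>_. 0" y x, OF forms(1) forms(1) q_dual x_dual o] m_pos
    by simp
qed

lemma rel_g:
  assumes i: "i \<in> I"
  shows "p i * p i ^ (m - 1) + Q i * q i ^ (m - 1) \<in> JJ"
proof -
  have o: "(\<Sum>j\<in>I. (if j = i then p i else 0) * q j - (if j = i then q i else 0) * p j) + 0 * y - 0 * x = 0"
    using sum_single[OF i, of "p i" q] sum_single[OF i, of "q i" p]
    by (simp add: sum_subtractf mult.commute[of "q i"])
  have "of_nat m * (p i * p i ^ (m - 1) + Q i * q i ^ (m - 1)) \<in> JJ"
    using vertex_relation_1[of "\<lambda>j. if j = i then p i else 0" "\<lambda>j. if j = i then q i else 0" 0 0,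
        OF forms(3)[OF p_dual forms(1)] forms(3)[OF q_dual forms(1)] forms(1) forms(1) o] i m_pos
    by (simp add: power_if_0 if_distrib[of "\<lambda>z. _ * z"] sum.distrib cong: if_cong)
  then show ?thesis using JJ_of_nat_cancel m_pos by blast
qed

text \<open>The Koszul choice for \<open>p i\<close> and \<open>q i\<close> is perturbed by
  \<open>s\<close> times the one for \<open>q i\<close> and \<open>p l\<close>; the coefficient of
  \<open>s\<close> isolates the mixed term.\<close>

lemma rel_f:
  assumes i: "i \<in> I" and l: "l \<in> I" and neq: "l \<noteq> i"
  shows "p i ^ (m - 1) * p l \<in> JJ"
proof -
  define P where "P = [:p i:] * [:p i, p l:] ^ (m - 1) + [:Q i * q i ^ (m - 1):] + monom (Q l * q i ^ (m - 1)) (m - 1)"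
  have "poly P (\<lambda>_. s) \<in> JJ" for s
  proof -
    define \<alpha> where "\<alpha> j = (if j = i then p i + fscale s (p l) else 0)" for j
    define \<kappa> where "\<kappa> j = (if j = i then q i else if j = l then fscale s (q i) else 0)" for j
    have fs: "\<alpha> j \<in> dual smul" "\<kappa> j \<in> dual smul" for j
      unfolding \<alpha>_def \<kappa>_def
      by (intro forms fs.subspace_add[OF subspace_dual'] fs.subspace_scale[OF subspace_dual'])+
    have two: "(\<Sum>j\<in>I. f j) = f i + f l" if "\<And>j. j \<noteq> i \<Longrightarrow> j \<noteq> l \<Longrightarrow> f j = 0" for f :: "nat \<Rightarrow> 'v \<Rightarrow> complex"
    proof -
      have "(\<Sum>j\<in>I. f j) = (\<Sum>j\<in>{i, l}. f j)"
        using i l that by (intro sum.mono_neutral_right) auto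
      then show ?thesis using neq by simp
    qed
    have o: "(\<Sum>j\<in>I. \<alpha> j * q j - \<kappa> j * p j) + 0 * y - 0 * x = 0"
      using neq by (subst two) (auto simp: \<alpha>_def \<kappa>_def fun_eq_iff algebra_simps)
    have "of_nat m * (\<Sum>j\<in>I. p j * \<alpha> j ^ (m - 1) + Q j * \<kappa> j ^ (m - 1)) \<in> JJ"
      using vertex_relation_1[of \<alpha> \<kappa> 0 0, OF fs forms(1) forms(1) o] m_pos by simp
    then have "(\<Sum>j\<in>I. p j * \<alpha> j ^ (m - 1) + Q j * \<kappa> j ^ (m - 1)) \<in> JJ"
      using JJ_of_nat_cancel m_pos by blast
    also have "(\<Sum>j\<in>I. p j * \<alpha> j ^ (m - 1) + Q j * \<kappa> j ^ (m - 1)) =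
        (p i * \<alpha> i ^ (m - 1) + Q i * \<kappa> i ^ (m - 1)) + (p l * \<alpha> l ^ (m - 1) + Q l * \<kappa> l ^ (m - 1))"
      using m_pos by (subst two) (simp_all add: \<alpha>_def \<kappa>_def)
    also have "\<dots> = poly P (\<lambda>_. s)"
      using neq m_pos by (simp add: \<alpha>_def \<kappa>_def P_def fun_eq_iff poly_monom power_mult_distrib algebra_simps)
    finally show ?thesis .
  qed
  then have "coeff P 1 \<in> JJ" by (rule poly_coeff_mem[OF subspace_JJ])
  \<comment> \<open>The term with \<open>Q l\<close> has degree \<open>m - 1 \<ge> 2\<close> in
    \<open>s\<close>, so it does not contribute.\<close>
  also have "coeff P 1 = p i * (of_nat (m - 1) * p l * p i ^ (m - 2))"
    using m coeff_linear_power_1[of "p i" "p l" "m - 1"]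
    unfolding P_def coeff_add by (simp add: coeff_mult numeral_2_eq_2)
  also have "\<dots> = of_nat (m - 1) * (p i ^ Suc (m - 2) * p l)"
    by (simp add: algebra_simps)
  also have "Suc (m - 2) = m - 1" using m by simp
  finally show ?thesis using JJ_of_nat_cancel m_pos by blast
qed

end

section \<open>The zero locus of the ideal at the witness\<close>

lemma ideal_power:
  assumes "ideal_in R I" and "a \<in> I" and "j > 0"
  shows "a ^ j \<in> I"
  using ideal_power_mono[OF assms(1), of a 1 j] ideal_subset[OF assms(1)] assms(2,3) by auto

lemma ideal_mult_right: "ideal_in R I \<Longrightarrow> a \<in> I \<Longrightarrow> r \<in> R \<Longrightarrow> a * r \<in> I"
  using ideal_mult[of R I r a] by (simp add: mult.commute)

context darboux
begin

lemma ideal_of_nat_cancel: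
  assumes "ideal_in (polyfun smul) K" and "j > 0" and "of_nat j * a \<in> K"
  shows "a \<in> K"
proof -
  have "(\<lambda>_. 1 / of_nat j) * (of_nat j * a) \<in> K"
    by (rule ideal_mult[OF assms(1) polyfun_const assms(3)])
  also have "(\<lambda>_. 1 / of_nat j) * (of_nat j * a) = a"
    using assms(2) by (simp add: fun_eq_iff)
  finally show ?thesis .
qed

lemmas p_poly = dual_polyfun[OF p_dual] and q_poly = dual_polyfun[OF q_dual]
  and Q_poly = dual_polyfun[OF Q_dual] and x_poly = dual_polyfun[OF x_dual]

text \<open>The point \<open>E 0\<close> (where \<open>x = 1\<close> and the other coordinates vanish) is a reduced isolated point of the zero
  locus of \<open>JJ\<close> \<dots>\<close>

lemma x_power_mult:
  assumes i: "i \<in> I"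
  shows "x ^ m * p i \<in> JJ" and "x ^ m * q i \<in> JJ" and "x ^ m * y \<in> JJ"
proof -
  note id = ideal_JJ
  have m': "x ^ m = x * x ^ (m - 1)" "x ^ (m - 1) = x * x ^ (m - 2)"
    using m by (simp_all flip: power_Suc add: Suc_diff_Suc numeral_2_eq_2)
  have px: "p j * x ^ (m - 1) \<in> JJ" if "j \<in> I" for j
    using rel_b[OF that] .
  have "x * (p i * x ^ (m - 1)) \<in> JJ"
    by (rule ideal_mult[OF id x_poly px[OF i]])
  then show "x ^ m * p i \<in> JJ" by (simp add: m'(1) mult_ac)
  have "y * (\<Sum>j\<in>I. p j * x ^ (m - 1)) \<in> JJ"
    by (intro ideal_mult[OF id q_poly] ideal_sum[OF id] px)
  then have s: "of_nat (m - 1) * (y * (\<Sum>j\<in>I. p j * x ^ (m - 1))) \<in> JJ"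
    by (rule ideal_mult[OF id ring_of_nat[OF id]])
  \<comment> \<open>Modulo the \<open>p j * x ^ (m - 1)\<close>, the factor \<open>p 0\<close> can
    be replaced by \<open>x\<close>. Both terms of \<open>rel_e\<close>, times \<open>x\<close>,
    then become multiples of \<open>x ^ m * y\<close>, with coefficients adding up to
    \<open>m\<close>.\<close>
  have "x * (y * x ^ (m - 1) + of_nat (m - 1) * y * p 0 * x ^ (m - 2)) -
      of_nat (m - 1) * (y * (\<Sum>j\<in>I. p j * x ^ (m - 1))) \<in> JJ"
    by (intro ideal_diff[OF id] ideal_mult[OF id x_poly] rel_e s)
  also have "x * (y * x ^ (m - 1) + of_nat (m - 1) * y * p 0 * x ^ (m - 2)) -
      of_nat (m - 1) * (y * (\<Sum>j\<in>I. p j * x ^ (m - 1))) =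
      y * x ^ m + of_nat (m - 1) * y * x ^ (m - 1) * (p 0 - (\<Sum>j\<in>I. p j))"
    unfolding m' by (simp only: sum_distrib_right[symmetric]) (simp add: algebra_simps)
  also have "\<dots> = of_nat (Suc (m - 1)) * (x ^ m * y)"
    unfolding x_def[symmetric] m'(1) by (simp add: algebra_simps)
  finally show y: "x ^ m * y \<in> JJ"
    by (rule ideal_of_nat_cancel[OF id zero_less_Suc])
  have "x * (Q i * x ^ (m - 1)) - x ^ m * y \<in> JJ"
    by (intro ideal_diff[OF id] ideal_mult[OF id x_poly] rel_a(1)[OF i] y)
  also have "x * (Q i * x ^ (m - 1)) - x ^ m * y = x ^ m * q i"
    unfolding m'(1) Q_def by (simp add: algebra_simps)
  finally show "x ^ m * q i \<in> JJ" .
qed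

text \<open>\<dots> and the zero locus has no point on the hyperplane \<open>x = 0\<close>.\<close>

lemma nilpotent:
  assumes i: "i \<in> I"
  shows "p i \<in> rad_in (polyfun smul) JJ" and "q i \<in> rad_in (polyfun smul) JJ"
    and "y \<in> rad_in (polyfun smul) JJ"
proof -
  \<comment> \<open>By \<open>x_power_mult\<close> a power of \<open>x\<close> multiplies each of
    the three forms into \<open>JJ\<close>, so nilpotency only has to be shown modulo
    \<open>JJ\<close> and \<open>x\<close>.\<close>
  define A where "A = {a + x * r | a r. a \<in> JJ \<and> r \<in> polyfun smul}"
  have idA: "ideal_in (polyfun smul) A"
    unfolding A_def by (rule ideal_in_adjoin[OF ideal_JJ x_poly])
  define N where "N = rad_in (polyfun smul) A"
  have id: "ideal_in (polyfun smul) N"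
    unfolding N_def by (rule ideal_in_radical[OF idA])
  have xN: "x \<in> N" unfolding N_def A_def
    by (intro ideal_subset_radical[OF idA[unfolded A_def]] adjoin_base[OF ideal_JJ] x_poly)
  have JN: "a \<in> N" if "a \<in> JJ" for a unfolding N_def A_def
    using that adjoin_superset[OF ideal_JJ] by (intro ideal_subset_radical[OF idA[unfolded A_def]]) blast
  note prod_N = radical_mult_power[OF idA, folded N_def]
  have prod1_N: "a * b \<in> N" if "a * b ^ j \<in> N" "a \<in> polyfun smul" "b \<in> polyfun smul" for a b j
    using prod_N[of a b 1 j] that by simp
  have power_N: "a \<in> N" if "a ^ j \<in> N" "a \<in> polyfun smul" for a j
    using radical_power[OF idA, folded N_def] that by blast
  note of_nat_R = ring_of_nat[OF id] and power_R = ring_power[OF id] and mult_R = ring_mult[OF id]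
  have pB: "p j * p 0 \<in> N" if j: "j \<in> I" for j
  proof -
    have "of_nat m * (x * Q j ^ (m - 1)) - (of_nat m * (x * Q j ^ (m - 1)) - p j * p 0 ^ (m - 1)) \<in> N"
      by (intro ideal_diff[OF id] ideal_mult[OF id of_nat_R] ideal_mult_right[OF id xN]
          power_R Q_poly JN rel_a(2) j)
    then have "p j * p 0 ^ (m - 1) \<in> N" by (simp only: diff_diff_eq2 add_diff_cancel_left')
    then show ?thesis by (rule prod1_N[OF _ p_poly p_poly])
  qed
  \<comment> \<open>\<open>p 0\<close> is the sum of \<open>x\<close> and the \<open>p j\<close>;
    its product with \<open>x\<close> and with each \<open>p j\<close> is already in
    \<open>N\<close>.\<close>
  have B: "p 0 \<in> N"
  proof (rule power_N[OF _ p_poly])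
    have "p 0 * x + (\<Sum>j\<in>I. p j * p 0) \<in> N"
      by (intro ideal_add[OF id] ideal_mult[OF id p_poly xN] ideal_sum[OF id] pB)
    also have "p 0 * x + (\<Sum>j\<in>I. p j * p 0) = p 0 ^ 2"
      by (simp only: sum_distrib_right[symmetric]) (simp add: x_def power2_eq_square algebra_simps)
    finally show "p 0 ^ 2 \<in> N" .
  qed
  have B': "p 0 ^ (m - 2) \<in> N"
    by (rule ideal_power[OF id B m_pos(3)])
  have Qy: "y * Q j \<in> N" if j: "j \<in> I" for j
  proof -
    have "(of_nat m * (y * Q j ^ (m - 1)) + of_nat (m - 1) * y * p j * p 0 ^ (m - 2)) -
        of_nat (m - 1) * y * p j * p 0 ^ (m - 2) \<in> N"
      by (intro ideal_diff[OF id] JN rel_c j ideal_mult[OF id _ B'] mult_R of_nat_R q_poly p_poly)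
    then have "of_nat m * (y * Q j ^ (m - 1)) \<in> N" by (simp only: add_diff_cancel_right')
    from ideal_of_nat_cancel[OF id m_pos(1) this]
    show ?thesis by (rule prod1_N[OF _ q_poly Q_poly])
  qed
  have py: "y * p j \<in> N" if j: "j \<in> I" for j
  proof -
    have "(of_nat m * (y * p j ^ (m - 1)) - of_nat (m - 1) * y * q j * p 0 ^ (m - 2)) +
        of_nat (m - 1) * y * q j * p 0 ^ (m - 2) \<in> N"
      by (intro ideal_add[OF id] JN rel_d j ideal_mult[OF id _ B'] mult_R of_nat_R q_poly p_poly)
    then have "of_nat m * (y * p j ^ (m - 1)) \<in> N" by (simp only: diff_add_cancel)
    from ideal_of_nat_cancel[OF id m_pos(1) this]
    show ?thesis by (rule prod1_N[OF _ q_poly p_poly])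
  qed
  have qy: "y * q j \<in> N" if j: "j \<in> I" for j
  proof -
    have "y ^ (m - 1) = y * y ^ (m - 2)"
      using m by (simp flip: power_Suc add: Suc_diff_Suc numeral_2_eq_2)
    then have e: "of_nat m * (p j * y ^ (m - 1)) = (of_nat m * y ^ (m - 2)) * (y * p j)"
      by (simp only: mult_ac)
    have "(of_nat m * (p j * y ^ (m - 1)) + y * (- q j) ^ (m - 1)) - of_nat m * (p j * y ^ (m - 1)) \<in> N"
      unfolding e
      by (intro ideal_diff[OF id] JN rel_d(2)[OF j, unfolded e] ideal_mult[OF id _ py] mult_R of_nat_R power_R q_poly j)
    then have "y * (- q j) ^ (m - 1) \<in> N" by (simp only: add_diff_cancel_left')
    then have "y * (- q j) \<in> N"
      by (rule prod1_N[OF _ q_poly ring_uminus[OF id q_poly]])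
    from ideal_uminus[OF id this] show ?thesis by simp
  qed
  \<comment> \<open>Here the shift in \<open>Q i\<close> excludes the point \<open>F 0\<close>: both
    \<open>y * Q i\<close> and \<open>y * q i\<close> are in \<open>N\<close>, and they differ by
    \<open>y ^ 2\<close>.\<close>
  have yN: "y \<in> N"
  proof (rule power_N[OF _ q_poly])
    have "y * Q i - y * q i \<in> N"
      by (intro ideal_diff[OF id] Qy qy i)
    also have "y * Q i - y * q i = y ^ 2"
      by (simp add: Q_def power2_eq_square algebra_simps)
    finally show "y ^ 2 \<in> N" .
  qed
  have pp: "p j * p l \<in> N" if "j \<in> I" "l \<in> I" "l \<noteq> j" for j l
  proof -
    have "p l * p j ^ (m - 1) \<in> N"
      using JN[OF rel_f[OF that]] by (simp only: mult.commute)
    from prod1_N[OF this p_poly p_poly] show ?thesis by (simp only: mult.commute)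
  qed
  \<comment> \<open>\<open>p i\<close> equals \<open>p 0 - x\<close> minus the other
    \<open>p l\<close>, and its product with each of these forms is in \<open>N\<close>.\<close>
  have pN: "p i \<in> N"
  proof (rule power_N[OF _ p_poly])
    have "p i * p 0 - p i * x - (\<Sum>l\<in>I - {i}. p i * p l) \<in> N"
      by (intro ideal_diff[OF id] ideal_sum[OF id] pB ideal_mult[OF id p_poly xN] pp i) auto
    also have "p i * p 0 - p i * x - (\<Sum>l\<in>I - {i}. p i * p l) = p i ^ 2"
    proof -
      have "(\<Sum>l\<in>I. p l) = p i + (\<Sum>l\<in>I - {i}. p l)"
        using i by (intro sum.remove) auto
      then show ?thesis
        by (simp only: x_def sum_distrib_left[symmetric]) (simp add: power2_eq_square algebra_simps)
    qed
    finally show "p i ^ 2 \<in> N" .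
  qed
  have qN: "q i \<in> N"
  proof (rule power_N[OF _ q_poly])
    have "(p i * p i ^ (m - 1) + Q i * q i ^ (m - 1)) - p i * p i ^ (m - 1) - y * q i ^ (m - 1) \<in> N"
      by (intro ideal_diff[OF id] JN rel_g i ideal_mult_right[OF id pN] ideal_mult_right[OF id yN]
        power_R p_poly q_poly)
    also have "(p i * p i ^ (m - 1) + Q i * q i ^ (m - 1)) - p i * p i ^ (m - 1) - y * q i ^ (m - 1) =
        q i ^ Suc (m - 1)"
      by (simp add: Q_def algebra_simps)
    finally show "q i ^ Suc (m - 1) \<in> N" .
  qed
  note nil = nilpotent_if_nilpotent_mod[OF ideal_JJ x_poly, folded A_def, folded N_def]
  show "p i \<in> rad_in (polyfun smul) JJ" "q i \<in> rad_in (polyfun smul) JJ" "y \<in> rad_in (polyfun smul) JJ"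
    using nil[OF p_poly x_power_mult(1)[OF i] pN] nil[OF q_poly x_power_mult(2)[OF i] qN]
      nil[OF q_poly x_power_mult(3)[OF i] yN] by auto
qed

section \<open>All forms of large degree vanishing at \<open>E 0\<close>\<close>

lemma Sym_polyfun: "L \<subseteq> dual smul \<Longrightarrow> s \<in> Sym j L \<Longrightarrow> s \<in> polyfun smul"
  using Sym_mono polyfun_Sym by blast

text \<open>Surplus linear factors are absorbed as ring elements. Used with \<open>h = 1\<close> and
  with \<open>h = x ^ m\<close>.\<close>

lemma Sym_ideal_mono:
  assumes "L \<subseteq> dual smul" and "\<And>s. s \<in> Sym b L \<Longrightarrow> h * s \<in> JJ" and "s \<in> Sym (b + c) L"
  shows "h * s \<in> JJ"
proof -
  have *: "h * (\<lambda>x. \<Prod>i<b + c. l i x) \<in> JJ" if "\<And>i. i < b + c \<Longrightarrow> l i \<in> L" for l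
    using that
  proof (induction c)
    case 0
    then have "h * (\<lambda>x. \<Prod>i<b. l i x) \<in> JJ" by (intro assms(2) Sym_prod) simp
    then show ?case by (simp only: add_0_right)
  next
    case (Suc c)
    have "l (b + c) * (h * (\<lambda>x. \<Prod>i<b + c. l i x)) \<in> JJ"
    proof (rule JJ_mult)
      show "l (b + c) \<in> polyfun smul" using Suc.prems[of "b + c"] assms(1) dual_polyfun by auto
      show "h * (\<lambda>x. \<Prod>i<b + c. l i x) \<in> JJ" by (rule Suc.IH, rule Suc.prems) simp
    qed
    also have "l (b + c) * (h * (\<lambda>x. \<Prod>i<b + c. l i x)) = h * (\<lambda>x. \<Prod>i<b + Suc c. l i x)"
      by (simp add: fun_eq_iff mult_ac)
    finally show ?case .
  qed
  from assms(3) show ?thesis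
  proof (induction rule: Sym_induct)
    case zero
    show ?case by (simp only: mult_zero_right JJ_zero)
  next
    case (add p q)
    then show ?case by (simp only: distrib_left JJ_add)
  next
    case (scale c p)
    have "h * fscale c p = fscale c (h * p)" by (simp add: fun_eq_iff)
    then show ?case using scale JJ_fscale by metis
  next
    case (prod l)
    then show ?case by (rule *)
  qed
qed

text \<open>Binomial expansion in powers of \<open>g\<close>, one linear factor at a time. Used to
  split off a generator of a nilpotent ideal, and to split off \<open>x\<close>.\<close>

lemma Sym_expand:
  assumes "s \<in> Sym n {fscale c g + h | c h. h \<in> H}"
  shows "s \<in> fspan {g ^ j * s | j s. j \<le> n \<and> s \<in> Sym (n - j) H}" (is "_ \<in> fspan (?E n)")
  using assms
proof (induction rule: Sym_induct)
  case (prod l)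
  then show ?case
  proof (induction n)
    case 0
    have "(\<lambda>x. \<Prod>i<0. l i x) \<in> ?E 0"
      by (auto simp: Sym_0 fun_eq_iff intro!: exI[of _ "\<lambda>_. 1"])
    then show ?case by (rule fs.span_base)
  next
    case (Suc n)
    have "l n \<in> {fscale c g + h | c h. h \<in> H}" by (rule Suc.prems) simp
    then obtain c h where ch: "l n = fscale c g + h" "h \<in> H" by blast
    have mult: "(fscale c g + h) * a \<in> fspan (?E (Suc n))" if "a \<in> fspan (?E n)" for a
      using that
    proof (induction rule: fs.span_induct_alt)
      case base
      show ?case by (simp only: mult_zero_right fs.span_zero)
    next
      case (step d a b)
      then obtain j s where js: "a = g ^ j * s" "j \<le> n" "s \<in> Sym (n - j) H" by blast
      have "g ^ Suc j * s \<in> ?E (Suc n)"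
        using js by (auto intro!: exI[of _ "Suc j"] exI[of _ s])
      moreover have "g ^ j * (h * s) \<in> ?E (Suc n)"
        using js Sym_mult_left[OF ch(2) js(3)] by (auto simp: Suc_diff_le intro!: exI[of _ j] exI[of _ "h * s"])
      moreover have "(fscale c g + h) * (fscale d a + b) =
          fscale d (fscale c (g ^ Suc j * s) + g ^ j * (h * s)) + (fscale c g + h) * b"
        by (simp add: js(1) fun_eq_iff algebra_simps)
      ultimately show ?case
        using step by (simp only: fs.span_add fs.span_scale fs.span_base)
    qed
    have "l n * (\<lambda>x. \<Prod>i<n. l i x) \<in> fspan (?E (Suc n))"
      unfolding ch(1) by (rule mult, rule Suc.IH, rule Suc.prems) simp
    also have "l n * (\<lambda>x. \<Prod>i<n. l i x) = (\<lambda>x. \<Prod>i<Suc n. l i x)"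
      by (simp add: fun_eq_iff)
    finally show ?case .
  qed
qed (rule fs.span_zero fs.span_add fs.span_scale | assumption)+

text \<open>If \<open>g ^ a\<close> and all products of \<open>b\<close> forms of the smaller span
  lie in \<open>JJ\<close>, then degree \<open>a + b\<close> suffices: in each term
  \<open>g ^ j * s\<close> of the expansion, either \<open>j \<ge> a\<close> or the degree
  \<open>a + b - j\<close> of \<open>s\<close> exceeds \<open>b\<close>.\<close>

lemma nilpotent_span:
  assumes "finite T" and "T \<subseteq> dual smul" and "T \<subseteq> rad_in (polyfun smul) JJ"
  shows "\<exists>M. Sym M (fspan T) \<subseteq> JJ"
  using assms
proof (induction T rule: finite_induct)
  case empty
  have "Sym 1 (fspan {}) \<subseteq> {0 :: 'v \<Rightarrow> complex}"
    unfolding Sym_def by (rule fs.span_minimal) (auto simp: fun_eq_iff)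
  then show ?case using JJ_zero by blast
next
  case (insert g T)
  then obtain b where b: "Sym b (fspan T) \<subseteq> JJ" by (metis insert_subset)
  from insert.prems obtain a where a: "g ^ a \<in> JJ" by (auto simp: rad_in_def)
  have T: "fspan T \<subseteq> dual smul"
    using insert.prems by (intro fs.span_minimal subspace_dual') auto
  have "fspan (insert g T) \<subseteq> {fscale c g + h | c h. h \<in> fspan T}"
  proof
    fix f assume "f \<in> fspan (insert g T)"
    then obtain c where "f - fscale c g \<in> fspan T" by (auto simp: fs.span_insert)
    moreover have "f = fscale c g + (f - fscale c g)" by simp
    ultimately show "f \<in> {fscale c g + h | c h. h \<in> fspan T}" by blast
  qed
  then have "Sym (a + b) (fspan (insert g T)) \<subseteq>
      fspan {g ^ j * s | j s. j \<le> a + b \<and> s \<in> Sym (a + b - j) (fspan T)}"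
    using Sym_mono Sym_expand by blast
  also have "\<dots> \<subseteq> JJ"
  proof (rule fs.span_minimal[OF _ subspace_JJ], safe)
    fix j s assume j: "j \<le> a + b" and s: "s \<in> Sym (a + b - j) (fspan T)"
    have g: "g ^ i \<in> polyfun smul" for i
      using insert.prems ring_power[OF ideal_JJ dual_polyfun] by auto
    show "g ^ j * s \<in> JJ"
    proof (cases "a \<le> j")
      case True
      have "g ^ j \<in> JJ"
        using ideal_power_mono[OF ideal_JJ _ a True] g[of 1] by simp
      then show ?thesis
        using ideal_mult_right[OF ideal_JJ] Sym_polyfun[OF T s] by blast
    next
      case False
      then have "a + b - j = b + (a - j)" by simp
      then have "1 * s \<in> JJ"
        using Sym_ideal_mono[OF T, of b 1 s "a - j"] b s by auto
      then show ?thesis using JJ_mult[OF g] by simp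
    qed
  qed
  finally show ?case by blast
qed

lemma E0_values: "p 0 (E 0) = 1" "i \<in> I \<Longrightarrow> p i (E 0) = 0" "i < k \<Longrightarrow> q i (E 0) = 0" "x (E 0) = 1"
proof -
  show "p 0 (E 0) = 1" and p: "\<And>i. i \<in> I \<Longrightarrow> p i (E 0) = 0" and "\<And>i. i < k \<Longrightarrow> q i (E 0) = 0"
    using EF k by (auto simp: p_def q_def darboux_system_def)
  then show "x (E 0) = 1" by (simp add: x_def sum_fun_apply)
qed

text \<open>The degree is \<open>m + M\<close>, where all products of \<open>M\<close> linear forms
  vanishing at \<open>E 0\<close> lie in \<open>JJ\<close>. Up to a multiple of
  \<open>x ^ (m + M)\<close>, which is determined by the value at \<open>E 0\<close>, a form of this
  degree is a sum of terms \<open>x ^ j * s\<close> with \<open>s\<close> of positive degree in such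
  linear forms. If \<open>j \<ge> m\<close>, then \<open>x ^ m\<close> times a factor of
  \<open>s\<close> is in the ideal; otherwise \<open>s\<close> has degree above
  \<open>M\<close>.\<close>

theorem J_large_degree:
  "\<exists>D>0. \<forall>g\<in>Sym D (dual smul). g (E 0) = 0 \<longrightarrow> g \<in> J D"
proof -
  define Z where "Z = {l \<in> dual smul. l (E 0) = 0}"
  define T where "T = p ` I \<union> q ` {..<k}"
  have one: "1 \<in> I" using k by simp
  have T: "T \<subseteq> dual smul" "T \<subseteq> rad_in (polyfun smul) JJ"
    using p_dual q_dual nilpotent nilpotent(3)[OF one] lessThan_k by (auto simp: T_def simp del: One_nat_def)
  have xZ: "x ^ m * l \<in> JJ" if "l \<in> T" for l
    using that x_power_mult one by (auto simp: T_def lessThan_k(1) simp del: One_nat_def)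
  have Z_T: "Z \<subseteq> fspan T"
  proof
    fix l assume "l \<in> Z"
    then have l: "l \<in> dual smul" "l (E 0) = 0" by (auto simp: Z_def)
    have "fscale (l (E i)) (p i) + fscale (l (F i)) (q i) \<in> fspan T" if "i \<in> {..<k}" for i
    proof (cases "i = 0")
      case True
      then show ?thesis using l that by (simp add: T_def fs.span_scale fs.span_base)
    next
      case False
      with that have "p i \<in> T" "q i \<in> T" by (auto simp: T_def)
      then show ?thesis by (simp only: fs.span_add fs.span_scale fs.span_base)
    qed
    then have "(\<Sum>i<k. fscale (l (E i)) (p i) + fscale (l (F i)) (q i)) \<in> fspan T"
      by (rule fs.span_sum)
    then show "l \<in> fspan T" using dual_expand[OF l(1)] by simp
  qed
  have xZ': "x ^ m * l \<in> JJ" if "l \<in> Z" for l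
  proof -
    have "l \<in> fspan T" using that Z_T by blast
    then show ?thesis
    proof (induction rule: fs.span_induct_alt)
      case base
      show ?case by (simp only: mult_zero_right JJ_zero)
    next
      case (step c a b)
      have "x ^ m * (fscale c a + b) = fscale c (x ^ m * a) + x ^ m * b"
        by (simp add: fun_eq_iff algebra_simps)
      then show ?case using step xZ JJ_add JJ_fscale by metis
    qed
  qed
  obtain M where "Sym M (fspan T) \<subseteq> JJ"
    using nilpotent_span[OF _ T] by (auto simp: T_def)
  with Z_T have M: "Sym M Z \<subseteq> JJ" using Sym_mono by blast
  have Z: "Z \<subseteq> dual smul" by (auto simp: Z_def)
  let ?D = "m + M"
  have dual_split: "dual smul \<subseteq> {fscale c x + h | c h. h \<in> Z}"
  proof
    fix l assume l: "l \<in> dual smul"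
    have "l - fscale (l (E 0)) x \<in> Z"
      using fs.subspace_diff[OF subspace_dual' l fs.subspace_scale[OF subspace_dual' x_dual]]
      by (simp add: Z_def E0_values)
    moreover have "l = fscale (l (E 0)) x + (l - fscale (l (E 0)) x)" by simp
    ultimately show "l \<in> {fscale c x + h | c h. h \<in> Z}" by blast
  qed
  have main: "g - fscale (g (E 0)) (x ^ ?D) \<in> JJ" if g: "g \<in> Sym ?D (dual smul)" for g
  proof -
    have "g \<in> fspan {x ^ j * s | j s. j \<le> ?D \<and> s \<in> Sym (?D - j) Z}"
      using Sym_expand[of g ?D x Z] Sym_mono[OF dual_split] g by blast
    then show ?thesis
    proof (induction rule: fs.span_induct_alt)
      case base
      have "0 - fscale (0 (E 0)) (x ^ ?D) = 0" by (simp add: fun_eq_iff)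
      then show ?case using JJ_zero by metis
    next
      case (step c a b)
      then obtain j s where a: "a = x ^ j * s" and j: "j \<le> ?D" and s: "s \<in> Sym (?D - j) Z" by blast
      have "a - fscale (a (E 0)) (x ^ ?D) \<in> JJ"
      proof (cases "j = ?D")
        case True
        with s obtain d where "s = (\<lambda>_. d)" by (auto simp: Sym_0)
        then have "a - fscale (a (E 0)) (x ^ ?D) = 0"
          using True by (simp add: a fun_eq_iff E0_values)
        then show ?thesis using JJ_zero by simp
      next
        case False
        have "s (E 0) = 0 ^ (?D - j) * s (E 0)"
          by (rule Sym_homogeneous[OF s]) (simp add: Z_def)
        moreover have "(0::complex) ^ (?D - j) = 0" using False j by (intro zero_power) simp
        ultimately have "s (E 0) = 0" by simp
        moreover have "a \<in> JJ"
        proof (cases "m \<le> j")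
          case True
          have s': "x ^ m * s' \<in> JJ" if "s' \<in> Sym 1 Z" for s'
            using that
          proof (induction rule: Sym_induct)
            case zero
            show ?case by (simp only: mult_zero_right JJ_zero)
          next
            case (add p q)
            then show ?case by (simp only: distrib_left JJ_add)
          next
            case (scale c p)
            have "x ^ m * fscale c p = fscale c (x ^ m * p)" by (simp add: fun_eq_iff)
            then show ?case using scale JJ_fscale by metis
          next
            case (prod l)
            have "(\<lambda>w. \<Prod>i<1. l i w) = l 0" by (simp add: fun_eq_iff)
            moreover have "x ^ m * l 0 \<in> JJ" by (rule xZ', rule prod) simp
            ultimately show ?case by metis
          qed
          have "?D - j = 1 + (?D - j - 1)" using \<open>j \<noteq> ?D\<close> j by simp
          with s have s1: "s \<in> Sym (1 + (?D - j - 1)) Z" by metis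
          have "x ^ m * s \<in> JJ"
          proof (rule Sym_ideal_mono[OF Z _ s1])
            show "x ^ m * t \<in> JJ" if "t \<in> Sym 1 Z" for t by (rule s'[OF that])
          qed
          then have "x ^ (j - m) * (x ^ m * s) \<in> JJ"
            by (rule JJ_mult[OF ring_power[OF ideal_JJ x_poly]])
          also have "x ^ (j - m) * (x ^ m * s) = a"
            using True by (simp add: a mult.assoc[symmetric] power_add[symmetric])
          finally show ?thesis .
        next
          case False
          then have "?D - j = M + (m - j)" by simp
          then have "1 * s \<in> JJ"
            using Sym_ideal_mono[OF Z, of M 1 s "m - j"] M s by auto
          then show ?thesis
            using JJ_mult[OF ring_power[OF ideal_JJ x_poly]] by (simp add: a)
        qed
        ultimately show ?thesis by (simp add: a)
      qed
      moreover have "(fscale c a + b) - fscale ((fscale c a + b) (E 0)) (x ^ ?D) =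
          fscale c (a - fscale (a (E 0)) (x ^ ?D)) + (b - fscale (b (E 0)) (x ^ ?D))"
        by (simp add: fun_eq_iff algebra_simps)
      ultimately show ?case using step(2) by (simp only: JJ_add JJ_fscale)
    qed
  qed
  have "g \<in> J ?D" if g: "g \<in> Sym ?D (dual smul)" "g (E 0) = 0" for g
  proof (rule JJ_homogeneous[OF _ g(1)])
    show "g \<in> JJ" using main[OF g(1)] g(2) by simp
  qed
  then show ?thesis using m by (intro exI[of _ ?D]) auto
qed


section \<open>The vertex as a polynomial in the form\<close>

lemma Sym_finite_dim: "\<exists>C. finite C \<and> Sym d (dual smul) \<subseteq> fspan C"
proof (rule Sym_finite_span)
  show "finite (p ` {..<k} \<union> q ` {..<k})" by simp
  show "dual smul \<subseteq> fspan (p ` {..<k} \<union> q ` {..<k})"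
  proof
    fix l assume "l \<in> dual smul"
    then have "l = (\<Sum>i<k. fscale (l (E i)) (p i) + fscale (l (F i)) (q i))" by (rule dual_expand)
    also have "\<dots> \<in> fspan (p ` {..<k} \<union> q ` {..<k})"
      by (intro fs.span_sum fs.span_add fs.span_scale fs.span_base) auto
    finally show "l \<in> fspan (p ` {..<k} \<union> q ` {..<k})" .
  qed
qed

text \<open>The unknowns are the values at \<open>w\<close> of a basis \<open>S\<close> of the forms
  of degree \<open>D\<close> vanishing at \<open>E 0\<close>. They are found relative to the value
  of one further form \<open>X\<close>, and these ratios give the coordinates of \<open>w\<close> up
  to a common factor.\<close>

theorem ex_generic_vertex:
  obtains d \<Delta> v where "\<Delta> \<in> Sym d (dual fscale)" "\<Delta> f0 \<noteq> 0"
    "\<And>l. l \<in> dual smul \<Longrightarrow> (\<lambda>f. l (v f)) \<in> Sym d (dual fscale)"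
    "\<And>f w. f \<in> Sym m (dual smul) \<Longrightarrow> \<Delta> f \<noteq> 0 \<Longrightarrow> cone_vertex f w \<Longrightarrow> w \<noteq> 0 \<Longrightarrow>
       \<exists>c. c \<noteq> 0 \<and> w = smul c (v f)"
proof -
  obtain D where D: "D > 0" and J: "\<And>g. g \<in> Sym D (dual smul) \<Longrightarrow> g (E 0) = 0 \<Longrightarrow> g \<in> J D"
    using J_large_degree by blast
  define K where "K = {g \<in> Sym D (dual smul). g (E 0) = 0}"
  have subK: "fs.subspace K"
    unfolding K_def
    by (intro fs.subspaceI) (auto simp: Sym_zero Sym_add Sym_fscale simp del: plus_fun_apply, auto)
  obtain C where "finite C" "Sym D (dual smul) \<subseteq> fspan C" using Sym_finite_dim by blast
  then have C: "K \<subseteq> fspan C" "finite C" by (auto simp: K_def)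
  obtain S \<phi> where S: "finite S" "S \<subseteq> K" and \<phi>: "\<And>b. \<phi> b \<in> dual fscale"
    "\<And>b b'. b \<in> S \<Longrightarrow> b' \<in> S \<Longrightarrow> \<phi> b b' = (if b = b' then 1 else 0)"
    "\<And>g. g \<in> K \<Longrightarrow> g = (\<Sum>b\<in>S. fscale (\<phi> b g) b)"
    using ex_dual_basis[OF subK C] by blast
  have \<phi>_lin: "\<phi> b (f + g) = \<phi> b f + \<phi> b g" "\<phi> b (fscale c f) = c * \<phi> b f" for b f g c
    using \<phi>(1)[of b] by (auto simp: dual_iff[OF vector_space_fscale])
  define X where "X = p 0 ^ D"
  have X: "X \<in> Sym D (dual smul)" "X (E 0) = 1"
    unfolding X_def using Sym_power_form[OF p_dual] by (auto simp: E0_values)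
  \<comment> \<open>Subtracting the multiple of \<open>X\<close> that has the same value at
    \<open>E 0\<close> moves \<open>g\<close> into \<open>K\<close>, where the coordinates
    \<open>\<phi> b\<close> are meaningful.\<close>
  define \<psi> where "\<psi> b g = \<phi> b (g + fscale (- g (E 0)) X)" for b g
  have \<psi>_lin: "\<psi> b (f + g) = \<psi> b f + \<psi> b g" "\<psi> b (fscale c f) = c * \<psi> b f" for b f g c
  proof -
    have "(f + g) + fscale (- (f + g) (E 0)) X = (f + fscale (- f (E 0)) X) + (g + fscale (- g (E 0)) X)"
      "fscale c f + fscale (- fscale c f (E 0)) X = fscale c (f + fscale (- f (E 0)) X)"
      by (simp_all add: fun_eq_iff algebra_simps)
    then show "\<psi> b (f + g) = \<psi> b f + \<psi> b g" "\<psi> b (fscale c f) = c * \<psi> b f"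
      unfolding \<psi>_def by (simp_all only: \<phi>_lin)
  qed
  have "\<forall>b. \<exists>G. b \<in> S \<longrightarrow> G \<in> vertex_eqns D \<and> b = G f0"
    using S J unfolding K_def J_def by blast
  then obtain G where G: "\<And>b. b \<in> S \<Longrightarrow> G b \<in> vertex_eqns D" "\<And>b. b \<in> S \<Longrightarrow> G b f0 = b"
    by metis
  have G_lin: "G b (f + g) = G b f + G b g" "G b (fscale c f) = fscale c (G b f)" if "b \<in> S" for b f g c
    using G(1)[OF that] by (auto simp: vertex_eqns_def)
  \<comment> \<open>Row \<open>b\<close> consists of the coefficients of \<open>G b f\<close> with
    respect to \<open>S\<close>. The remaining coefficient \<open>G b f (E 0)\<close>, that of
    \<open>X\<close>, goes to the right side with opposite sign, since \<open>G b f\<close> vanishes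
    at the vertex.\<close>
  define A where "A b b' f = \<psi> b' (G b f)" for b b' f
  define B where "B b f = - G b f (E 0)" for b f
  have "\<exists>d \<Delta> c. \<Delta> \<in> Sym d (dual fscale) \<and> (\<forall>b\<in>S. c b \<in> Sym d (dual fscale)) \<and> \<Delta> f0 = 1 \<and>
    (\<forall>f y y0. (\<forall>j\<in>S. (\<Sum>k\<in>S. A j k f * y k) = B j f * y0) \<longrightarrow>
       (\<forall>k\<in>S. \<Delta> f * y k = c k f * y0))"
  proof (rule elimination[where d = 1])
    show "finite S" by (rule S)
    show "A b b' \<in> Sym 1 (dual fscale)" if "b \<in> S" "b' \<in> S" for b b'
      by (rule Sym_1) (simp add: dual_iff[OF vector_space_fscale] A_def G_lin[OF that(1)] \<psi>_lin)
    show "B b \<in> Sym 1 (dual fscale)" if "b \<in> S" for b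
      by (rule Sym_1) (simp add: dual_iff[OF vector_space_fscale] B_def G_lin[OF that(1)])
    show "A b b' f0 = (if b = b' then 1 else 0)" if "b \<in> S" "b' \<in> S" for b b'
    proof -
      have "b (E 0) = 0" using that S by (auto simp: K_def)
      then have "\<psi> b' b = \<phi> b' b" by (simp add: \<psi>_def)
      then show ?thesis using that G(2) \<phi>(2) by (auto simp: A_def)
    qed
  qed
  then obtain d \<Delta> c where \<Delta>: "\<Delta> \<in> Sym d (dual fscale)" "\<Delta> f0 = 1"
    and c: "\<And>b. b \<in> S \<Longrightarrow> c b \<in> Sym d (dual fscale)"
    and sol: "\<And>f y y0 b. (\<forall>j\<in>S. (\<Sum>k\<in>S. A j k f * y k) = B j f * y0) \<Longrightarrow> b \<in> S \<Longrightarrow> \<Delta> f * y b = c b f * y0"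
    by blast
  have sol_b: "\<Delta> f * b w = c b f * X w"
    if f: "f \<in> Sym m (dual smul)" and w: "cone_vertex f w" and b: "b \<in> S" for f w b
  proof (rule sol[OF _ b], rule ballI)
    fix j assume j: "j \<in> S"
    have Gj: "G j f \<in> Sym D (dual smul)" "G j f w = 0"
      using G(1)[OF j] f w by (auto simp: vertex_eqns_def)
    have "G j f + fscale (- G j f (E 0)) X \<in> K"
      unfolding K_def
    proof (intro CollectI conjI Sym_add Sym_fscale Gj X)
      show "(G j f + fscale (- G j f (E 0)) X) (E 0) = 0" by (simp add: X)
    qed
    then have "G j f + fscale (- G j f (E 0)) X = (\<Sum>b\<in>S. fscale (\<psi> b (G j f)) b)"
      unfolding \<psi>_def by (rule \<phi>(3))
    from arg_cong[OF this, of "\<lambda>h. h w"]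
    have "(G j f + fscale (- G j f (E 0)) X) w = (\<Sum>b\<in>S. A j b f * b w)"
      by (simp add: sum_fun_apply A_def)
    then show "(\<Sum>k\<in>S. A j k f * k w) = B j f * X w"
      using Gj by (simp add: B_def)
  qed
  define cf where "cf g f = (\<Sum>b\<in>S. \<phi> b g * c b f)" for g f
  have cf_Sym: "cf g \<in> Sym d (dual fscale)" for g
  proof -
    have "cf g = (\<Sum>b\<in>S. fscale (\<phi> b g) (c b))"
      by (simp add: cf_def fun_eq_iff sum_fun_apply)
    then show ?thesis using c by (simp only: Sym_sum Sym_fscale)
  qed
  have sol_g: "\<Delta> f * g w = cf g f * X w"
    if f: "f \<in> Sym m (dual smul)" and w: "cone_vertex f w" and g: "g \<in> K" for f w g
  proof -
    have "g w = (\<Sum>b\<in>S. \<phi> b g * b w)"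
      using arg_cong[OF \<phi>(3)[OF g], of "\<lambda>h. h w"] by (simp add: sum_fun_apply)
    then have "\<Delta> f * g w = (\<Sum>b\<in>S. \<phi> b g * (\<Delta> f * b w))"
      by (simp add: sum_distrib_left mult_ac)
    also have "\<dots> = (\<Sum>b\<in>S. \<phi> b g * (c b f * X w))"
      using sol_b[OF f w] by simp
    finally show ?thesis by (simp add: cf_def sum_distrib_right mult.assoc)
  qed
  define X' where "X' = p 0 ^ (D - 1)"
  have X': "X = X' * p 0" using D by (simp add: X_def X'_def power_eq_if mult.commute)
  have KX: "X' * l \<in> K" if "l \<in> dual smul" "l (E 0) = 0" for l
  proof -
    have "l * X' \<in> Sym (Suc (D - 1)) (dual smul)"
      unfolding X'_def by (intro Sym_mult_left that Sym_power_form p_dual)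
    then show ?thesis using D that by (simp add: K_def mult.commute)
  qed
  \<comment> \<open>For a form \<open>l\<close> vanishing at \<open>E 0\<close>, the ratio of
    \<open>l\<close> to \<open>p 0\<close> at \<open>w\<close> is that of \<open>X' * l\<close> to
    \<open>X = X' * p 0\<close>. With the common denominator \<open>\<Delta> f\<close>, the
    coordinate \<open>p 0\<close> itself becomes \<open>\<Delta> f\<close>.\<close>
  define a where "a f i = (if i = 0 then \<Delta> f else cf (X' * p i) f)" for f i
  define a' where "a' f i = cf (X' * q i) f" for f i
  define v where "v f = vec (a f) (a' f)" for f
  have vSym: "(\<lambda>f. l (v f)) \<in> Sym d (dual fscale)" if l: "l \<in> dual smul" for l
  proof -
    have "l (v f) = (\<Sum>i<k. l (E i) * p i (v f) + l (F i) * q i (v f))" for f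
      using arg_cong[OF dual_expand[OF l], of "\<lambda>h. h (v f)"] by (simp add: sum_fun_apply)
    also have "\<dots> f = (\<Sum>i<k. l (E i) * a f i + l (F i) * a' f i)" for f
      by (intro sum.cong refl) (simp add: v_def p_vec q_vec)
    finally have "(\<lambda>f. l (v f)) = (\<Sum>i<k. fscale (l (E i)) (\<lambda>f. a f i) + fscale (l (F i)) (\<lambda>f. a' f i))"
      by (simp add: fun_eq_iff sum_fun_apply)
    moreover have "(\<lambda>f. a f i) \<in> Sym d (dual fscale)" "(\<lambda>f. a' f i) \<in> Sym d (dual fscale)" for i
      using \<Delta>(1) cf_Sym by (cases "i = 0"; simp add: a_def a'_def)+
    ultimately show ?thesis by (simp only: Sym_sum Sym_add Sym_fscale)
  qed
  have main: "\<exists>c. c \<noteq> 0 \<and> w = smul c (v f)"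
    if f: "f \<in> Sym m (dual smul)" and \<Delta>f: "\<Delta> f \<noteq> 0" and w: "cone_vertex f w" "w \<noteq> 0" for f w
  proof -
    \<comment> \<open>Otherwise \<open>X w = 0\<close>, and the powers \<open>l ^ D\<close> of the
      forms vanishing at \<open>E 0\<close> would force all coordinates of \<open>w\<close> to be
      0.\<close>
    have p0: "p 0 w \<noteq> 0"
    proof
      assume p0: "p 0 w = 0"
      then have Xw: "X w = 0" using D by (simp add: X_def)
      have l0: "l w = 0" if "l \<in> dual smul" "l (E 0) = 0" for l
      proof -
        have "l ^ D \<in> K" using Sym_power_form[OF that(1)] that D by (simp add: K_def)
        from sol_g[OF f w(1) this] show ?thesis using Xw \<Delta>f by simp
      qed
      have pw: "p i w = 0" "q i w = 0" if "i < k" for i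
        using p0 that l0[OF p_dual] l0[OF q_dual] E0_values(2,3) by (cases "i = 0"; force)+
      have "w = (\<Sum>i<k. smul (p i w) (E i) + smul (q i w) (F i))"
        using vec_pq[of w] by (simp only: darboux_vec_def)
      also have "\<dots> = 0" using pw by simp
      finally show False using w(2) by simp
    qed
    then have X'w: "X' w \<noteq> 0" by (simp add: X'_def)
    have lin: "\<Delta> f * l w = cf (X' * l) f * p 0 w" if "l \<in> dual smul" "l (E 0) = 0" for l
      using sol_g[OF f w(1) KX[OF that]] X'w by (simp add: X')
    have pw: "\<Delta> f * p i w = p 0 w * a f i" "\<Delta> f * q i w = p 0 w * a' f i" if "i < k" for i
      using lin[OF p_dual, of i] lin[OF q_dual, of i] E0_values(2,3) that
      by (cases "i = 0"; simp add: a_def a'_def mult.commute)+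
    have "smul (\<Delta> f) w = (\<Sum>i<k. smul (\<Delta> f * p i w) (E i) + smul (\<Delta> f * q i w) (F i))"
      using arg_cong[OF vec_pq[of w], of "smul (\<Delta> f)"]
      by (simp add: darboux_vec_scale[symmetric]) (simp add: darboux_vec_def)
    also have "\<dots> = smul (p 0 w) (v f)"
      unfolding v_def darboux_vec_scale[symmetric] by (simp add: darboux_vec_def pw)
    finally have "smul (1 / \<Delta> f) (smul (\<Delta> f) w) = smul (p 0 w / \<Delta> f) (v f)"
      by simp
    then show ?thesis
      using \<Delta>f p0 by (intro exI[of _ "p 0 w / \<Delta> f"]) simp
  qed
  show ?thesis
  proof (rule that[of \<Delta> d v])
    show "\<Delta> f0 \<noteq> 0" using \<Delta>(2) by simp
  qed (fact \<Delta>(1) vSym main)+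
qed

end

section \<open>Points of the incidence\<close>

text \<open>Restriction commutes with products of at least one factor. For \<open>n = 0\<close> the
  left side consists of the constants, which need not vanish outside \<open>H\<close>.\<close>

lemma Sym_res:
  assumes "n > 0"
  shows "Sym n (res H ` L) = res H ` Sym n L"
proof
  show "Sym n (res H ` L) \<subseteq> res H ` Sym n L"
  proof
    fix a assume "a \<in> Sym n (res H ` L)"
    then show "a \<in> res H ` Sym n L"
    proof (induction rule: Sym_induct)
      case zero
      have "0 = res H 0" by (simp add: res_def fun_eq_iff)
      then show ?case using Sym_zero by blast
    next
      case (add a b)
      then obtain a' b' where "a = res H a'" "b = res H b'" "a' \<in> Sym n L" "b' \<in> Sym n L" by blast
      moreover from this have "a + b = res H (a' + b')" by (simp add: res_def fun_eq_iff)
      ultimately show ?case using Sym_add by blast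
    next
      case (scale c a)
      then obtain a' where "a = res H a'" "a' \<in> Sym n L" by blast
      moreover from this have "fscale c a = res H (fscale c a')" by (simp add: res_def fun_eq_iff)
      ultimately show ?case using Sym_fscale by blast
    next
      case (prod l)
      then have "\<forall>i. \<exists>l'. i < n \<longrightarrow> l' \<in> L \<and> l i = res H l'" by blast
      then obtain l' where l': "\<And>i. i < n \<Longrightarrow> l' i \<in> L" "\<And>i. i < n \<Longrightarrow> l i = res H (l' i)" by metis
      have "(\<lambda>x. \<Prod>i<n. l i x) = res H (\<lambda>x. \<Prod>i<n. l' i x)"
        using l'(2) assms by (auto simp: res_def fun_eq_iff)
      then show ?case using Sym_prod[of n l' L] l'(1) by blast
    qed
  qed
next
  have "res H a \<in> Sym n (res H ` L)" if "a \<in> Sym n L" for a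
    using that
  proof (induction rule: Sym_induct)
    case zero
    have "res H 0 = 0" by (simp add: res_def fun_eq_iff)
    then show ?case by (metis Sym_zero)
  next
    case (add a b)
    have "res H (a + b) = res H a + res H b" by (simp add: res_def fun_eq_iff)
    then show ?case using add by (simp only: Sym_add)
  next
    case (scale c a)
    have "res H (fscale c a) = fscale c (res H a)" by (simp add: res_def fun_eq_iff)
    then show ?case using scale by (simp only: Sym_fscale)
  next
    case (prod l)
    have "res H (\<lambda>x. \<Prod>i<n. l i x) = (\<lambda>x. \<Prod>i<n. res H (l i) x)"
      using assms by (auto simp: res_def fun_eq_iff)
    moreover have "(\<lambda>x. \<Prod>i<n. res H (l i) x) \<in> Sym n (res H ` L)"
      using prod by (intro Sym_prod) blast
    ultimately show ?case by metis
  qed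
  then show "res H ` Sym n L \<subseteq> Sym n (res H ` L)" by blast
qed

lemma fspan_singleton_eq:
  assumes "f \<noteq> 0" and "fspan {f} = fspan {g}"
  shows "\<exists>c. c \<noteq> 0 \<and> g = fscale c f"
proof -
  have "g \<in> fspan {f}" using assms(2) fs.span_base by blast
  then obtain c where c: "g = fscale c f" by (auto simp only: fs.span_singleton)
  have "f \<in> fspan {g}" using assms(2) fs.span_base by blast
  then obtain c' where "f = fscale c' g" by (auto simp only: fs.span_singleton)
  with c assms(1) have "c \<noteq> 0" by (metis fs.scale_zero_left fs.scale_zero_right)
  with c show ?thesis by blast
qed

lemma fspan_singleton_fscale:
  assumes "c \<noteq> 0"
  shows "fspan {fscale c f} = fspan {f}"
proof -
  have "fscale (1 / c) (fscale c f) = f" using assms by (simp add: fun_eq_iff)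
  then show ?thesis
    using fs.span_scale[OF fs.span_base[of "fscale c f" "{fscale c f}"], of "1 / c"]
    by (intro fs.span_eq[THEN iffD2]) (auto simp del: fscale_apply intro: fs.span_scale fs.span_base)
qed

context symplectic
begin

definition perp :: "'v \<Rightarrow> 'v set" where "perp v = {u. \<omega> v u = 0}"

definition ann :: "'v \<Rightarrow> ('v \<Rightarrow> complex) set" where "ann v = {l \<in> dual smul. l v = 0}"

lemma perp_smul: "c \<noteq> 0 \<Longrightarrow> perp (smul c v) = perp v"
  by (simp add: perp_def)

lemma proportional_if_kernel:
  assumes "v \<noteq> 0" and "perp v \<subseteq> perp v'"
  shows "\<exists>c. v' = smul c v"
proof -
  obtain u0 where u0: "\<omega> v u0 \<noteq> 0" using \<omega>_nondegenerate[OF assms(1)] by blast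
  define c where "c = \<omega> v' u0 / \<omega> v u0"
  have "\<omega> (v' - smul c v) u = 0" for u
  proof -
    have "u - smul (\<omega> v u / \<omega> v u0) u0 \<in> perp v" using u0 by (simp add: perp_def)
    then have "u - smul (\<omega> v u / \<omega> v u0) u0 \<in> perp v'" using assms(2) by blast
    then have "\<omega> v' (u - smul (\<omega> v u / \<omega> v u0) u0) = 0" by (simp only: perp_def mem_Collect_eq)
    then have "\<omega> v' u = \<omega> v u / \<omega> v u0 * \<omega> v' u0" by (simp only: \<omega>_diff \<omega>_right right_minus_eq)
    then show ?thesis by (simp add: c_def)
  qed
  then have "v' - smul c v = 0" using \<omega>_nondegenerate by blast
  then show ?thesis by auto
qed

lemma perp_hyperplane: "v \<noteq> 0 \<Longrightarrow> perp v \<in> hyperplanes smul"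
  using \<omega>_dual \<omega>_nondegenerate unfolding hyperplanes_def perp_def
  by (auto simp: fun_eq_iff intro!: exI[of _ "\<omega> v"])

lemma polar_point_perp:
  assumes "v \<noteq> 0"
  shows "polar_point smul \<omega> (perp v) = span {v}"
proof -
  let ?P = "{v'. \<exists>l\<in>dual smul. l \<noteq> 0 \<and> perp v = {u. l u = 0} \<and> (\<forall>u. l u = \<omega> v' u)}"
  have "\<omega> v \<noteq> 0" using \<omega>_nondegenerate[OF assms] by auto
  then have "v \<in> ?P"
    using \<omega>_dual[of v] by (auto simp: perp_def intro!: bexI[of _ "\<omega> v"])
  moreover have "?P \<subseteq> span {v}"
  proof
    fix v' assume "v' \<in> ?P"
    then have "perp v \<subseteq> perp v'" by (auto simp: perp_def)
    from proportional_if_kernel[OF assms this] show "v' \<in> span {v}"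
      by (auto intro: span_scale span_base)
  qed
  ultimately have "span ?P = span {v}"
    by (intro span_eq[THEN iffD2]) (auto intro: span_base)
  then show ?thesis by (simp add: polar_point_def)
qed

lemma G\<sigma>_fiber_perp:
  assumes "v \<noteq> 0"
  shows "G\<sigma>_fiber smul \<omega> (perp v) = res (perp v) ` ann v"
proof -
  have "res (perp v) l v' = 0" if "l \<in> ann v" "v' \<in> span {v}" for l v'
    using that by (auto simp: span_singleton ann_def dual_iff' res_def)
  moreover have "v \<in> span {v}" "v \<in> perp v" by (auto simp: perp_def intro: span_base)
  ultimately show ?thesis
    unfolding G\<sigma>_fiber_def polar_point_perp[OF assms] Q_fiber_def
    by (auto simp: ann_def res_def)
qed

lemma Sym_ann_invariant: "q \<in> Sym n (ann v) \<Longrightarrow> q (u + smul t v) = q u"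
  using Sym_homogeneous[of q n "ann v" "u + smul t v" 1 u] by (auto simp: ann_def dual_iff')

lemma Sym_ann_dual: "Sym n (ann v) \<subseteq> Sym n (dual smul)"
  by (rule Sym_mono) (auto simp: ann_def)

lemma cone_vertexI:
  assumes "q \<in> Sym n (ann v)" and "\<And>u. u \<in> perp v \<Longrightarrow> f u = c * q u"
  shows "cone_vertex f v"
  unfolding cone_vertex_def
  using assms Sym_ann_invariant[OF assms(1)] by (simp add: perp_def)

text \<open>For \<open>d = m\<close> the cofactor of the cone form has degree 0, so lying in the
  fiber means restricting to a constant multiple of \<open>q\<close>. The constant \<open>c\<close>
  may be 0.\<close>

lemma PF_pointsI:
  assumes "n > 0" "v \<noteq> 0" "q \<in> Sym n (ann v)" "res (perp v) q \<noteq> 0" "f \<in> Sym n (dual smul)" "f \<noteq> 0"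
    and fq: "\<And>u. u \<in> perp v \<Longrightarrow> f u = c * q u"
  shows "(perp v, fspan {res (perp v) q}, fspan {f}) \<in> PF_points smul \<omega> n n"
proof -
  have "res (perp v) q \<in> Sym n (G\<sigma>_fiber smul \<omega> (perp v))"
    unfolding G\<sigma>_fiber_perp[OF assms(2)] Sym_res[OF assms(1)] using assms(3) by blast
  then have "(perp v, fspan {res (perp v) q}) \<in> Y_points smul \<omega> n"
    using assms(4) perp_hyperplane[OF assms(2)] by (auto simp: Y_points_def proj_def)
  moreover have "f \<in> F_fiber smul n n (perp v, fspan {res (perp v) q})"
    unfolding F_fiber_def
  proof (simp only: prod.case mem_Collect_eq, intro conjI assms(5) bexI ballI)
    fix u assume "u \<in> perp v"
    then show "f u = res (perp v) q u * (\<lambda>_. c) u" by (simp add: fq res_def)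
  next
    show "(\<lambda>_. c) \<in> Sym (n - n) (Q_fiber smul (perp v))" by (auto simp: Sym_0)
    show "res (perp v) q \<in> fspan {res (perp v) q}" by (rule fs.span_base) simp
  qed
  ultimately show ?thesis
    using assms(6) by (auto simp: PF_points_def proj_def)
qed

lemma PF_pointsD:
  assumes pt: "(H, L, M) \<in> PF_points smul \<omega> n n" and "n > 0" and v: "v \<noteq> 0" "H = perp v"
  obtains q f c where "q \<in> Sym n (ann v)" "res H q \<noteq> 0" "L = fspan {res H q}"
    "f \<in> Sym n (dual smul)" "f \<noteq> 0" "M = fspan {f}" "\<And>u. u \<in> H \<Longrightarrow> f u = c * q u"
proof -
  obtain a f where a: "a \<in> Sym n (G\<sigma>_fiber smul \<omega> H)" "a \<noteq> 0" "L = fspan {a}"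
    and f: "f \<in> F_fiber smul n n (H, L)" "f \<noteq> 0" "M = fspan {f}"
    using pt by (auto simp: PF_points_def Y_points_def proj_def)
  from a(1) obtain q where q: "q \<in> Sym n (ann v)" "a = res H q"
    unfolding v(2) G\<sigma>_fiber_perp[OF v(1)] Sym_res[OF assms(2)] by blast
  from f(1) obtain t s where f': "f \<in> Sym n (dual smul)" and t: "t \<in> L"
    and s: "s \<in> Sym (n - n) (Q_fiber smul H)" and fts: "\<And>u. u \<in> H \<Longrightarrow> f u = t u * s u"
    by (auto simp: F_fiber_def)
  from t a(3) obtain c where "t = fscale c a" by (auto simp only: fs.span_singleton)
  moreover from s obtain c' where "s = (\<lambda>_. c')" by (auto simp: Sym_0)
  ultimately have "f u = (c * c') * q u" if "u \<in> H" for u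
    using fts[OF that] that q(2) by (simp add: res_def)
  then show ?thesis
    using that[OF q(1), of f "c * c'"] a q f f' by metis
qed

text \<open>Composition with the projection to the hyperplane gives the remainder of the division by its
  equation.\<close>

lemma divide_by_form:
  assumes a: "\<omega> v a = 1" and f: "f \<in> Sym n (dual smul)"
  shows "\<exists>g\<in>(if n = 0 then {0} else Sym (n - 1) (dual smul)).
    f - (f \<circ> (\<lambda>x. x - smul (\<omega> v x) a)) = \<omega> v * g"
proof -
  define P where "P x = x - smul (\<omega> v x) a" for x
  \<comment> \<open>Forms of degree \<open>n - 1\<close>. For \<open>n = 0\<close> the truncated
    subtraction would yield the constants, whereas there are no nonzero forms of degree -1.\<close>
  let ?S = "\<lambda>n. if n = 0 then {0} else Sym (n - 1) (dual smul)"
  have lP: "l \<circ> P \<in> dual smul" "l = (l \<circ> P) + fscale (l a) (\<omega> v)" if l: "l \<in> dual smul" for l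
  proof -
    have l_add: "l (x + y) = l x + l y" and l_sc: "l (smul c x) = c * l x" for x y c
      using l by (auto simp: dual_iff')
    have l_diff: "l (x - y) = l x - l y" for x y
      using l_add[of "x - y" y] by simp
    have lPx: "l (P x) = l x - \<omega> v x * l a" for x
      by (simp only: P_def l_diff l_sc)
    show "l \<circ> P \<in> dual smul"
      unfolding dual_iff' comp_def lPx by (simp add: l_add l_sc algebra_simps)
    show "l = (l \<circ> P) + fscale (l a) (\<omega> v)"
      by (simp add: fun_eq_iff lPx)
  qed
  have sub: "0 \<in> ?S n" "\<And>a b. a \<in> ?S n \<Longrightarrow> b \<in> ?S n \<Longrightarrow> a + b \<in> ?S n"
    "\<And>a c. a \<in> ?S n \<Longrightarrow> fscale c a \<in> ?S n" for n
  proof -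
    have sS: "fs.subspace (?S n)" by (cases "n = 0") (simp_all add: subspace_Sym)
    show "0 \<in> ?S n" by (rule fs.subspace_0[OF sS])
    show "a + b \<in> ?S n" if "a \<in> ?S n" "b \<in> ?S n" for a b by (rule fs.subspace_add[OF sS that])
    show "fscale c a \<in> ?S n" if "a \<in> ?S n" for a c by (rule fs.subspace_scale[OF sS that])
  qed
  have "\<exists>g\<in>?S n. f - (f \<circ> P) = \<omega> v * g" using f
  proof (induction rule: Sym_induct)
    case zero
    have "0 - (0 \<circ> P) = \<omega> v * 0" by (simp add: fun_eq_iff)
    then show ?case using sub by blast
  next
    case (add f1 f2)
    then obtain g1 g2 where "g1 \<in> ?S n" "g2 \<in> ?S n" "f1 - (f1 \<circ> P) = \<omega> v * g1" "f2 - (f2 \<circ> P) = \<omega> v * g2" by blast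
    moreover have "(f1 + f2) - ((f1 + f2) \<circ> P) = (f1 - (f1 \<circ> P)) + (f2 - (f2 \<circ> P))"
      by (simp add: fun_eq_iff)
    ultimately have "(f1 + f2) - ((f1 + f2) \<circ> P) = \<omega> v * (g1 + g2)" by (simp only: distrib_left)
    then show ?case using sub \<open>g1 \<in> ?S n\<close> \<open>g2 \<in> ?S n\<close> by blast
  next
    case (scale c f)
    then obtain g where "g \<in> ?S n" and g: "f - (f \<circ> P) = \<omega> v * g" by blast
    have "fscale c f - (fscale c f \<circ> P) = fscale c (f - (f \<circ> P))" by (simp add: fun_eq_iff algebra_simps)
    also have "\<dots> = \<omega> v * fscale c g" unfolding g by (simp add: fun_eq_iff)
    finally show ?case using sub \<open>g \<in> ?S n\<close> by blast
  next
    case (prod l)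
    then show ?case
    proof (induction n)
      case 0
      show ?case by (intro bexI[of _ 0]) (auto simp: fun_eq_iff)
    next
      case (Suc n)
      define A where "A = (\<lambda>x. \<Prod>i<n. l i x)"
      have A: "A \<in> Sym n (dual smul)" unfolding A_def using Suc.prems by (intro Sym_prod) simp
      have "\<exists>g\<in>?S n. A - (A \<circ> P) = \<omega> v * g"
        unfolding A_def by (rule Suc.IH, rule Suc.prems) simp
      then obtain g where g: "g \<in> ?S n" "A - (A \<circ> P) = \<omega> v * g" by blast
      have ln: "l n \<in> dual smul" using Suc.prems by simp
      have e1: "(\<lambda>x. \<Prod>i<Suc n. l i x) = A * l n" by (simp add: A_def fun_eq_iff)
      \<comment> \<open>A product rule for the operator sending \<open>f\<close> to
        \<open>f - (f \<circ> P)\<close>.\<close>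
      have e2: "A * l n - ((A * l n) \<circ> P) = A * (l n - (l n \<circ> P)) + (A - (A \<circ> P)) * (l n \<circ> P)"
        by (simp add: fun_eq_iff algebra_simps)
      have e3: "l n - (l n \<circ> P) = fscale (l n a) (\<omega> v)"
        using lP(2)[OF ln] by (metis add_diff_cancel_left')
      have eq: "(\<lambda>x. \<Prod>i<Suc n. l i x) - ((\<lambda>x. \<Prod>i<Suc n. l i x) \<circ> P) =
          \<omega> v * (fscale (l n a) A + g * (l n \<circ> P))"
        unfolding e1 e2 e3 g(2) by (simp add: fun_eq_iff algebra_simps)
      have "g * (l n \<circ> P) \<in> Sym n (dual smul)"
      proof (cases n)
        case 0
        then have "g * (l n \<circ> P) = 0" using g(1) by (simp add: fun_eq_iff)
        then show ?thesis by (metis Sym_zero)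
      next
        case (Suc n')
        then have "(l n \<circ> P) * g \<in> Sym n (dual smul)"
          using Sym_mult_left[OF lP(1)[OF ln], of g n'] g(1) by simp
        then show ?thesis by (simp only: mult.commute)
      qed
      then have mem: "fscale (l n a) A + g * (l n \<circ> P) \<in> ?S (Suc n)"
        using Sym_add[OF Sym_fscale[OF A]] by simp
      show ?case
        using eq by (intro bexI[of _ "fscale (l n a) A + g * (l n \<circ> P)"] mem)
    qed
  qed
  then show ?thesis by (simp only: P_def[abs_def])
qed

lemma form_vanishing_on_perp:
  assumes "v \<noteq> 0" and f: "f \<in> Sym n (dual smul)" "n > 0" and 0: "\<And>u. u \<in> perp v \<Longrightarrow> f u = 0"
  shows "\<exists>g\<in>Sym (n - 1) (dual smul). f = \<omega> v * g"
proof -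
  obtain a' where a': "\<omega> v a' \<noteq> 0" using \<omega>_nondegenerate[OF assms(1)] by blast
  define a where "a = smul (1 / \<omega> v a') a'"
  have a: "\<omega> v a = 1" using a' by (simp add: a_def)
  have "x - smul (\<omega> v x) a \<in> perp v" for x
    using a by (simp add: perp_def)
  then have "f \<circ> (\<lambda>x. x - smul (\<omega> v x) a) = 0"
    using 0 by (simp add: fun_eq_iff)
  with divide_by_form[OF a f(1)] f(2) show ?thesis by simp
qed


end

section \<open>The witness as a cone, and the generic conditions\<close>

context darboux
begin

lemma dual_representation:
  assumes "l \<in> dual smul"
  shows "\<exists>v. l = \<omega> v"
proof
  show "l = \<omega> (vec (\<lambda>i. l (F i)) (\<lambda>i. - l (E i)))"
  proof
    fix w
    have "l w = (\<Sum>i<k. l (E i) * p i w + l (F i) * q i w)"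
      using arg_cong[OF dual_expand[OF assms], of "\<lambda>h. h w"] by (simp add: sum_fun_apply)
    also have "\<dots> = \<omega> (vec (\<lambda>i. l (F i)) (\<lambda>i. - l (E i))) w"
      by (subst \<omega>_pq, intro sum.cong refl) (simp add: p_vec q_vec)
    finally show "l w = \<omega> (vec (\<lambda>i. l (F i)) (\<lambda>i. - l (E i))) w" .
  qed
qed

lemma hyperplane_perp:
  assumes "H \<in> hyperplanes smul"
  shows "\<exists>v. v \<noteq> 0 \<and> H = perp v"
proof -
  obtain l where l: "l \<in> dual smul" "l \<noteq> 0" "H = {u. l u = 0}"
    using assms by (auto simp: hyperplanes_def)
  obtain v where v: "l = \<omega> v" using dual_representation[OF l(1)] by blast
  have "v \<noteq> 0" using l(2) v by (auto simp: fun_eq_iff)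
  then show ?thesis using l v by (auto simp: perp_def)
qed

text \<open>The cone form of the witness: it is built from linear forms vanishing at
  \<open>E 0\<close> and agrees with \<open>f0\<close> on the hyperplane
  \<open>y = 0\<close>.\<close>

definition q0 :: "'v \<Rightarrow> complex" where "q0 = (\<Sum>i\<in>I. Q i ^ m + p i ^ m)"

lemma q0_Sym: "q0 \<in> Sym m (ann (E 0))"
proof -
  have "Q i \<in> ann (E 0)" "p i \<in> ann (E 0)" if "i \<in> I" for i
    using that Q_dual p_dual E0_values k by (auto simp: ann_def Q_def)
  then show ?thesis
    unfolding q0_def by (intro Sym_sum Sym_add Sym_power_form)
qed

lemma f0_eq: "f0 = q0 + \<omega> (E 0) * p 0 ^ (m - 1)"
  by (simp add: f0_def q0_def q_def[abs_def])

lemma E0_nonzero: "E 0 \<noteq> 0"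
proof
  assume "E 0 = 0"
  then have "p 0 (E 0) = 0" by (simp add: p_def)
  then show False by (simp add: E0_values)
qed

lemma f0_vertex: "cone_vertex f0 (E 0)"
  by (rule cone_vertexI[OF q0_Sym, of _ 1]) (simp add: f0_eq perp_def)

lemma f0_E1: "f0 (E 1) = 1" "\<omega> (E 0) (E 1) = 0" "\<omega> (E 0) (F 0) = 1"
proof -
  have 01: "0 < k" "1 < k" using k by auto
  have E1: "q i (E 1) = 0" "p i (E 1) = (if i = 1 then 1 else 0)" if "i < k" for i
    using EF 01 that by (auto simp: darboux_system_def q_def p_def)
  have "q0 (E 1) = (\<Sum>i\<in>I. if i = 1 then 1 else 0)"
    unfolding q0_def sum_fun_apply
    using E1 01 m by (intro sum.cong refl) (auto simp: Q_def power_0_left)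
  also have "\<dots> = 1" using 01 by simp
  finally show "f0 (E 1) = 1"
    using E1(1)[OF 01(1)] by (simp add: f0_eq q_def)
  show "\<omega> (E 0) (E 1) = 0" "\<omega> (E 0) (F 0) = 1"
    using EF 01 by (auto simp: darboux_system_def)
qed

text \<open>To \<open>\<Delta>\<close> a factor is added whose value at \<open>f\<close> is that of
  \<open>f\<close> at a vector \<open>\<theta> f\<close> of the hyperplane \<open>perp (v f)\<close>
  depending polynomially on \<open>f\<close>. Where it is nonzero, \<open>f\<close> does not vanish
  on that hyperplane.\<close>

theorem ex_generic:
  obtains e \<delta> d v where "\<delta> \<in> Sym e (dual fscale)" "\<delta> f0 \<noteq> 0"
    "\<And>l. l \<in> dual smul \<Longrightarrow> (\<lambda>f. l (v f)) \<in> Sym d (dual fscale)"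
    "\<And>f w. f \<in> Sym m (dual smul) \<Longrightarrow> \<delta> f \<noteq> 0 \<Longrightarrow> cone_vertex f w \<Longrightarrow> w \<noteq> 0 \<Longrightarrow>
       \<exists>c. c \<noteq> 0 \<and> w = smul c (v f)"
    "\<And>f. f \<in> Sym m (dual smul) \<Longrightarrow> \<delta> f \<noteq> 0 \<Longrightarrow> \<exists>u\<in>perp (v f). f u \<noteq> 0"
proof -
  obtain d \<Delta> v where \<Delta>: "\<Delta> \<in> Sym d (dual fscale)" "\<Delta> f0 \<noteq> 0"
    and v: "\<And>l. l \<in> dual smul \<Longrightarrow> (\<lambda>f. l (v f)) \<in> Sym d (dual fscale)"
    and main: "\<And>f w. f \<in> Sym m (dual smul) \<Longrightarrow> \<Delta> f \<noteq> 0 \<Longrightarrow> cone_vertex f w \<Longrightarrow> w \<noteq> 0 \<Longrightarrow>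
       \<exists>c. c \<noteq> 0 \<and> w = smul c (v f)"
    by (rule ex_generic_vertex) (rule that; assumption)
  \<comment> \<open>This combination of \<open>E 1\<close> and \<open>F 0\<close> is orthogonal to
    \<open>v f\<close> for every \<open>f\<close>. As \<open>v f0\<close> is proportional to
    \<open>E 0\<close>, it becomes a multiple of \<open>E 1\<close> at the witness, and
    \<open>f0 (E 1) = 1\<close>.\<close>
  define \<theta> where "\<theta> f = smul (\<omega> (v f) (F 0)) (E 1) + smul (- \<omega> (v f) (E 1)) (F 0)" for f
  have \<theta>_perp: "\<theta> f \<in> perp (v f)" for f by (simp add: perp_def \<theta>_def)
  have \<theta>: "l \<circ> \<theta> \<in> Sym d (dual fscale)" if l: "l \<in> dual smul" for l
  proof -
    have "l \<circ> \<theta> = fscale (l (E 1)) (\<lambda>f. \<omega> (v f) (F 0)) + fscale (- l (F 0)) (\<lambda>f. \<omega> (v f) (E 1))"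
      using l by (simp add: \<theta>_def fun_eq_iff dual_iff' mult.commute del: scale_minus_left)
    then show ?thesis
      by (simp only: Sym_add Sym_fscale v[OF \<omega>_dual_left])
  qed
  obtain C where C: "Sym m (dual smul) \<subseteq> fspan C" "finite C" using Sym_finite_dim by blast
  obtain S \<phi> where S: "finite S" "S \<subseteq> Sym m (dual smul)" "\<And>b. \<phi> b \<in> dual fscale"
    and \<phi>: "\<And>g. g \<in> Sym m (dual smul) \<Longrightarrow> g = (\<Sum>b\<in>S. fscale (\<phi> b g) b)"
    by (rule ex_dual_basis[OF subspace_Sym C]) (rule that; assumption)
  \<comment> \<open>\<open>f (\<theta> f)\<close> depends on \<open>f\<close> in two places.
    Expanding the outer \<open>f\<close> in a basis with linear coordinates \<open>\<phi> b\<close>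
    shows that it is a form in \<open>f\<close>, of degree \<open>1 + m * d\<close>.\<close>
  define r where "r = (\<Sum>b\<in>S. \<phi> b * (b \<circ> \<theta>))"
  have r: "r \<in> Sym (1 + m * d) (dual fscale)"
    unfolding r_def
  proof (intro Sym_sum Sym_mult Sym_1 S)
    fix b assume "b \<in> S"
    then show "b \<circ> \<theta> \<in> Sym (m * d) (dual fscale)"
      using S(2) by (intro Sym_comp[OF _ \<theta>]) auto
  qed
  have r_eq: "r f = f (\<theta> f)" if f: "f \<in> Sym m (dual smul)" for f
    using arg_cong[OF \<phi>[OF f], of "\<lambda>h. h (\<theta> f)"] by (simp add: r_def sum_fun_apply)
  have "r f0 \<noteq> 0"
  proof -
    obtain c where c: "c \<noteq> 0" "E 0 = smul c (v f0)"
      using main[OF f0_Sym \<Delta>(2) f0_vertex E0_nonzero] by blast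
    then have "\<omega> (v f0) u = \<omega> (E 0) u / c" for u by simp
    then have "\<theta> f0 = smul (1 / c) (E 1)" by (simp add: \<theta>_def f0_E1 del: One_nat_def)
    moreover have "f0 (smul (1 / c) (E 1)) = (1 / c) ^ m * f0 (E 1)"
      by (rule Sym_homogeneous[OF f0_Sym]) (rule form_smul)
    ultimately have "r f0 = (1 / c) ^ m * f0 (E 1)"
      using r_eq[OF f0_Sym] by simp
    then show ?thesis using c by (simp add: f0_E1 del: One_nat_def)
  qed
  show ?thesis
  proof (rule that[of "\<Delta> * r" _ v d])
    show "\<Delta> * r \<in> Sym (d + (1 + m * d)) (dual fscale)" by (rule Sym_mult[OF \<Delta>(1) r])
    show "(\<Delta> * r) f0 \<noteq> 0" using \<Delta>(2) \<open>r f0 \<noteq> 0\<close> by simp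
    show "\<exists>c. c \<noteq> 0 \<and> w = smul c (v f)"
      if "f \<in> Sym m (dual smul)" "(\<Delta> * r) f \<noteq> 0" "cone_vertex f w" "w \<noteq> 0" for f w
      using main that by simp
    show "\<exists>u\<in>perp (v f). f u \<noteq> 0" if "f \<in> Sym m (dual smul)" "(\<Delta> * r) f \<noteq> 0" for f
      using that r_eq \<theta>_perp by auto
  qed (fact v)
qed

end

section \<open>Polynomial curves\<close>

text \<open>Polynomial dependence on the parameter without a choice of coordinates: the coefficients
  of \<open>P\<close> are functions, and the parameter enters as a constant function.\<close>

definition poly_curve :: "(complex \<Rightarrow> 'a \<Rightarrow> complex) \<Rightarrow> bool" where
  "poly_curve \<gamma> \<longleftrightarrow> (\<exists>P. \<forall>t. \<gamma> t = poly P (\<lambda>_. t))"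

lemma poly_curve_const: "poly_curve (\<lambda>_. f)"
  unfolding poly_curve_def by (intro exI[of _ "[:f:]"]) simp

lemma poly_curve_param: "poly_curve (\<lambda>t _. t)"
  unfolding poly_curve_def by (intro exI[of _ "[:0, 1:]"]) (simp add: fun_eq_iff)

lemma poly_curve_add: "poly_curve \<gamma> \<Longrightarrow> poly_curve \<gamma>' \<Longrightarrow> poly_curve (\<lambda>t. \<gamma> t + \<gamma>' t)"
  unfolding poly_curve_def by (metis poly_add)

lemma poly_curve_diff: "poly_curve \<gamma> \<Longrightarrow> poly_curve \<gamma>' \<Longrightarrow> poly_curve (\<lambda>t. \<gamma> t - \<gamma>' t)"
  unfolding poly_curve_def by (metis poly_diff)

lemma poly_curve_mult: "poly_curve \<gamma> \<Longrightarrow> poly_curve \<gamma>' \<Longrightarrow> poly_curve (\<lambda>t. \<gamma> t * \<gamma>' t)"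
  unfolding poly_curve_def by (metis poly_mult)

lemma poly_curve_affine: "poly_curve (\<lambda>t. fscale ((1 - t) * a + t * b) f)"
proof -
  have "poly_curve (\<lambda>t. (((\<lambda>_. 1) - (\<lambda>_. t)) * (\<lambda>_. a) + (\<lambda>_. t) * (\<lambda>_. b)) * f)"
    by (intro poly_curve_mult poly_curve_add poly_curve_diff poly_curve_const poly_curve_param)
  also have "(\<lambda>t. (((\<lambda>_. 1) - (\<lambda>_. t)) * (\<lambda>_. a) + (\<lambda>_. t) * (\<lambda>_. b)) * f) =
      (\<lambda>t. fscale ((1 - t) * a + t * b) f)"
    by (simp add: fun_eq_iff)
  finally show ?thesis .
qed

lemma poly_curve_prod: "(\<And>i. i < (n::nat) \<Longrightarrow> poly_curve (\<gamma> i)) \<Longrightarrow> poly_curve (\<lambda>t. \<Prod>i<n. \<gamma> i t)"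
proof (induction n)
  case 0
  show ?case using poly_curve_const[of 1] by (simp only: lessThan_0 prod.empty)
next
  case (Suc n)
  then have "poly_curve (\<lambda>t. (\<Prod>i<n. \<gamma> i t) * \<gamma> n t)"
    by (intro poly_curve_mult) auto
  then show ?case by (simp only: prod.lessThan_Suc)
qed

lemma poly_curve_Sym:
  assumes "q \<in> Sym n L" and "\<And>l. l \<in> L \<Longrightarrow> poly_curve (\<lambda>t. l \<circ> \<phi> t)"
  shows "poly_curve (\<lambda>t. q \<circ> \<phi> t)"
  using assms(1)
proof (induction rule: Sym_induct)
  case zero
  have eq: "(\<lambda>t. 0 \<circ> \<phi> t) = (\<lambda>_. 0)" by (simp add: fun_eq_iff)
  show ?case unfolding eq by (rule poly_curve_const)
next
  case (add f g)
  have eq: "(\<lambda>t. (f + g) \<circ> \<phi> t) = (\<lambda>t. (f \<circ> \<phi> t) + (g \<circ> \<phi> t))" by (simp add: fun_eq_iff)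
  show ?case unfolding eq by (rule poly_curve_add[OF add])
next
  case (scale c f)
  have eq: "(\<lambda>t. fscale c f \<circ> \<phi> t) = (\<lambda>t. (\<lambda>_. c) * (f \<circ> \<phi> t))" by (simp add: fun_eq_iff)
  show ?case unfolding eq by (rule poly_curve_mult[OF poly_curve_const scale])
next
  case (prod l)
  have eq: "(\<lambda>t. (\<lambda>x. \<Prod>i<n. l i x) \<circ> \<phi> t) = (\<lambda>t. \<Prod>i<n. l i \<circ> \<phi> t)"
    by (simp add: fun_eq_iff prod_fun_apply)
  show ?case
    unfolding eq using prod assms(2) by (intro poly_curve_prod) blast
qed

lemma dual_along_curve:
  assumes l: "l \<in> dual fscale" and "poly_curve \<gamma>"
  shows "\<exists>r. \<forall>t. l (\<gamma> t) = poly r t"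
proof -
  obtain P where P: "\<And>t. \<gamma> t = poly P (\<lambda>_. t)" using assms(2) by (auto simp: poly_curve_def)
  have add: "l (f + g) = l f + l g" and sc: "l (fscale c f) = c * l f" for f g c
    using l by (auto simp: dual_iff[OF vector_space_fscale])
  have "\<exists>r. \<forall>t. l (poly P (\<lambda>_. t)) = poly r t"
  proof (induction P)
    case 0
    have "l 0 = 0" using sc[of 0 0] by (metis fs.scale_zero_right mult_zero_left)
    then show ?case by (intro exI[of _ 0]) (simp only: poly_0 simp_thms)
  next
    case (pCons a P)
    have "\<exists>r. \<forall>t. l ((\<lambda>_. t) * poly P (\<lambda>_. t)) = poly r t"
    proof -
      from pCons obtain r where r: "\<And>t. l (poly P (\<lambda>_. t)) = poly r t" by blast
      have "l ((\<lambda>_. t) * poly P (\<lambda>_. t)) = poly (pCons 0 r) t" for t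
      proof -
        have "(\<lambda>_. t) * poly P (\<lambda>_. t) = fscale t (poly P (\<lambda>_. t))" by (simp add: fun_eq_iff)
        then show ?thesis by (simp only: sc r) simp
      qed
      then show ?thesis by blast
    qed
    then obtain r where "\<And>t. l ((\<lambda>_. t) * poly P (\<lambda>_. t)) = poly r t" by blast
    then have "l (poly (pCons a P) (\<lambda>_. t)) = poly ([:l a:] + r) t" for t
      by (simp only: poly_pCons add) simp
    then show ?case by blast
  qed
  then show ?thesis by (simp add: P)
qed

lemma polyfun_along_curve:
  assumes "p \<in> polyfun s" and lin: "\<And>l. l \<in> dual s \<Longrightarrow> \<exists>r. \<forall>t. l (\<Phi> t) = poly r (t::complex)"
  shows "\<exists>r. \<forall>t. p (\<Phi> t) = poly r t"
  using assms(1)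
proof (induction rule: polyfun_induct)
  case zero
  show ?case by (intro exI[of _ 0]) simp
next
  case (add p q)
  then obtain r r' where "\<forall>t. p (\<Phi> t) = poly r t" "\<forall>t. q (\<Phi> t) = poly r' t" by blast
  then show ?case by (intro exI[of _ "r + r'"]) simp
next
  case (scale c p)
  then obtain r where "\<forall>t. p (\<Phi> t) = poly r t" by blast
  then show ?case by (intro exI[of _ "smult c r"]) simp
next
  case (Sym p n)
  then show ?case
  proof (induction rule: Sym_induct)
    case zero
    show ?case by (intro exI[of _ 0]) simp
  next
    case (add p q)
    then obtain r r' where "\<forall>t. p (\<Phi> t) = poly r t" "\<forall>t. q (\<Phi> t) = poly r' t" by blast
    then show ?case by (intro exI[of _ "r + r'"]) simp
  next
    case (scale c p)
    then obtain r where "\<forall>t. p (\<Phi> t) = poly r t" by blast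
    then show ?case by (intro exI[of _ "smult c r"]) simp
  next
    case (prod l)
    then have "\<forall>i. \<exists>r. i < n \<longrightarrow> (\<forall>t. l i (\<Phi> t) = poly r t)" using lin by blast
    then obtain r where "\<And>i t. i < n \<Longrightarrow> l i (\<Phi> t) = poly (r i) t" by metis
    then show ?case by (intro exI[of _ "\<Prod>i<n. r i"]) (simp add: poly_prod)
  qed
qed

text \<open>A linear form on triples is the sum of its restrictions to the three factors.\<close>

lemma dual_tscale_along_curve:
  assumes l: "l \<in> dual tscale" and \<gamma>: "poly_curve \<gamma>1" "poly_curve \<gamma>2" "poly_curve \<gamma>3"
  shows "\<exists>r. \<forall>t. l (\<gamma>1 t, \<gamma>2 t, \<gamma>3 t) = poly r t"
proof -
  have add: "l (a + b) = l a + l b" and sc: "l (tscale c a) = c * l a" for a b c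
    using l unfolding dual_iff[OF vector_space_tscale] by blast+
  have parts: "(\<lambda>f. l (f, 0, 0)) \<in> dual fscale" "(\<lambda>f. l (0, f, 0)) \<in> dual fscale"
    "(\<lambda>f. l (0, 0, f)) \<in> dual fscale"
    unfolding dual_iff[OF vector_space_fscale]
    using add[of "(_, 0, 0)" "(_, 0, 0)"] sc[of _ "(_, 0, 0)"]
      add[of "(0, _, 0)" "(0, _, 0)"] sc[of _ "(0, _, 0)"]
      add[of "(0, 0, _)" "(0, 0, _)"] sc[of _ "(0, 0, _)"]
    by (simp_all add: tscale_def del: fscale_apply)
  obtain r1 r2 r3 where r: "\<And>t. l (\<gamma>1 t, 0, 0) = poly r1 t" "\<And>t. l (0, \<gamma>2 t, 0) = poly r2 t"
    "\<And>t. l (0, 0, \<gamma>3 t) = poly r3 t"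
    using dual_along_curve[OF parts(1) \<gamma>(1)] dual_along_curve[OF parts(2) \<gamma>(2)]
      dual_along_curve[OF parts(3) \<gamma>(3)] by blast
  have "l (a, b, c) = l (a, 0, 0) + l (0, b, 0) + l (0, 0, c)" for a b c
    using add[of "(a, 0, 0) + (0, b, 0)" "(0, 0, c)"] add[of "(a, 0, 0)" "(0, b, 0)"] by simp
  then have "l (\<gamma>1 t, \<gamma>2 t, \<gamma>3 t) = poly (r1 + r2 + r3) t" for t
    unfolding poly_add r[symmetric] .
  then show ?thesis by blast
qed

lemma common_nonroot:
  fixes r1 r2 :: "complex poly"
  assumes "poly r1 a \<noteq> 0" and "poly r2 b \<noteq> 0"
  shows "\<exists>t. poly r1 t \<noteq> 0 \<and> poly r2 t \<noteq> 0"
proof -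
  have "r1 * r2 \<noteq> 0" using assms by auto
  then have "finite {t. poly (r1 * r2) t = 0}" by (rule poly_roots_finite)
  then have "{t. poly (r1 * r2) t = 0} \<noteq> UNIV"
    using infinite_UNIV_char_0[where 'a = complex] by metis
  then obtain t where "poly (r1 * r2) t \<noteq> 0" by blast
  then show ?thesis by auto
qed

lemma open_subspace_topspace: "topspace (zar X) = S \<Longrightarrow> open_subspace X S = X"
  by (auto simp: open_subspace_def)

section \<open>Density of the general points\<close>

context darboux
begin

text \<open>\<open>p 0\<close> serves unless it vanishes at \<open>w\<close>. In that case a form
  that is nonzero at \<open>w\<close> is scaled to the value 1 at \<open>E 0\<close>, or is added to
  \<open>p 0\<close> if it vanishes there.\<close>

lemma ex_separating_form:
  assumes "w \<noteq> 0"
  shows "\<exists>u0\<in>dual smul. u0 (E 0) = 1 \<and> u0 w \<noteq> 0"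
proof (cases "p 0 w = 0")
  case False
  then show ?thesis using p_dual E0_values by blast
next
  case True
  obtain a where a: "\<omega> w a \<noteq> 0" using \<omega>_nondegenerate[OF assms] by blast
  define l where "l x = \<omega> x a" for x
  have l: "l \<in> dual smul" unfolding l_def[abs_def] by (rule \<omega>_dual_left)
  show ?thesis
  proof (cases "l (E 0) = 0")
    case 0: True
    show ?thesis
      using a 0 True E0_values fs.subspace_add[OF subspace_dual' p_dual l]
      by (intro bexI[of _ "p 0 + l"]) (simp_all add: l_def)
  next
    case False
    then show ?thesis
      using a fs.subspace_scale[OF subspace_dual' l, of "1 / l (E 0)"]
      by (intro bexI[of _ "fscale (1 / l (E 0)) l"]) (simp_all add: l_def)
  qed
qed

text \<open>Every point of the incidence lies on a rational curve through a given general point.\<close>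

lemma PF_dense:
  assumes \<delta>: "\<delta> \<in> Sym e (dual fscale)" "\<delta> f0 \<noteq> 0"
    and v: "\<And>f w. f \<in> Sym m (dual smul) \<Longrightarrow> \<delta> f \<noteq> 0 \<Longrightarrow> cone_vertex f w \<Longrightarrow> w \<noteq> 0 \<Longrightarrow>
       \<exists>c. c \<noteq> 0 \<and> w = smul c (v f)"
    and nz: "\<And>f. f \<in> Sym m (dual smul) \<Longrightarrow> \<delta> f \<noteq> 0 \<Longrightarrow> \<exists>u\<in>perp (v f). f u \<noteq> 0"
    and A: "openin (zar (PF smul \<omega> m m)) A" and ptA: "pt \<in> A"
  shows "\<exists>pt'\<in>A. \<exists>f\<in>Sym m (dual smul). \<delta> f \<noteq> 0 \<and> rho pt' = fspan {f}"
proof -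
  let ?X = "PF_points smul \<omega> m m"
  let ?W = "dual smul \<times> Sym m (dual smul) \<times> Sym m (dual smul)"
  have A': "A \<subseteq> ?X" "openin (subtopology (zariski tscale) (?W \<inter> PF_coord -` ?X)) (?W \<inter> PF_coord -` A)"
    using A by (auto simp: PF_def openin_coordinate_space)
  obtain H L M where pt: "pt = (H, L, M)" by (metis prod_cases3)
  have ptX: "(H, L, M) \<in> ?X" using pt ptA A' by blast
  then have "H \<in> hyperplanes smul" by (simp add: PF_points_def Y_points_def)
  then obtain v' where v': "v' \<noteq> 0" "H = perp v'" using hyperplane_perp by blast
  \<comment> \<open>After scaling the vertex, the segment \<open>vt\<close> from it to
    \<open>E 0\<close> lies in the affine hyperplane \<open>u0 = 1\<close>. Hence it avoids 0, and
    \<open>pr t\<close> is the projection along \<open>vt t\<close> onto the kernel of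
    \<open>u0\<close>.\<close>
  obtain u0 where u0: "u0 \<in> dual smul" "u0 (E 0) = 1" "u0 v' \<noteq> 0"
    using ex_separating_form[OF v'(1)] by blast
  define v0 where "v0 = smul (1 / u0 v') v'"
  have v0: "v0 \<noteq> 0" "H = perp v0" "u0 v0 = 1"
    using v' u0 perp_smul[of "1 / u0 v'" v'] form_smul[OF u0(1)] by (auto simp: v0_def)
  have m0: "m > 0" using m by simp
  obtain q1 f1 c where q1: "q1 \<in> Sym m (ann v0)" "res H q1 \<noteq> 0" "L = fspan {res H q1}"
    and f1: "f1 \<in> Sym m (dual smul)" "f1 \<noteq> 0" "M = fspan {f1}" and fq: "\<And>u. u \<in> H \<Longrightarrow> f1 u = c * q1 u"
    by (rule PF_pointsD[OF ptX m0 v0(1,2)]) (rule that; assumption)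
  have "f1 - fscale c q1 \<in> Sym m (dual smul)"
    using f1(1) q1(1) Sym_ann_dual by (intro Sym_diff Sym_fscale) auto
  then have "\<exists>g\<in>Sym (m - 1) (dual smul). f1 - fscale c q1 = \<omega> v0 * g"
    by (rule form_vanishing_on_perp[OF v0(1) _ m0]) (simp add: fq v0(2)[symmetric])
  then obtain g where g: "g \<in> Sym (m - 1) (dual smul)" "f1 - fscale c q1 = \<omega> v0 * g" by blast
  define vt where "vt t = smul (1 - t) v0 + smul t (E 0)" for t
  define pr where "pr t x = x - smul (u0 x) (vt t)" for t x
  \<comment> \<open>Composition with \<open>pr t\<close> turns every form into one in the linear
    forms vanishing at \<open>vt t\<close>, so \<open>qt t\<close> is a cone form for the moving
    vertex. The coefficients are written as \<open>(1 - t) * a + t * b\<close> to match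
    \<open>poly_curve_affine\<close>.\<close>
  define qt where "qt t = fscale ((1 - t) * 1 + t * 0) (q1 \<circ> pr t) + fscale ((1 - t) * 0 + t * 1) (q0 \<circ> pr t)" for t
  define gt where "gt t = fscale ((1 - t) * 1 + t * 0) g + fscale ((1 - t) * 0 + t * 1) (p 0 ^ (m - 1))" for t
  \<comment> \<open>This interpolates between the decompositions
    \<open>f1 = fscale c q1 + \<omega> v0 * g\<close> at \<open>t = 0\<close> and
    \<open>f0 = q0 + \<omega> (E 0) * p 0 ^ (m - 1)\<close> at \<open>t = 1\<close>.\<close>
  define ft where "ft t = fscale ((1 - t) * c + t * 1) (qt t) + \<omega> (vt t) * gt t" for t
  have l_vt: "l (vt t) = (1 - t) * l v0 + t * l (E 0)" if "l \<in> dual smul" for l t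
    by (simp add: vt_def form_add[OF that] form_smul[OF that])
  have u0_vt: "u0 (vt t) = 1" for t by (simp add: l_vt[OF u0(1)] u0 v0)
  have vt_nz: "vt t \<noteq> 0" for t
  proof
    assume "vt t = 0"
    then have "u0 (vt t) = 0" using form_smul[OF u0(1), of 0 0] by simp
    then show False by (simp add: u0_vt)
  qed
  have l_pr: "l \<circ> pr t = l - fscale ((1 - t) * l v0 + t * l (E 0)) u0" if "l \<in> dual smul" for l t
  proof
    fix x
    have "l x = l (pr t x + smul (u0 x) (vt t))" by (simp add: pr_def)
    also have "\<dots> = l (pr t x) + u0 x * l (vt t)" by (simp only: form_add[OF that] form_smul[OF that])
    finally show "(l \<circ> pr t) x = (l - fscale ((1 - t) * l v0 + t * l (E 0)) u0) x"
      by (simp add: l_vt[OF that] algebra_simps)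
  qed
  have ann_pr: "l \<circ> pr t \<in> ann (vt t)" if "l \<in> dual smul" for l t
  proof -
    have "l \<circ> pr t \<in> dual smul"
      unfolding l_pr[OF that]
      by (intro fs.subspace_diff[OF subspace_dual' that] fs.subspace_scale[OF subspace_dual' u0(1)])
    moreover have "(l \<circ> pr t) (vt t) = 0"
      unfolding l_pr[OF that] by (simp add: u0_vt l_vt[OF that])
    ultimately show ?thesis by (simp add: ann_def)
  qed
  have q_pr: "q \<circ> pr t \<in> Sym m (ann (vt t))" if "q \<in> Sym m (ann w)" for q w t
    by (rule Sym_comp_linear[OF that]) (auto simp: ann_def intro: ann_pr[unfolded ann_def mem_Collect_eq, THEN conjunct1]
        ann_pr[unfolded ann_def mem_Collect_eq comp_def, THEN conjunct2])
  have qt_ann: "qt t \<in> Sym m (ann (vt t))" for t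
    unfolding qt_def by (intro Sym_add Sym_fscale q_pr[OF q1(1)] q_pr[OF q0_Sym])
  have gt: "gt t \<in> Sym (m - 1) (dual smul)" for t
    unfolding gt_def by (intro Sym_add Sym_fscale g Sym_power_form p_dual)
  have ft: "ft t \<in> Sym m (dual smul)" for t
  proof -
    have "\<omega> (vt t) * gt t \<in> Sym (Suc (m - 1)) (dual smul)"
      by (rule Sym_mult_left[OF \<omega>_dual gt])
    moreover have "qt t \<in> Sym m (dual smul)" using qt_ann Sym_ann_dual by blast
    ultimately show ?thesis unfolding ft_def using m0 by (simp add: Sym_add Sym_fscale del: fscale_apply)
  qed
  have ft_qt: "ft t u = ((1 - t) * c + t) * qt t u" if "u \<in> perp (vt t)" for t u
    using that by (simp add: ft_def perp_def)
  have vt01: "vt 0 = v0" "vt 1 = E 0" by (simp_all add: vt_def)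
  have "q1 (pr 0 x) = q1 x" for x
    using Sym_ann_invariant[OF q1(1), of x "- u0 x"] by (simp add: pr_def vt01)
  then have qt0: "qt 0 = q1" by (simp add: qt_def fun_eq_iff)
  have "q0 (pr 1 x) = q0 x" for x
    using Sym_ann_invariant[OF q0_Sym, of x "- u0 x"] by (simp add: pr_def vt01)
  then have qt1: "qt 1 = q0" by (simp add: qt_def fun_eq_iff)
  have ft0: "ft 0 = f1"
  proof -
    have "ft 0 = fscale c q1 + \<omega> v0 * g" by (simp add: ft_def qt0 vt01 gt_def fun_eq_iff)
    then show ?thesis unfolding g(2)[symmetric] by simp
  qed
  have ft1: "ft 1 = f0"
    by (simp add: ft_def qt1 vt01 gt_def f0_eq fun_eq_iff)
  have curve_l: "poly_curve (\<lambda>t. l \<circ> pr t)" if "l \<in> dual smul" for l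
    unfolding l_pr[OF that] by (intro poly_curve_diff poly_curve_const poly_curve_affine)
  have curve_\<omega>: "poly_curve (\<lambda>t. \<omega> (vt t))"
  proof -
    have eq: "(\<lambda>t. \<omega> (vt t)) = (\<lambda>t. fscale ((1 - t) * 1 + t * 0) (\<omega> v0) + fscale ((1 - t) * 0 + t * 1) (\<omega> (E 0)))"
      by (simp add: vt_def fun_eq_iff)
    show ?thesis unfolding eq by (intro poly_curve_add poly_curve_affine)
  qed
  have scaled: "poly_curve (\<lambda>t. fscale ((1 - t) * a + t * b) (\<gamma> t))" if "poly_curve \<gamma>" for a b \<gamma>
  proof -
    have eq: "(\<lambda>t. fscale ((1 - t) * a + t * b) (\<gamma> t)) = (\<lambda>t. fscale ((1 - t) * a + t * b) 1 * \<gamma> t)"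
      by (simp add: fun_eq_iff)
    show ?thesis unfolding eq by (rule poly_curve_mult[OF poly_curve_affine that])
  qed
  have curve_q: "poly_curve (\<lambda>t. q \<circ> pr t)" if "q \<in> Sym m (ann w)" for q w
    using that by (rule poly_curve_Sym) (auto simp: ann_def intro: curve_l)
  have curve_qt: "poly_curve qt"
    unfolding qt_def[abs_def] by (intro poly_curve_add scaled curve_q[OF q1(1)] curve_q[OF q0_Sym])
  have curve_ft: "poly_curve ft"
    unfolding ft_def[abs_def] gt_def
    by (intro poly_curve_add scaled poly_curve_mult curve_qt curve_\<omega> poly_curve_const)
  have coord0: "PF_coord (\<omega> (vt 0), qt 0, ft 0) = (H, L, M)"
    by (simp add: PF_coord_def vt01 qt0 ft0 v0(2) q1(3) f1(3) perp_def)
  then have "(\<omega> (vt 0), qt 0, ft 0) \<in> ?W \<inter> PF_coord -` A"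
    using ft \<omega>_dual qt_ann Sym_ann_dual pt ptA by (simp add: subset_iff) blast
  then obtain pA where pA: "pA \<in> polyfun tscale" "pA (\<omega> (vt 0), qt 0, ft 0) \<noteq> 0"
    "{z \<in> ?W \<inter> PF_coord -` ?X. pA z \<noteq> 0} \<subseteq> ?W \<inter> PF_coord -` A"
    using A'(2) unfolding openin_zariski_subtopology by blast
  obtain r1 where r1: "\<And>t. pA (\<omega> (vt t), qt t, ft t) = poly r1 t"
    using polyfun_along_curve[where \<Phi> = "\<lambda>t. (\<omega> (vt t), qt t, ft t)", OF pA(1)]
      dual_tscale_along_curve[OF _ curve_\<omega> curve_qt curve_ft] by blast
  obtain r2 where r2: "\<And>t. \<delta> (ft t) = poly r2 t"
    using polyfun_along_curve[where \<Phi> = ft, OF polyfun_Sym[OF \<delta>(1)]]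
      dual_along_curve[OF _ curve_ft] by blast
  \<comment> \<open>The condition for staying in \<open>A\<close> holds at \<open>t = 0\<close>, the
    one for generality at \<open>t = 1\<close>. Both are nonvanishing conditions on polynomials in
    \<open>t\<close>, so they hold together somewhere.\<close>
  obtain t where t: "poly r1 t \<noteq> 0" "poly r2 t \<noteq> 0"
    using common_nonroot[of r1 0 r2 1] pA(2) \<delta>(2) r1 r2 ft1 by metis
  have \<delta>t: "\<delta> (ft t) \<noteq> 0" using t r2 by simp
  have "cone_vertex (ft t) (vt t)"
    by (rule cone_vertexI[OF qt_ann ft_qt])
  then obtain c' where "c' \<noteq> 0" "vt t = smul c' (v (ft t))" using v[OF ft \<delta>t _ vt_nz] by blast
  then have "perp (v (ft t)) = perp (vt t)" by (simp add: perp_smul)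
  then obtain u where u: "u \<in> perp (vt t)" "ft t u \<noteq> 0" using nz[OF ft \<delta>t] by blast
  \<comment> \<open>A point of the incidence needs a cone form that is nonzero on the hyperplane.
    There \<open>ft t\<close> is a multiple of \<open>qt t\<close> and does not vanish.\<close>
  have nz': "ft t \<noteq> 0" "res (perp (vt t)) (qt t) \<noteq> 0"
  proof -
    show "ft t \<noteq> 0" using u by (metis zero_fun_apply)
    have "qt t u \<noteq> 0" using u ft_qt[OF u(1)] by auto
    then have "res (perp (vt t)) (qt t) u \<noteq> 0" using u by (simp add: res_def)
    then show "res (perp (vt t)) (qt t) \<noteq> 0" by (metis zero_fun_apply)
  qed
  have "(perp (vt t), fspan {res (perp (vt t)) (qt t)}, fspan {ft t}) \<in> ?X"
    by (rule PF_pointsI[OF m0 vt_nz qt_ann nz'(2) ft nz'(1) ft_qt])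
  then have "PF_coord (\<omega> (vt t), qt t, ft t) \<in> ?X" by (simp add: PF_coord_def perp_def)
  then have "(\<omega> (vt t), qt t, ft t) \<in> {z \<in> ?W \<inter> PF_coord -` ?X. pA z \<noteq> 0}"
    using ft \<omega>_dual qt_ann Sym_ann_dual t(1) r1 by (simp add: subset_iff) blast
  with pA(3) have "PF_coord (\<omega> (vt t), qt t, ft t) \<in> A" by blast
  moreover have "rho (PF_coord (\<omega> (vt t), qt t, ft t)) = fspan {ft t}"
    by (simp add: PF_coord_def rho_def)
  ultimately show ?thesis using ft \<delta>t by blast
qed

end

section \<open>The inverse morphism\<close>

lemma dual_comp_polyfun:
  assumes "p \<in> polyfun s2" and "\<And>l. l \<in> dual s2 \<Longrightarrow> l \<circ> \<Phi> \<in> dual s1"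
  shows "p \<circ> \<Phi> \<in> polyfun s1"
  using polyfun_comp[OF assms(1), of \<Phi> s1] assms(2) polyfun_Sym[OF Sym_1] by blast

context darboux
begin

text \<open>The polar vector of \<open>H\<close> is a cone vertex of \<open>f\<close>, and this
  determines \<open>H\<close>. As \<open>f\<close> is not zero on \<open>H\<close>, the constant
  relating it to the cone form is nonzero, so the restriction of \<open>f\<close> spans
  \<open>L\<close>.\<close>

lemma PF_point_unique:
  assumes v: "\<And>w. cone_vertex f w \<Longrightarrow> w \<noteq> 0 \<Longrightarrow> \<exists>c. c \<noteq> 0 \<and> w = smul c v"
    and nz: "\<exists>u\<in>perp v. f u \<noteq> 0"
    and pt: "(H, L, fspan {f}) \<in> PF_points smul \<omega> m m"
  shows "H = perp v" and "L = fspan {res (perp v) f}"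
proof -
  have m0: "m > 0" using m by simp
  have "H \<in> hyperplanes smul" using pt by (simp add: PF_points_def Y_points_def)
  then obtain v0 where v0: "v0 \<noteq> 0" "H = perp v0" using hyperplane_perp by blast
  obtain q1 f1 c where q1: "q1 \<in> Sym m (ann v0)" "L = fspan {res H q1}"
    and f1: "f1 \<noteq> 0" "fspan {f} = fspan {f1}" and fq: "\<And>u. u \<in> H \<Longrightarrow> f1 u = c * q1 u"
    by (rule PF_pointsD[OF pt m0 v0]) (rule that; assumption)
  obtain c1 where c1: "c1 \<noteq> 0" "f = fscale c1 f1"
    using fspan_singleton_eq[OF f1(1) f1(2)[symmetric]] by blast
  have fq': "f u = (c1 * c) * q1 u" if "u \<in> H" for u
    using fq[OF that] by (simp add: c1(2))
  have "cone_vertex f v0"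
    by (rule cone_vertexI[OF q1(1)]) (simp only: fq' v0(2)[symmetric])
  then obtain c2 where "c2 \<noteq> 0" "v0 = smul c2 v" using v v0(1) by blast
  then show H: "H = perp v" using v0(2) by (simp add: perp_smul)
  obtain u where "u \<in> H" "f u \<noteq> 0" using nz H by blast
  then have "c1 * c \<noteq> 0" using fq' by auto
  moreover have "res H f = fscale (c1 * c) (res H q1)"
    using fq' by (simp add: res_def fun_eq_iff)
  ultimately show "L = fspan {res (perp v) f}"
    using q1(2) H fspan_singleton_fscale by metis
qed

theorem rho_birational: "birational_morphism (PF smul \<omega> m m) (B smul \<omega> m m) rho"
proof -
  let ?X = "PF_points smul \<omega> m m"
  let ?W = "dual smul \<times> Sym m (dual smul) \<times> Sym m (dual smul)"
  let ?PF = "coordinate_space tscale ?W PF_coord ?X"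
  let ?B = "coordinate_space fscale (Sym m (dual smul)) (\<lambda>f. fspan {f}) (rho ` ?X)"
  have PF: "PF smul \<omega> m m = ?PF" and B: "B smul \<omega> m m = ?B"
    by (simp_all add: PF_def B_def)
  obtain e \<delta> d v where \<delta>: "\<delta> \<in> Sym e (dual fscale)" "\<delta> f0 \<noteq> 0"
    and v: "\<And>l. l \<in> dual smul \<Longrightarrow> (\<lambda>f. l (v f)) \<in> Sym d (dual fscale)"
    and vertex: "\<And>f w. f \<in> Sym m (dual smul) \<Longrightarrow> \<delta> f \<noteq> 0 \<Longrightarrow> cone_vertex f w \<Longrightarrow> w \<noteq> 0 \<Longrightarrow>
       \<exists>c. c \<noteq> 0 \<and> w = smul c (v f)"
    and nz: "\<And>f. f \<in> Sym m (dual smul) \<Longrightarrow> \<delta> f \<noteq> 0 \<Longrightarrow> \<exists>u\<in>perp (v f). f u \<noteq> 0"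
    by (rule ex_generic) (rule that; assumption)
  define U' where "U' = {fspan {f} | f. f \<in> Sym m (dual smul) \<and> fspan {f} \<in> rho ` ?X \<and> \<delta> f \<noteq> 0}"
  define U where "U = {pt \<in> ?X. rho pt \<in> U'}"
  have U'X: "U' \<subseteq> rho ` ?X" by (auto simp: U'_def)
  have UX: "U \<subseteq> ?X" by (auto simp: U_def)
  have rhoU: "rho ` U = U'" using U'X by (auto simp: U_def)
  have line_nz: "f \<noteq> 0" if "fspan {f} \<in> rho ` ?X" for f
  proof
    assume "f = 0"
    obtain g where g: "g \<noteq> 0" "fspan {f} = fspan {g}"
      using \<open>fspan {f} \<in> rho ` ?X\<close> by (force simp: PF_points_def rho_def proj_def)
    then have "g \<in> fspan {f}" by (simp only: fs.span_base singletonI)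
    then show False using \<open>f = 0\<close> g(1) by (auto simp only: fs.span_singleton fs.scale_zero_right)
  qed
  \<comment> \<open>\<open>\<delta>\<close> is homogeneous, so its nonvanishing depends only on the
    line and not on the form chosen in it.\<close>
  have U'_iff: "fspan {f} \<in> U' \<longleftrightarrow> fspan {f} \<in> rho ` ?X \<and> \<delta> f \<noteq> 0" if f: "f \<in> Sym m (dual smul)" for f
  proof
    assume "fspan {f} \<in> U'"
    then obtain g where g: "fspan {f} = fspan {g}" "fspan {g} \<in> rho ` ?X" "\<delta> g \<noteq> 0"
      by (auto simp: U'_def)
    obtain c where c: "c \<noteq> 0" "f = fscale c g"
      using fspan_singleton_eq[OF line_nz[OF g(2)] g(1)[symmetric]] by blast
    have "\<delta> (fscale c g) = c ^ e * \<delta> g"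
      by (rule Sym_homogeneous[OF \<delta>(1)]) (simp add: dual_iff[OF vector_space_fscale])
    then have "\<delta> f \<noteq> 0" using c g(3) by simp
    then show "fspan {f} \<in> rho ` ?X \<and> \<delta> f \<noteq> 0" using g by simp
  qed (use f in \<open>auto simp: U'_def\<close>)
  have unique: "pt = (perp (v f), fspan {res (perp (v f)) f}, fspan {f})"
    if "pt \<in> ?X" "rho pt = fspan {f}" "f \<in> Sym m (dual smul)" "\<delta> f \<noteq> 0" for pt f
  proof -
    obtain H L M where pt: "pt = (H, L, M)" by (metis prod_cases3)
    with that have "(H, L, fspan {f}) \<in> ?X" by (simp add: rho_def)
    from PF_point_unique[OF vertex[OF that(3,4)] nz[OF that(3,4)] this] show ?thesis
      using pt that(2) by (simp add: rho_def)
  qed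
  have topPF: "topspace (zar ?PF) = ?X" and topB: "topspace (zar ?B) = rho ` ?X" by simp_all
  have openX: "openin (zar ?PF) ?X" and openRX: "openin (zar ?B) (rho ` ?X)"
    using openin_topspace[of "zar ?PF"] openin_topspace[of "zar ?B"] by simp_all
  define third :: "'v triple \<Rightarrow> 'v \<Rightarrow> complex" where "third = (\<lambda>(l, q, f). f)"
  have third: "r \<circ> third \<in> polyfun tscale" if "r \<in> polyfun fscale" for r
    using that
  proof (rule dual_comp_polyfun)
    fix l :: "('v \<Rightarrow> complex) \<Rightarrow> complex" assume "l \<in> dual fscale"
    then show "l \<circ> third \<in> dual tscale"
      by (auto simp: dual_iff[OF vector_space_fscale] dual_iff[OF vector_space_tscale] third_def tscale_def
          simp del: fscale_apply)
  qed
  have third_coord: "third w \<in> Sym m (dual smul) \<and> fspan {third w} = rho (PF_coord w)" if "w \<in> ?W" for w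
    using that by (auto simp: third_def PF_coord_def rho_def)
  have morph: "morphism ?PF ?B rho"
  proof -
    have "morphism (open_subspace ?PF ?X) (open_subspace ?B (rho ` ?X)) rho"
      by (rule morphism_coordinates[OF openX openRX third third_coord]) auto
    then show ?thesis by (simp only: open_subspace_topspace[OF topPF] open_subspace_topspace[OF topB])
  qed
  have openU': "openin (zar ?B) U'"
    unfolding openin_coordinate_space openin_zariski_subtopology
  proof (intro conjI U'X ballI)
    show "Sym m (dual smul) \<inter> (\<lambda>f. fspan {f}) -` U' \<subseteq>
        Sym m (dual smul) \<inter> (\<lambda>f. fspan {f}) -` rho ` ?X"
      using U'X by (intro Int_mono subset_refl vimage_mono)
    fix f assume f: "f \<in> Sym m (dual smul) \<inter> (\<lambda>f. fspan {f}) -` U'"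
    have sub: "{z \<in> Sym m (dual smul) \<inter> (\<lambda>f. fspan {f}) -` rho ` ?X. \<delta> z \<noteq> 0} \<subseteq>
        Sym m (dual smul) \<inter> (\<lambda>f. fspan {f}) -` U'"
    proof
      fix z assume "z \<in> {z \<in> Sym m (dual smul) \<inter> (\<lambda>f. fspan {f}) -` rho ` ?X. \<delta> z \<noteq> 0}"
      then have "z \<in> Sym m (dual smul)" "fspan {z} \<in> rho ` ?X" "\<delta> z \<noteq> 0" by auto
      with U'_iff[of z] show "z \<in> Sym m (dual smul) \<inter> (\<lambda>f. fspan {f}) -` U'" by simp
    qed
    have "\<delta> f \<noteq> 0" using f U'_iff[of f] by simp
    with sub show "\<exists>p\<in>polyfun fscale. p f \<noteq> 0 \<and>
        {z \<in> Sym m (dual smul) \<inter> (\<lambda>f. fspan {f}) -` rho ` ?X. p z \<noteq> 0} \<subseteq>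
        Sym m (dual smul) \<inter> (\<lambda>f. fspan {f}) -` U'"
      by (intro bexI[of _ \<delta>] polyfun_Sym[OF \<delta>(1)] conjI)
  qed
  have preimage: "openin (zar ?PF) {pt \<in> ?X. rho pt \<in> T}" if "openin (zar ?B) T" for T
  proof -
    have "continuous_map (zar ?PF) (zar ?B) rho" using morph by (simp add: morphism_def)
    from openin_continuous_map_preimage[OF this that] show ?thesis by simp
  qed
  have openU: "openin (zar ?PF) U"
    unfolding U_def by (rule preimage[OF openU'])
  have meets: "U \<inter> A \<noteq> {}" if A: "openin (zar ?PF) A" "A \<noteq> {}" for A
  proof -
    obtain pt where pt: "pt \<in> A" using A by blast
    have A': "openin (zar (PF smul \<omega> m m)) A" by (simp only: PF A(1))
    have "\<exists>pt'\<in>A. \<exists>f\<in>Sym m (dual smul). \<delta> f \<noteq> 0 \<and> rho pt' = fspan {f}"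
      by (rule PF_dense[OF \<delta> vertex nz A' pt])
    then obtain pt' f where pt': "pt' \<in> A" and f: "f \<in> Sym m (dual smul)" "\<delta> f \<noteq> 0" "rho pt' = fspan {f}"
      by blast
    have "A \<subseteq> ?X" using openin_subset[OF A(1)] topPF by simp
    with pt' have X: "pt' \<in> ?X" by blast
    then have "rho pt' \<in> rho ` ?X" by (rule imageI)
    then have "rho pt' \<in> U'" using U'_iff[OF f(1)] f by simp
    with X pt' have "pt' \<in> U \<inter> A" by (simp add: U_def)
    then show ?thesis by blast
  qed
  have denseU: "dense_open ?PF U"
    unfolding dense_open_def dense_intersects_open using openU meets by blast
  \<comment> \<open>Density in the image follows from density in the incidence, because a nonempty
    open set of the image has a nonempty open preimage.\<close>
  have "U' \<inter> T \<noteq> {}" if T: "openin (zar ?B) T" "T \<noteq> {}" for T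
  proof -
    have "T \<subseteq> rho ` ?X" using openin_subset[OF T(1)] topB by simp
    then have "{pt \<in> ?X. rho pt \<in> T} \<noteq> {}" using T(2) by blast
    from meets[OF preimage[OF T(1)] this] show ?thesis by (auto simp: U_def)
  qed
  then have denseU': "dense_open ?B U'"
    unfolding dense_open_def dense_intersects_open using openU' by blast
  define \<psi> where "\<psi> = inv_into ?X rho"
  have \<psi>: "\<psi> M \<in> ?X" "rho (\<psi> M) = M" if "M \<in> U'" for M
  proof -
    have "M \<in> rho ` ?X" using that U'X by (rule rev_subsetD)
    then show "\<psi> M \<in> ?X" "rho (\<psi> M) = M"
      unfolding \<psi>_def by (rule inv_into_into, rule f_inv_into_f)
  qed
  have \<psi>_rho: "\<psi> (rho pt) = pt" if "pt \<in> U" for pt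
  proof -
    from that obtain f where f: "rho pt = fspan {f}" "f \<in> Sym m (dual smul)" "\<delta> f \<noteq> 0" "pt \<in> ?X" "rho pt \<in> U'"
      by (auto simp: U_def U'_def)
    show ?thesis
      using unique[of pt f] unique[of "\<psi> (rho pt)" f] \<psi>[OF f(5)] f by simp
  qed
  \<comment> \<open>The inverse in coordinates. The middle entry can be \<open>f\<close> itself,
    since the restriction of \<open>f\<close> to the hyperplane spans the line of the cone
    form.\<close>
  define \<Phi> where "\<Phi> f = (\<omega> (v f), f, f)" for f
  have \<Phi>: "r \<circ> \<Phi> \<in> polyfun fscale" if "r \<in> polyfun tscale" for r
    using that
  proof (rule polyfun_comp)
    fix l :: "'v triple \<Rightarrow> complex" assume l: "l \<in> dual tscale"
    have add: "l (a + b) = l a + l b" and sc: "l (tscale c a) = c * l a" for a b c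
      using l unfolding dual_iff[OF vector_space_tscale] by blast+
    \<comment> \<open>The first entry of \<open>\<Phi> f\<close> is linear in the vector
      \<open>v f\<close>, so the defining property of \<open>v\<close> makes this contribution
      polynomial in \<open>f\<close>.\<close>
    have l1: "(\<lambda>w. l (\<omega> w, 0, 0)) \<in> dual smul"
    proof -
      have "\<omega> (a + b) = \<omega> a + \<omega> b" "\<omega> (smul c a) = fscale c (\<omega> a)" for a b c
        by (simp_all add: fun_eq_iff)
      then have "((\<omega> (a + b), 0, 0) :: 'v triple) = (\<omega> a, 0, 0) + (\<omega> b, 0, 0)"
        "(\<omega> (smul c a), 0, 0) = tscale c (\<omega> a, 0, 0)" for a b c
        by (simp_all add: tscale_def del: fscale_apply)
      then show ?thesis unfolding dual_iff' by (simp only: add sc) simp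
    qed
    have l2: "(\<lambda>f. l (0, f, f)) \<in> dual fscale"
      unfolding dual_iff[OF vector_space_fscale]
      using add[of "(0, _, _)" "(0, _, _)"] sc[of _ "(0, _, _)"]
      by (simp add: tscale_def del: fscale_apply)
    have "l \<circ> \<Phi> = (\<lambda>f. l (\<omega> (v f), 0, 0)) + (\<lambda>f. l (0, f, f))"
    proof
      fix f
      show "(l \<circ> \<Phi>) f = ((\<lambda>f. l (\<omega> (v f), 0, 0)) + (\<lambda>f. l (0, f, f))) f"
        using add[of "(\<omega> (v f), 0, 0)" "(0, f, f)"] by (simp add: \<Phi>_def)
    qed
    then show "l \<circ> \<Phi> \<in> polyfun fscale"
      using polyfun_add[OF polyfun_Sym[OF v[OF l1]] polyfun_Sym[OF Sym_1[OF l2]]] by (simp only:)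
  qed
  have \<Phi>_coord: "\<Phi> f \<in> ?W \<and> PF_coord (\<Phi> f) = \<psi> (fspan {f})"
    if f: "f \<in> Sym m (dual smul)" and U': "fspan {f} \<in> U'" for f
  proof -
    have "\<delta> f \<noteq> 0" using U'_iff[OF f] U' by blast
    from unique[OF \<psi>[OF U'] f this] show ?thesis
      using f \<omega>_dual by (simp add: \<Phi>_def PF_coord_def perp_def)
  qed
  have \<psi>U: "\<psi> ` U' \<subseteq> U" using \<psi> by (auto simp: U_def)
  have "isomorphism (open_subspace ?PF U) (open_subspace ?B U') rho"
    unfolding isomorphism_def
  proof (intro conjI exI[of _ \<psi>])
    show "morphism (open_subspace ?PF U) (open_subspace ?B U') rho"
      by (rule morphism_coordinates[OF openU openU' third third_coord]) (use rhoU in auto)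
    show "morphism (open_subspace ?B U') (open_subspace ?PF U) \<psi>"
      by (rule morphism_coordinates[OF openU' openU \<Phi> \<Phi>_coord \<psi>U])
    show "\<forall>x\<in>topspace (zar (open_subspace ?PF U)). \<psi> (rho x) = x"
      using \<psi>_rho by (simp add: open_subspace_def)
    show "\<forall>y\<in>topspace (zar (open_subspace ?B U')). rho (\<psi> y) = y"
      using \<psi> by (simp add: open_subspace_def)
  qed
  with morph denseU denseU' show ?thesis
    unfolding birational_morphism_def PF B by blast
qed

end

theorem proposition8p3:
  fixes smul :: "complex \<Rightarrow> 'v::ab_group_add \<Rightarrow> 'v"
    and \<omega> :: "'v \<Rightarrow> 'v \<Rightarrow> complex"
    and n m :: nat
  assumes "vector_space smul"
    and "vector_space.dim smul UNIV = 2 * n"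
    and "symplectic_form smul \<omega>"
    and "n \<ge> 3" and "m \<ge> 3"
  shows "birational_morphism (PF smul \<omega> m m) (B smul \<omega> m m) rho"
proof -
  interpret symplectic smul \<omega>
    using assms(1,3) by (simp add: symplectic_def symplectic_axioms_def)
  have "n > 0" using assms(4) by simp
  then obtain k E F where "darboux_system k E F" "k \<ge> n"
    "\<And>w. w = darboux_vec k E F (\<lambda>i. \<omega> w (F i)) (\<lambda>i. \<omega> (E i) w)"
    by (rule ex_darboux[OF assms(2)]) (rule that; assumption)
  then interpret darboux smul \<omega> k m E F
    using assms(4,5) by unfold_locales auto
  show ?thesis by (rule rho_birational)
qed

end
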